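(* Let $\xi\in C_c^\infty[0,\infty[$ with $\xi=1$ near $0$. For every $m\in\mathbb{C}$ with $|\mathrm{Re}(m)|<1$, $$\mathcal{D}(H_m)=\mathcal{H}_0^2(\mathbb{R}_+)+\mathbb{C}\,x^{\frac12+m}\xi.$$ Besides, if $m_1\neq m_2$ and $|\mathrm{Re}(m_i)|<1$ for $i=1,2$, then $\mathcal{D}(H_{m_1})\neq\mathcal{D}(H_{m_2})$.
   Context: $\mathbb{R}_+=]0,\infty[$; all operators act in the complex Hilbert space $L^2(\mathbb{R}_+)$, and $\mathcal{D}(T)$ is the domain of $T$. For $\alpha\in\mathbb{C}$, $L_\alpha$ is the differential expression $L_\alpha=-\frac{d^2}{dx^2}+\left(\alpha-\frac14\right)\frac1{x^2}$ (in the distributional sense on $\mathbb{R}_+$). $L_\alpha^{\max}$ is the operator given by $L_\alpha$ on $\mathcal{D}(L_\alpha^{\max})=\{f\in L^2(\mathbb{R}_+) : L_\alpha f\in L^2(\mathbb{R}_+)\}$, and $L_\alpha^{\min}$ is the closure of the restriction of $L_\alpha^{\max}$ to $C_c^\infty(\mathbb{R}_+)$. For $\mathrm{Re}(m)>-1$, $H_m$ is the restriction of $L_{m^2}^{\max}$ to $\mathcal{D}(H_m):=\mathcal{D}(L_{m^2}^{\min})+\mathbb{C}\,x^{\frac12+m}\xi$, where $\xi$ is any $C_c^\infty[0,\infty[$ function with $\xi=1$ near $0$. $\mathcal{H}^2(\mathbb{R}_+)=\{f\in L^2(\mathbb{R}_+) : f''\in L^2(\mathbb{R}_+)\}$ and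 $\mathcal{H}^2_0(\mathbb{R}_+)=\{f\in\mathcal{H}^2(\mathbb{R}_+) : f(0)=f'(0)=0\}$. *)

theory Defs
  imports "HOL-Analysis.Analysis"
begin

text \<open>
  Elements of \<open>L\<^sup>2(\<real>\<^sub>+)\<close>, with \<open>\<real>\<^sub>+ = ]0,\<infinity>[\<close>, are represented by functions; values outside
  \<open>\<real>\<^sub>+\<close> never matter. Every set of \<open>L\<^sup>2\<close>-elements below is closed under almost-everywhere
  equality on \<open>\<real>\<^sub>+\<close>, so equality of such sets is equality of the sets of classes.
\<close>

abbreviation Rplus :: "real set" where
  "Rplus \<equiv> {0<..}"

definition ae_eq :: "(real \<Rightarrow> complex) \<Rightarrow> (real \<Rightarrow> complex) \<Rightarrow> bool" where
  "ae_eq f g \<longleftrightarrow> (AE x in lebesgue_on Rplus. f x = g x)"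

definition L2 :: "(real \<Rightarrow> complex) set" where
  "L2 = {f. f \<in> borel_measurable (lebesgue_on Rplus) \<and>
            integrable (lebesgue_on Rplus) (\<lambda>x. (cmod (f x))\<^sup>2)}"

definition L2_norm :: "(real \<Rightarrow> complex) \<Rightarrow> real" where
  "L2_norm f = sqrt (LINT x|lebesgue_on Rplus. (cmod (f x))\<^sup>2)"

text \<open>Derivatives are taken within \<open>S\<close>, hence one-sided at \<open>0\<close> for \<open>S = [0,\<infinity>[\<close>.\<close>

definition smooth_on :: "real set \<Rightarrow> (real \<Rightarrow> complex) \<Rightarrow> bool" where
  "smooth_on S f \<longleftrightarrow> (\<exists>D :: nat \<Rightarrow> real \<Rightarrow> complex.
     (\<forall>x\<in>S. D 0 x = f x) \<and>
     (\<forall>n. \<forall>x\<in>S. (D n has_vector_derivative D (Suc n) x) (at x within S)))"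

definition Cc_smooth :: "real set \<Rightarrow> (real \<Rightarrow> complex) set" where
  "Cc_smooth S = {f. smooth_on S f \<and>
     compact (closure {x\<in>S. f x \<noteq> 0}) \<and> closure {x\<in>S. f x \<noteq> 0} \<subseteq> S}"

text \<open>
  Distributions on \<open>\<real>\<^sub>+\<close> are represented as functionals, of which only the values on
  \<open>Cc_smooth Rplus\<close> are meaningful. The pairing is bilinear (no complex conjugation).
\<close>

type_synonym distr = "(real \<Rightarrow> complex) \<Rightarrow> complex"

definition distr_of :: "(real \<Rightarrow> complex) \<Rightarrow> distr" where
  "distr_of f = (\<lambda>\<phi>. LINT x|lebesgue_on Rplus. f x * \<phi> x)"

definition distr_deriv :: "distr \<Rightarrow> distr" where
  "distr_deriv T = (\<lambda>\<phi>. - T (\<lambda>x. vector_derivative \<phi> (at x)))"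

definition distr_mult :: "(real \<Rightarrow> complex) \<Rightarrow> distr \<Rightarrow> distr" where
  "distr_mult u T = (\<lambda>\<phi>. T (\<lambda>x. u x * \<phi> x))"

definition distr_eq :: "distr \<Rightarrow> distr \<Rightarrow> bool" where
  "distr_eq T U \<longleftrightarrow> (\<forall>\<phi>\<in>Cc_smooth Rplus. T \<phi> = U \<phi>)"

definition L_expr :: "complex \<Rightarrow> distr \<Rightarrow> distr" where
  "L_expr \<alpha> T = (\<lambda>\<phi>. - distr_deriv (distr_deriv T) \<phi>
      + distr_mult (\<lambda>x. (\<alpha> - 1/4) * (1 / (complex_of_real x)\<^sup>2)) T \<phi>)"

text \<open>Operators in \<open>L\<^sup>2(\<real>\<^sub>+)\<close> are given by their graphs; the domain of \<open>T\<close> is \<open>Domain T\<close>.\<close>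

type_synonym L2_operator = "((real \<Rightarrow> complex) \<times> (real \<Rightarrow> complex)) set"

definition op_restrict :: "L2_operator \<Rightarrow> (real \<Rightarrow> complex) set \<Rightarrow> L2_operator" where
  "op_restrict T D = {(f, g). (f, g) \<in> T \<and> f \<in> D}"

definition op_closure :: "L2_operator \<Rightarrow> L2_operator" where
  "op_closure T = {(f, g). f \<in> L2 \<and> g \<in> L2 \<and>
     (\<forall>e>0. \<exists>(f', g')\<in>T. L2_norm (\<lambda>x. f x - f' x) < e \<and> L2_norm (\<lambda>x. g x - g' x) < e)}"

definition L_max :: "complex \<Rightarrow> L2_operator" where
  "L_max \<alpha> = {(f, g). f \<in> L2 \<and> g \<in> L2 \<and> distr_eq (L_expr \<alpha> (distr_of f)) (distr_of g)}"

definition L_min :: "complex \<Rightarrow> L2_operator" where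
  "L_min \<alpha> = op_closure (op_restrict (L_max \<alpha>) {f. \<exists>\<phi>\<in>Cc_smooth Rplus. ae_eq f \<phi>})"

text \<open>The subspace \<open>A + \<complex> u\<close>.\<close>

definition plus_span :: "(real \<Rightarrow> complex) set \<Rightarrow> (real \<Rightarrow> complex) \<Rightarrow> (real \<Rightarrow> complex) set" where
  "plus_span A u = {f. \<exists>g\<in>A. \<exists>c. ae_eq f (\<lambda>x. g x + c * u x)}"

definition cutoffs :: "(real \<Rightarrow> complex) set" where
  "cutoffs = {\<xi> \<in> Cc_smooth {0..}. \<exists>\<epsilon>>0. \<forall>x. 0 \<le> x \<and> x < \<epsilon> \<longrightarrow> \<xi> x = 1}"

definition cut_power :: "complex \<Rightarrow> (real \<Rightarrow> complex) \<Rightarrow> real \<Rightarrow> complex" where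
  "cut_power m \<xi> = (\<lambda>x. complex_of_real x powr (1/2 + m) * \<xi> x)"

text \<open>
  The operator \<open>H\<^sub>m\<close>, meant for \<open>Re m > -1\<close>. It does not depend on the choice of the
  cutoff \<open>\<eta>\<close>, which is kept as an explicit parameter.
\<close>

definition H_op :: "(real \<Rightarrow> complex) \<Rightarrow> complex \<Rightarrow> L2_operator" where
  "H_op \<eta> m = op_restrict (L_max (m\<^sup>2)) (plus_span (Domain (L_min (m\<^sup>2))) (cut_power m \<eta>))"

definition H2 :: "(real \<Rightarrow> complex) set" where
  "H2 = {f \<in> L2. \<exists>g\<in>L2. distr_eq (distr_deriv (distr_deriv (distr_of f))) (distr_of g)}"

text \<open>
  An element of \<open>H2\<close> has a unique representative that is \<open>C\<^sup>1\<close> on \<open>[0,\<infinity>[\<close>; the boundary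
  values \<open>f(0)\<close> and \<open>f'(0)\<close> are those of this representative.
\<close>

definition H2_0 :: "(real \<Rightarrow> complex) set" where
  "H2_0 = {f \<in> H2. \<exists>h h'. ae_eq f h \<and>
     (\<forall>x\<in>{0..}. (h has_vector_derivative h' x) (at x within {0..})) \<and>
     continuous_on {0..} h' \<and> h 0 = 0 \<and> h' 0 = 0}"

end

(*
  Write prim for integration from 0 and prim2 for its square. On L^2 the weighted Hardy operators
  g |-> x^(-1-b) prim (t^b g) are bounded for Re b > -1/2 (Schur's test). Hence prim2 G / x^2 is in L^2 for
  G in L^2, and the space H2_0 consists exactly of the L^2 functions of the form prim2 G.
  For |Re m| < 1 the expression L = - (d/dx + b/x) (d/dx - b/x), b = 1/2 + m, is inverted on test
  functions by two Hardy operators, so that phi / x^2, and therefore phi'', is controlled by L phi in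
  L^2; this gives D(L_min) <= H2_0. Conversely, cutting off prim2 psi at infinity, with psi a test
  function close to G, approximates prim2 G by test functions in the graph norm, Hardy's inequality
  absorbing the derivatives of the cutoff.
  For the second claim, if x^(1/2+m1) lies in H2_0 + C x^(1/2+m2) near 0, then prim2 G = o(x^(1/2+m1))
  gives c x^(m2-m1) --> 1, and replacing x by q x shows q^(m2-m1) = 1 for all q > 0, so m1 = m2.
*)
theory Submission
  imports Defs
begin

section \<open>Square-integrable functions on the half-line\<close>

text \<open>On the unbounded half-line L phi does not control phi in norm, but it does control phi /
  x^2: \<open>hardy \<beta>\<close> commutes with dilations, and phi / x^2, prim2 G / x^2 and the
  inverse of L divided by x^2 are all compositions of two such operators. The condition |Re m| < 1
  makes both exponents 1/2 + m and 1/2 - m admissible. The price is that a graph-norm limit arrives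
  in two modes, phi in L^2 and phi / x^2 in L^2, which have to be matched almost everywhere. All
  bump functions come from the cutoff that the statement supplies: a difference \<xi>(c x) - \<xi>(d
  x) of two dilates is a test function equal to 1 on a prescribed interval. Density of test
  functions therefore needs no convolution; a Weierstrass polynomial times such a plateau is enough.
  This is why even general facts such as the fundamental lemma live in the locale of a cutoff. In
  the approximation of prim2 G the cutoff radius has to be fixed before the test function psi,
  because prim2 (G - psi) is small only relative to x^2.\<close>

abbreviation LR :: "real measure" where
  "LR \<equiv> lebesgue_on Rplus"

lemma space_LR [simp]: "space LR = Rplus"
  by simp

lemma borel_measurable_LR_I: "f \<in> borel_measurable borel \<Longrightarrow> f \<in> borel_measurable LR"
  by (intro measurable_restrict_space1 measurable_completion) (simp add: measurable_lborel2)

lemma continuous_measurable_LR: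
  fixes f :: "real \<Rightarrow> complex"
  assumes "continuous_on Rplus f"
  shows "f \<in> borel_measurable LR"
  by (rule continuous_imp_measurable_on_sets_lebesgue[OF assms]) auto

lemma AE_LR_everywhere: "(\<And>x. 0 < x \<Longrightarrow> P x) \<Longrightarrow> AE x in LR. P x"
  by (rule AE_I2) simp

text \<open>Required by Tonelli's theorem in the Hardy inequality and by the measurability of
  integrals depending on a parameter.\<close>

lemma sigma_finite_LR: "sigma_finite_measure LR"
proof -
  have "sigma_finite_measure (lebesgue :: real measure)"
  proof
    let ?A = "range (\<lambda>n::nat. {- real n..real n})"
    have "x \<in> \<Union>?A" for x :: real
    proof -
      obtain n where "\<bar>x\<bar> \<le> real n"
        using real_arch_simple by blast
      then show ?thesis
        by (intro UnionI[of "{- real n..real n}"]) auto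
    qed
    then have "\<Union>?A = space lebesgue"
      by auto
    moreover have "emeasure lebesgue a \<noteq> \<infinity>" if "a \<in> ?A" for a :: "real set"
      using that by auto
    ultimately show "\<exists>A. countable A \<and> A \<subseteq> sets (lebesgue :: real measure) \<and> \<Union>A = space lebesgue \<and>
        (\<forall>a\<in>A. emeasure lebesgue a \<noteq> \<infinity>)"
      by (intro exI[of _ ?A] conjI ballI) auto
  qed
  then show ?thesis
    by (rule sigma_finite_measure_restrict_space) auto
qed

lemma L2_measurable: "f \<in> L2 \<Longrightarrow> f \<in> borel_measurable LR"
  by (simp add: L2_def)

lemma L2_integrable_sq: "f \<in> L2 \<Longrightarrow> integrable LR (\<lambda>x. (cmod (f x))\<^sup>2)"
  by (simp add: L2_def)

lemma L2_norm_nonneg [simp]: "0 \<le> L2_norm f"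
  unfolding L2_norm_def by (intro real_sqrt_ge_zero integral_nonneg_AE) auto

lemma L2_norm_sq: "(L2_norm f)\<^sup>2 = (LINT x|LR. (cmod (f x))\<^sup>2)"
  unfolding L2_norm_def by (intro real_sqrt_pow2 integral_nonneg_AE) auto

lemma L2_bound:
  assumes "f \<in> borel_measurable LR" "g \<in> L2" "AE x in LR. cmod (f x) \<le> C * cmod (g x)"
  shows "f \<in> L2"
proof -
  have "integrable LR (\<lambda>x. (cmod (f x))\<^sup>2)"
  proof (rule Bochner_Integration.integrable_bound)
    show "integrable LR (\<lambda>x. C\<^sup>2 * (cmod (g x))\<^sup>2)"
      using L2_integrable_sq[OF assms(2)] by simp
    show "(\<lambda>x. (cmod (f x))\<^sup>2) \<in> borel_measurable LR"
      using assms(1) by measurable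
    show "AE x in LR. norm ((cmod (f x))\<^sup>2) \<le> norm (C\<^sup>2 * (cmod (g x))\<^sup>2)"
      using assms(3)
    proof eventually_elim
      case (elim x)
      then have "(cmod (f x))\<^sup>2 \<le> (C * cmod (g x))\<^sup>2"
        by (intro power_mono) auto
      then show ?case
        by (simp add: power_mult_distrib)
    qed
  qed
  then show ?thesis
    using assms(1) by (simp add: L2_def)
qed

lemma L2_norm_mono:
  assumes "f \<in> borel_measurable LR" "g \<in> L2" "0 \<le> C" "AE x in LR. cmod (f x) \<le> C * cmod (g x)"
  shows "L2_norm f \<le> C * L2_norm g"
proof -
  have f: "f \<in> L2"
    using assms L2_bound by blast
  have "(L2_norm f)\<^sup>2 \<le> (LINT x|LR. C\<^sup>2 * (cmod (g x))\<^sup>2)"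
    unfolding L2_norm_sq
  proof (rule integral_mono_AE)
    show "AE x in LR. (cmod (f x))\<^sup>2 \<le> C\<^sup>2 * (cmod (g x))\<^sup>2"
      using assms(4)
    proof eventually_elim
      case (elim x)
      then have "(cmod (f x))\<^sup>2 \<le> (C * cmod (g x))\<^sup>2"
        by (intro power_mono) auto
      then show ?case
        by (simp add: power_mult_distrib)
    qed
  qed (use f assms L2_integrable_sq in auto)
  also have "\<dots> = (C * L2_norm g)\<^sup>2"
    by (simp add: power_mult_distrib L2_norm_sq)
  finally show ?thesis
    using assms(3) by (intro power2_le_imp_le[of "L2_norm f"]) auto
qed

lemma L2_cong:
  assumes "f \<in> borel_measurable LR" "g \<in> L2" "ae_eq f g"
  shows "f \<in> L2"
  using assms unfolding ae_eq_def by (intro L2_bound[of f g 1]) (auto elim: eventually_mono)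

lemma L2_norm_cong:
  assumes "ae_eq f g" "f \<in> borel_measurable LR" "g \<in> borel_measurable LR"
  shows "L2_norm f = L2_norm g"
proof -
  have "(LINT x|LR. (cmod (f x))\<^sup>2) = (LINT x|LR. (cmod (g x))\<^sup>2)"
    using assms(1) unfolding ae_eq_def
    by (intro integral_cong_AE) (use assms in \<open>auto elim!: eventually_mono\<close>)
  then show ?thesis
    by (simp add: L2_norm_def)
qed

text \<open>Rests on the completeness of Lebesgue measure: a change on a null set keeps
  measurability. It makes \<open>L2\<close> closed under \<open>ae_eq\<close>.\<close>

lemma ae_eq_measurable:
  assumes "ae_eq f g" "g \<in> borel_measurable LR"
  shows "f \<in> borel_measurable LR"
proof -
  have "AE x in lebesgue. x \<in> Rplus \<longrightarrow> f x = g x"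
    using assms(1) unfolding ae_eq_def by (subst (asm) AE_restrict_space_iff) auto
  then obtain N where N: "N \<in> null_sets lebesgue" "{x \<in> space lebesgue. \<not> (x \<in> Rplus \<longrightarrow> f x = g x)} \<subseteq> N"
    by (auto simp: eventually_ae_filter)
  then have "negligible N" "\<And>x. x \<in> Rplus - N \<Longrightarrow> g x = f x"
    by (auto simp: negligible_iff_null_sets)
  moreover have "g measurable_on Rplus"
    using assms(2) by (simp add: measurable_on_iff_borel_measurable)
  ultimately have "f measurable_on Rplus"
    by (metis measurable_on_spike)
  then show ?thesis
    by (simp add: measurable_on_iff_borel_measurable)
qed

lemma L2_ae_cong: "ae_eq f g \<Longrightarrow> g \<in> L2 \<Longrightarrow> f \<in> L2"
  using L2_cong L2_measurable ae_eq_measurable by blast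

lemma ae_eq_trans: "ae_eq f g \<Longrightarrow> ae_eq g h \<Longrightarrow> ae_eq f h"
  unfolding ae_eq_def by (auto elim: eventually_elim2)

lemma ae_eqI: "(\<And>x. 0 < x \<Longrightarrow> f x = g x) \<Longrightarrow> ae_eq f g"
  unfolding ae_eq_def by (rule AE_LR_everywhere)

lemma L2_scale: "f \<in> L2 \<Longrightarrow> (\<lambda>x. c * f x) \<in> L2"
  by (rule L2_bound[of _ f "cmod c"]) (auto simp: norm_mult dest: L2_measurable)

lemma L2_cnj: "f \<in> L2 \<Longrightarrow> (\<lambda>x. cnj (f x)) \<in> L2"
  unfolding L2_def mem_Collect_eq complex_mod_cnj
  by (auto intro: measurable_compose[OF _ borel_measurable_continuous_onI[of cnj]] continuous_intros)

lemma L2_add: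
  assumes "f \<in> L2" "g \<in> L2"
  shows "(\<lambda>x. f x + g x) \<in> L2"
proof -
  have m: "(\<lambda>x. f x + g x) \<in> borel_measurable LR"
    using assms by (intro borel_measurable_add L2_measurable)
  have "integrable LR (\<lambda>x. (cmod (f x + g x))\<^sup>2)"
  proof (rule Bochner_Integration.integrable_bound)
    show "integrable LR (\<lambda>x. 2 * (cmod (f x))\<^sup>2 + 2 * (cmod (g x))\<^sup>2)"
      using assms by (auto intro!: L2_integrable_sq Bochner_Integration.integrable_add)
    have "(cmod (f x + g x))\<^sup>2 \<le> 2 * (cmod (f x))\<^sup>2 + 2 * (cmod (g x))\<^sup>2" for x
    proof -
      have "(cmod (f x + g x))\<^sup>2 \<le> (cmod (f x) + cmod (g x))\<^sup>2"
        by (intro power_mono norm_triangle_ineq) auto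
      also have "\<dots> \<le> 2 * (cmod (f x))\<^sup>2 + 2 * (cmod (g x))\<^sup>2"
        using sum_squares_bound[of "cmod (f x)" "cmod (g x)"] by (simp add: power2_sum)
      finally show ?thesis .
    qed
    then show "AE x in LR. norm ((cmod (f x + g x))\<^sup>2) \<le> norm (2 * (cmod (f x))\<^sup>2 + 2 * (cmod (g x))\<^sup>2)"
      by (intro AE_I2) auto
  qed (use m in measurable)
  with m show ?thesis
    by (simp add: L2_def)
qed

lemma L2_diff: "f \<in> L2 \<Longrightarrow> g \<in> L2 \<Longrightarrow> (\<lambda>x. f x - g x) \<in> L2"
  using L2_add[of f "\<lambda>x. -1 * g x"] L2_scale[of g "-1"] by simp

lemma L2_norm_scale: "L2_norm (\<lambda>x. c * f x) = cmod c * L2_norm f"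
  by (simp add: L2_norm_def norm_mult power_mult_distrib real_sqrt_mult)

lemma L2_mult_integrable:
  assumes "f \<in> L2" "g \<in> L2"
  shows "integrable LR (\<lambda>x. f x * g x)"
proof (rule Bochner_Integration.integrable_bound)
  show "integrable LR (\<lambda>x. (cmod (f x))\<^sup>2 + (cmod (g x))\<^sup>2)"
    using assms by (auto intro!: L2_integrable_sq Bochner_Integration.integrable_add)
  show "(\<lambda>x. f x * g x) \<in> borel_measurable LR"
    using assms by (intro borel_measurable_times L2_measurable)
  have "cmod (f x) * cmod (g x) \<le> (cmod (f x))\<^sup>2 + (cmod (g x))\<^sup>2" for x
  proof -
    have "2 * (cmod (f x) * cmod (g x)) \<le> (cmod (f x))\<^sup>2 + (cmod (g x))\<^sup>2" "0 \<le> cmod (f x) * cmod (g x)"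
      using sum_squares_bound[of "cmod (f x)" "cmod (g x)"] by (auto simp: mult.assoc)
    then show ?thesis
      by linarith
  qed
  then show "AE x in LR. norm (f x * g x) \<le> norm ((cmod (f x))\<^sup>2 + (cmod (g x))\<^sup>2)"
    by (intro AE_I2) (auto simp: norm_mult)
qed

text \<open>Cauchy--Schwarz, by optimising \<open>2 |f g| \<le> t |f|\<^sup>2 + |g|\<^sup>2 / t\<close> over \<open>t > 0\<close>.\<close>

lemma L2_Cauchy_Schwarz_abs:
  assumes "f \<in> L2" "g \<in> L2"
  shows "(LINT x|LR. cmod (f x) * cmod (g x)) \<le> L2_norm f * L2_norm g"
proof -
  define I where "I = (LINT x|LR. cmod (f x) * cmod (g x))"
  have int: "integrable LR (\<lambda>x. cmod (f x) * cmod (g x))"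
    using integrable_norm[OF L2_mult_integrable[OF assms]] by (simp add: norm_mult)
  have *: "2 * I \<le> t * (L2_norm f)\<^sup>2 + (L2_norm g)\<^sup>2 / t" if "t > 0" for t
  proof -
    have "(LINT x|LR. 2 * (cmod (f x) * cmod (g x))) \<le>
        (LINT x|LR. t * (cmod (f x))\<^sup>2 + (cmod (g x))\<^sup>2 / t)"
    proof (rule integral_mono)
      fix x
      have "0 \<le> (sqrt t * cmod (f x) - cmod (g x) / sqrt t)\<^sup>2"
        by simp
      then show "2 * (cmod (f x) * cmod (g x)) \<le> t * (cmod (f x))\<^sup>2 + (cmod (g x))\<^sup>2 / t"
        using that by (simp add: power2_diff power_mult_distrib power_divide)
    qed (use int assms in \<open>auto intro!: L2_integrable_sq Bochner_Integration.integrable_add\<close>)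
    then show ?thesis
      using assms by (simp add: I_def L2_norm_sq L2_integrable_sq int)
  qed
  \<comment> \<open>The optimal t is the quotient of the norms; adding d to both keeps it defined
    when a norm vanishes, and d tends to 0 afterwards.\<close>
  have "I \<le> (L2_norm f + d) * (L2_norm g + d)" if "d > 0" for d
  proof -
    let ?F = "L2_norm f + d" and ?G = "L2_norm g + d"
    have pos: "?F > 0" "?G > 0"
      using that by (auto intro: add_nonneg_pos)
    have "2 * I \<le> ?G / ?F * (L2_norm f)\<^sup>2 + (L2_norm g)\<^sup>2 / (?G / ?F)"
      using pos by (intro *) simp
    also have "\<dots> \<le> ?G / ?F * ?F\<^sup>2 + ?G\<^sup>2 / (?G / ?F)"
      using pos that by (intro add_mono mult_left_mono divide_right_mono power_mono) auto
    also have "\<dots> = 2 * (?F * ?G)"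
      using pos by (simp add: power2_eq_square)
    finally show ?thesis by simp
  qed
  then have "eventually (\<lambda>d. I \<le> (L2_norm f + d) * (L2_norm g + d)) (at_right 0)"
    by (intro eventually_at_rightI[of 0 1]) auto
  moreover have "((\<lambda>d. (L2_norm f + d) * (L2_norm g + d)) \<longlongrightarrow> (L2_norm f + 0) * (L2_norm g + 0)) (at_right 0)"
    by (intro tendsto_intros)
  ultimately show ?thesis
    unfolding I_def[symmetric] using tendsto_lowerbound by fastforce
qed

lemma L2_Cauchy_Schwarz:
  assumes "f \<in> L2" "g \<in> L2"
  shows "cmod (LINT x|LR. f x * g x) \<le> L2_norm f * L2_norm g"
proof -
  have "cmod (LINT x|LR. f x * g x) \<le> (LINT x|LR. cmod (f x) * cmod (g x))"
    using integral_norm_bound[of LR "\<lambda>x. f x * g x"] by (simp add: norm_mult)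
  also note L2_Cauchy_Schwarz_abs[OF assms]
  finally show ?thesis .
qed

lemma L2_norm_triangle:
  assumes "f \<in> L2" "g \<in> L2"
  shows "L2_norm (\<lambda>x. f x + g x) \<le> L2_norm f + L2_norm g"
proof -
  have fg: "integrable LR (\<lambda>x. cmod (f x) * cmod (g x))"
    using integrable_norm[OF L2_mult_integrable[OF assms]] by (simp add: norm_mult)
  have "(L2_norm (\<lambda>x. f x + g x))\<^sup>2 \<le>
      (LINT x|LR. (cmod (f x))\<^sup>2 + (cmod (g x))\<^sup>2 + 2 * (cmod (f x) * cmod (g x)))"
    unfolding L2_norm_sq
  proof (rule integral_mono)
    fix x
    have "(cmod (f x + g x))\<^sup>2 \<le> (cmod (f x) + cmod (g x))\<^sup>2"
      by (intro power_mono norm_triangle_ineq) auto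
    then show "(cmod (f x + g x))\<^sup>2 \<le> (cmod (f x))\<^sup>2 + (cmod (g x))\<^sup>2 + 2 * (cmod (f x) * cmod (g x))"
      by (simp add: power2_sum)
  qed (use fg assms L2_add[OF assms] in \<open>auto intro!: L2_integrable_sq Bochner_Integration.integrable_add\<close>)
  also have "\<dots> = (L2_norm f)\<^sup>2 + (L2_norm g)\<^sup>2 + 2 * (LINT x|LR. cmod (f x) * cmod (g x))"
    using fg assms by (simp add: L2_norm_sq L2_integrable_sq)
  also have "\<dots> \<le> (L2_norm f + L2_norm g)\<^sup>2"
    using L2_Cauchy_Schwarz_abs[OF assms] by (simp add: power2_sum)
  finally show ?thesis
    by (rule power2_le_imp_le) simp
qed

lemma L2_norm_triangle_diff:
  assumes "f \<in> L2" "g \<in> L2"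
  shows "L2_norm (\<lambda>x. f x - g x) \<le> L2_norm f + L2_norm g"
  using L2_norm_triangle[of f "\<lambda>x. -1 * g x"] L2_scale[of g "-1"] L2_norm_scale[of "-1" g] assms
  by simp

lemma L2_norm_eq_0:
  assumes "f \<in> L2" "L2_norm f = 0"
  shows "ae_eq f (\<lambda>x. 0)"
proof -
  have "(LINT x|LR. (cmod (f x))\<^sup>2) = 0"
    using assms L2_norm_sq[of f] by simp
  then have "AE x in LR. (cmod (f x))\<^sup>2 = 0"
    using L2_integrable_sq[OF assms(1)] by (subst (asm) integral_nonneg_eq_0_iff_AE) auto
  then show ?thesis
    by (simp add: ae_eq_def)
qed

lemma L2_ae_eqI:
  assumes "(\<lambda>x. f x - g x) \<in> L2" "\<And>e. e > 0 \<Longrightarrow> L2_norm (\<lambda>x. f x - g x) \<le> e"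
  shows "ae_eq f g"
proof -
  have "L2_norm (\<lambda>x. f x - g x) = 0"
    using assms(2) field_le_epsilon[of "L2_norm (\<lambda>x. f x - g x)" 0] by (simp add: antisym)
  then show ?thesis
    using L2_norm_eq_0[OF assms(1)] by (simp add: ae_eq_def)
qed

section \<open>Smooth functions and test functions\<close>

lemma smooth_on_cong:
  assumes "smooth_on S f" "\<And>x. x \<in> S \<Longrightarrow> g x = f x"
  shows "smooth_on S g"
  using assms unfolding smooth_on_def by metis

lemma smooth_on_antideriv:
  assumes "smooth_on S g" "\<And>x. x \<in> S \<Longrightarrow> (f has_vector_derivative g x) (at x within S)"
  shows "smooth_on S f"
proof -
  obtain D where D: "\<forall>x\<in>S. D 0 x = g x"
      "\<forall>n. \<forall>x\<in>S. (D n has_vector_derivative D (Suc n) x) (at x within S)"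
    using assms(1) unfolding smooth_on_def by auto
  define E where "E n = (case n of 0 \<Rightarrow> f | Suc k \<Rightarrow> D k)" for n
  have "(E n has_vector_derivative E (Suc n) x) (at x within S)" if "x \<in> S" for n x
    using assms(2) D that by (cases n) (auto simp: E_def)
  moreover have "E 0 = f"
    by (simp add: E_def)
  ultimately show ?thesis
    unfolding smooth_on_def by (intro exI[of _ E]) auto
qed

lemma smooth_on_derivE:
  assumes "smooth_on S f"
  obtains g where "smooth_on S g" "\<And>x. x \<in> S \<Longrightarrow> (f has_vector_derivative g x) (at x within S)"
proof -
  obtain D where D: "\<forall>x\<in>S. D 0 x = f x"
      "\<forall>n. \<forall>x\<in>S. (D n has_vector_derivative D (Suc n) x) (at x within S)"
    using assms unfolding smooth_on_def by auto
  show thesis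
  proof
    show "smooth_on S (D 1)"
      unfolding smooth_on_def using D by (intro exI[of _ "\<lambda>n. D (Suc n)"]) auto
    show "(f has_vector_derivative D 1 x) (at x within S)" if "x \<in> S" for x
      using D that by (metis One_nat_def has_vector_derivative_transform)
  qed
qed

text \<open>\<open>smooth_on\<close> asks for a whole tower of derivatives. A class of functions in
  which every member has a derivative again in the class supplies it by iterating a choice
  function.\<close>

lemma smooth_on_coinduct:
  assumes "P f"
    and step: "\<And>f. P f \<Longrightarrow> \<exists>g. P g \<and> (\<forall>x\<in>S. (f has_vector_derivative g x) (at x within S))"
  shows "smooth_on S f"
proof -
  obtain d where d: "\<And>f. P f \<Longrightarrow> P (d f) \<and> (\<forall>x\<in>S. (f has_vector_derivative d f x) (at x within S))"
    using step by metis
  have "P ((d ^^ n) f)" for n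
    using assms(1) d by (induction n) auto
  then show ?thesis
    unfolding smooth_on_def using d by (intro exI[of _ "\<lambda>n. (d ^^ n) f"]) auto
qed

lemma smooth_on_subset:
  assumes "smooth_on S f" "T \<subseteq> S"
  shows "smooth_on T f"
proof -
  obtain D where D: "\<forall>x\<in>S. D 0 x = f x"
      "\<forall>n. \<forall>x\<in>S. (D n has_vector_derivative D (Suc n) x) (at x within S)"
    using assms(1) unfolding smooth_on_def by auto
  have "(D n has_vector_derivative D (Suc n) x) (at x within T)" if "x \<in> T" for n x
    using D(2) assms(2) that has_vector_derivative_within_subset[of "D n" "D (Suc n) x" x S T] by auto
  then show ?thesis
    unfolding smooth_on_def using D(1) assms(2) by (intro exI[of _ D]) auto
qed

lemma smooth_on_continuous_on: "smooth_on S f \<Longrightarrow> continuous_on S f"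
  by (metis continuous_on_eq_continuous_within has_vector_derivative_continuous smooth_on_derivE)

text \<open>Sums and products of smooth functions form a class that the Leibniz rule keeps stable
  under differentiation, so the coinduction applies and no formula for higher derivatives of a
  product is needed.\<close>

inductive smooth_algebra :: "real set \<Rightarrow> (real \<Rightarrow> complex) \<Rightarrow> bool" for S where
  base: "smooth_on S f \<Longrightarrow> smooth_algebra S f"
| add: "smooth_algebra S f \<Longrightarrow> smooth_algebra S g \<Longrightarrow> smooth_algebra S (\<lambda>x. f x + g x)"
| mult: "smooth_algebra S f \<Longrightarrow> smooth_algebra S g \<Longrightarrow> smooth_algebra S (\<lambda>x. f x * g x)"

lemma smooth_on_algebra: "smooth_algebra S f \<Longrightarrow> smooth_on S f"
proof (rule smooth_on_coinduct[where P = "smooth_algebra S"])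
  fix f assume "smooth_algebra S f"
  then show "\<exists>g. smooth_algebra S g \<and> (\<forall>x\<in>S. (f has_vector_derivative g x) (at x within S))"
  proof induction
    case (base f)
    then show ?case
      by (metis smooth_algebra.base smooth_on_derivE)
  next
    case (add f g)
    then obtain f' g' where *: "smooth_algebra S f'" "\<forall>x\<in>S. (f has_vector_derivative f' x) (at x within S)"
      "smooth_algebra S g'" "\<forall>x\<in>S. (g has_vector_derivative g' x) (at x within S)"
      by blast
    show ?case
    proof (intro exI conjI ballI)
      show "smooth_algebra S (\<lambda>x. f' x + g' x)"
        by (rule smooth_algebra.add[OF *(1,3)])
      show "((\<lambda>x. f x + g x) has_vector_derivative f' x + g' x) (at x within S)" if "x \<in> S" for x
        using * that by (intro has_vector_derivative_add) auto
    qed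
  next
    case (mult f g)
    then obtain f' g' where *: "smooth_algebra S f'" "\<forall>x\<in>S. (f has_vector_derivative f' x) (at x within S)"
      "smooth_algebra S g'" "\<forall>x\<in>S. (g has_vector_derivative g' x) (at x within S)"
      by blast
    show ?case
    proof (intro exI conjI ballI)
      show "smooth_algebra S (\<lambda>x. f x * g' x + f' x * g x)"
        by (rule smooth_algebra.add[OF smooth_algebra.mult[OF mult.hyps(1) *(3)] smooth_algebra.mult[OF *(1) mult.hyps(2)]])
      show "((\<lambda>x. f x * g x) has_vector_derivative f x * g' x + f' x * g x) (at x within S)" if "x \<in> S" for x
        using * that by (intro has_vector_derivative_mult) auto
    qed
  qed
qed

lemma smooth_on_add: "smooth_on S f \<Longrightarrow> smooth_on S g \<Longrightarrow> smooth_on S (\<lambda>x. f x + g x)"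
  by (rule smooth_on_algebra) (intro smooth_algebra.intros)

lemma smooth_on_mult: "smooth_on S f \<Longrightarrow> smooth_on S g \<Longrightarrow> smooth_on S (\<lambda>x. f x * g x)"
  by (rule smooth_on_algebra) (intro smooth_algebra.intros)

lemma smooth_on_const: "smooth_on S (\<lambda>x. c)"
  unfolding smooth_on_def by (intro exI[of _ "\<lambda>n x. if n = 0 then c else 0"]) auto

lemma smooth_on_diff: "smooth_on S f \<Longrightarrow> smooth_on S g \<Longrightarrow> smooth_on S (\<lambda>x. f x - g x)"
  using smooth_on_add[of S f "\<lambda>x. -1 * g x"] smooth_on_mult[OF smooth_on_const[of S "-1"], of g] by simp

lemma has_vector_derivative_powr_Rplus:
  assumes "0 < x"
  shows "((\<lambda>x. complex_of_real x powr \<beta>) has_vector_derivative \<beta> * complex_of_real x powr (\<beta> - 1)) (at x within S)"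
  by (rule has_vector_derivative_real_field) (use assms in \<open>auto intro!: derivative_eq_intros\<close>)

lemma smooth_on_powr: "smooth_on Rplus (\<lambda>x. complex_of_real x powr \<beta>)"
proof (rule smooth_on_coinduct[where P = "\<lambda>f. \<exists>c \<beta>. f = (\<lambda>x. c * complex_of_real x powr \<beta>)"])
  show "\<exists>c \<beta>'. (\<lambda>x. complex_of_real x powr \<beta>) = (\<lambda>x. c * complex_of_real x powr \<beta>')"
    by (intro exI[of _ 1] exI[of _ \<beta>]) simp
  fix f :: "real \<Rightarrow> complex"
  assume "\<exists>c \<beta>. f = (\<lambda>x. c * complex_of_real x powr \<beta>)"
  then obtain c \<beta> where f: "f = (\<lambda>x. c * complex_of_real x powr \<beta>)"
    by blast
  have "(f has_vector_derivative c * \<beta> * complex_of_real x powr (\<beta> - 1)) (at x within Rplus)" if "x \<in> Rplus" for x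
    using has_vector_derivative_mult_right[OF has_vector_derivative_powr_Rplus[of x \<beta> Rplus], of c] that
    unfolding f by (simp add: mult.assoc)
  then show "\<exists>g. (\<exists>c \<beta>. g = (\<lambda>x. c * complex_of_real x powr \<beta>)) \<and>
      (\<forall>x\<in>Rplus. (f has_vector_derivative g x) (at x within Rplus))"
    by (intro exI[of _ "\<lambda>x. c * \<beta> * complex_of_real x powr (\<beta> - 1)"]) auto
qed

lemma smooth_on_polynomial_function:
  fixes p :: "real \<Rightarrow> complex"
  assumes "polynomial_function p"
  shows "smooth_on S p"
proof (rule smooth_on_coinduct[where P = polynomial_function, OF assms])
  fix f :: "real \<Rightarrow> complex"
  assume "polynomial_function f"
  then obtain f' where "polynomial_function f'" "\<And>x. (f has_vector_derivative f' x) (at x)"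
    using has_vector_derivative_polynomial_function by blast
  then show "\<exists>g. polynomial_function g \<and> (\<forall>x\<in>S. (f has_vector_derivative g x) (at x within S))"
    by (intro exI[of _ f']) (auto intro: has_vector_derivative_at_within)
qed

lemma smooth_on_rescale:
  assumes "smooth_on S f" "\<And>x. x \<in> S \<Longrightarrow> c * x \<in> S"
  shows "smooth_on S (\<lambda>x. f (c * x))"
\<comment> \<open>The class carries a scalar \<open>a\<close> because every derivative of g(c x)
  brings out a factor c.\<close>
proof (rule smooth_on_coinduct[where P = "\<lambda>h. \<exists>a g. smooth_on S g \<and> h = (\<lambda>x. a * g (c * x))"])
  show "\<exists>a g. smooth_on S g \<and> (\<lambda>x. f (c * x)) = (\<lambda>x. a * g (c * x))"
    using assms(1) by (intro exI[of _ 1]) auto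
  fix h :: "real \<Rightarrow> complex"
  assume "\<exists>a g. smooth_on S g \<and> h = (\<lambda>x. a * g (c * x))"
  then obtain a g where g: "smooth_on S g" and h: "h = (\<lambda>x. a * g (c * x))"
    by blast
  obtain g' where g': "smooth_on S g'" "\<And>x. x \<in> S \<Longrightarrow> (g has_vector_derivative g' x) (at x within S)"
    using smooth_on_derivE[OF g] by blast
  have "(h has_vector_derivative (a * complex_of_real c) * g' (c * x)) (at x within S)" if "x \<in> S" for x
  proof -
    have "(g has_vector_derivative g' (c * x)) (at (c * x) within (\<lambda>x. c * x) ` S)"
      using g'(2) assms(2) that by (meson has_vector_derivative_within_subset image_subsetI)
    moreover have "((\<lambda>x. c * x) has_vector_derivative c) (at x within S)"
      by (auto intro!: derivative_eq_intros)
    ultimately have "(g \<circ> (\<lambda>x. c * x) has_vector_derivative c *\<^sub>R g' (c * x)) (at x within S)"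
      by (intro vector_diff_chain_within)
    from has_vector_derivative_mult_right[OF this, of a] show ?thesis
      by (simp add: h o_def scaleR_conv_of_real mult.assoc)
  qed
  then show "\<exists>g. (\<exists>a k. smooth_on S k \<and> g = (\<lambda>x. a * k (c * x))) \<and>
      (\<forall>x\<in>S. (h has_vector_derivative g x) (at x within S))"
    using g'(1) by (intro exI[of _ "\<lambda>x. (a * complex_of_real c) * g' (c * x)"]) auto
qed

section \<open>Test functions on the open half-line\<close>

lemma has_vector_derivative_at_Rplus:
  "0 < x \<Longrightarrow> (f has_vector_derivative d) (at x within Rplus) \<longleftrightarrow> (f has_vector_derivative d) (at x)"
  by (simp add: at_within_open[of x Rplus])

lemma Cc_smooth_Rplus_iff:
  "\<phi> \<in> Cc_smooth Rplus \<longleftrightarrow>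
     smooth_on Rplus \<phi> \<and> (\<exists>a b. 0 < a \<and> a < b \<and> (\<forall>x>0. x < a \<or> b < x \<longrightarrow> \<phi> x = 0))"
proof -
  let ?S = "{x \<in> Rplus. \<phi> x \<noteq> 0}"
  have 1: "\<exists>a b. 0 < a \<and> a < b \<and> (\<forall>x>0. x < a \<or> b < x \<longrightarrow> \<phi> x = 0)"
    if cpt: "compact (closure ?S)" "closure ?S \<subseteq> Rplus"
  proof (cases "closure ?S = {}")
    case True
    then have "?S = {}"
      using closure_subset by blast
    then show ?thesis
      by (intro exI[of _ 1] exI[of _ 2]) auto
  next
    case False
    obtain a where a: "a \<in> closure ?S" "\<And>x. x \<in> closure ?S \<Longrightarrow> a \<le> x"
      using compact_attains_inf[OF cpt(1) False] by blast
    obtain b where b: "b \<in> closure ?S" "\<And>x. x \<in> closure ?S \<Longrightarrow> x \<le> b"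
      using compact_attains_sup[OF cpt(1) False] by blast
    have "0 < a" "a \<le> b"
      using a b cpt by auto
    moreover have "a \<le> x \<and> x \<le> b" if "x > 0" "\<phi> x \<noteq> 0" for x
      using a(2) b(2) that closure_subset[of ?S] by auto
    ultimately show ?thesis
      \<comment> \<open>\<open>b + 1\<close> because only \<open>a \<le> b\<close> is known while a
        strict inequality is wanted.\<close>
      by (intro exI[of _ a] exI[of _ "b + 1"] conjI allI impI) (simp, simp, fastforce)
  qed
  have 2: "compact (closure ?S) \<and> closure ?S \<subseteq> Rplus"
    if "0 < a" "a < b" "\<forall>x>0. x < a \<or> b < x \<longrightarrow> \<phi> x = 0" for a b
  proof -
    have "?S \<subseteq> {a..b}"
      using that by force
    then have "closure ?S \<subseteq> {a..b}"
      by (simp add: closure_minimal)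
    then show ?thesis
      using that(1) compact_Int_closed[of "{a..b}" "closure ?S"] by (auto simp: Int_absorb1)
  qed
  have "(compact (closure ?S) \<and> closure ?S \<subseteq> Rplus) \<longleftrightarrow>
      (\<exists>a b. 0 < a \<and> a < b \<and> (\<forall>x>0. x < a \<or> b < x \<longrightarrow> \<phi> x = 0))"
    using 1 2 by (intro iffI) (simp, elim exE conjE, simp)
  then show ?thesis
    unfolding Cc_smooth_def by simp
qed

lemma Cc_smoothI:
  assumes "smooth_on Rplus \<phi>" "0 < a" "a < b" "\<And>x. 0 < x \<Longrightarrow> x < a \<or> b < x \<Longrightarrow> \<phi> x = 0"
  shows "\<phi> \<in> Cc_smooth Rplus"
  unfolding Cc_smooth_Rplus_iff using assms by (intro conjI exI[of _ a] exI[of _ b]) auto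

lemma Cc_smooth_smooth: "\<phi> \<in> Cc_smooth Rplus \<Longrightarrow> smooth_on Rplus \<phi>"
  by (simp add: Cc_smooth_Rplus_iff)

lemma Cc_smooth_supportE:
  assumes "\<phi> \<in> Cc_smooth Rplus"
  obtains a b where "0 < a" "a < b" "\<And>x. 0 < x \<Longrightarrow> x < a \<or> b < x \<Longrightarrow> \<phi> x = 0"
  using assms unfolding Cc_smooth_Rplus_iff by blast

lemma Cc_smooth_mult:
  assumes "\<phi> \<in> Cc_smooth Rplus" "smooth_on Rplus u"
  shows "(\<lambda>x. u x * \<phi> x) \<in> Cc_smooth Rplus"
proof -
  obtain a b where ab: "0 < a" "a < b" "\<And>x. 0 < x \<Longrightarrow> x < a \<or> b < x \<Longrightarrow> \<phi> x = 0"
    using Cc_smooth_supportE[OF assms(1)] by blast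
  have "smooth_on Rplus (\<lambda>x. u x * \<phi> x)"
    using smooth_on_mult[OF assms(2) Cc_smooth_smooth[OF assms(1)]] .
  then show ?thesis
    by (rule Cc_smoothI[of _ a b]) (use ab in auto)
qed

lemma Cc_smooth_add:
  assumes "\<phi> \<in> Cc_smooth Rplus" "\<psi> \<in> Cc_smooth Rplus"
  shows "(\<lambda>x. \<phi> x + \<psi> x) \<in> Cc_smooth Rplus"
proof -
  obtain a b where ab: "0 < a" "a < b" "\<And>x. 0 < x \<Longrightarrow> x < a \<or> b < x \<Longrightarrow> \<phi> x = 0"
    using Cc_smooth_supportE[OF assms(1)] by blast
  obtain c d where cd: "0 < c" "c < d" "\<And>x. 0 < x \<Longrightarrow> x < c \<or> d < x \<Longrightarrow> \<psi> x = 0"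
    using Cc_smooth_supportE[OF assms(2)] by blast
  have "smooth_on Rplus (\<lambda>x. \<phi> x + \<psi> x)"
    using smooth_on_add[OF Cc_smooth_smooth[OF assms(1)] Cc_smooth_smooth[OF assms(2)]] .
  then show ?thesis
    by (rule Cc_smoothI[of _ "min a c" "max b d"]) (use ab cd in auto)
qed

lemma Cc_smooth_scale: "\<phi> \<in> Cc_smooth Rplus \<Longrightarrow> (\<lambda>x. c * \<phi> x) \<in> Cc_smooth Rplus"
  using Cc_smooth_mult[OF _ smooth_on_const] .

lemma Cc_smooth_diff:
  "\<phi> \<in> Cc_smooth Rplus \<Longrightarrow> \<psi> \<in> Cc_smooth Rplus \<Longrightarrow> (\<lambda>x. \<phi> x - \<psi> x) \<in> Cc_smooth Rplus"
  using Cc_smooth_add[of \<phi> "\<lambda>x. -1 * \<psi> x"] Cc_smooth_scale[of \<psi> "-1"] by simp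

abbreviation vderiv :: "(real \<Rightarrow> complex) \<Rightarrow> real \<Rightarrow> complex" where
  "vderiv \<phi> \<equiv> \<lambda>x. vector_derivative \<phi> (at x)"

lemma smooth_on_vderiv:
  assumes "smooth_on Rplus \<phi>"
  shows "smooth_on Rplus (vderiv \<phi>)"
    and "\<And>x. 0 < x \<Longrightarrow> (\<phi> has_vector_derivative vderiv \<phi> x) (at x)"
proof -
  obtain g where g: "smooth_on Rplus g" "\<And>x. x \<in> Rplus \<Longrightarrow> (\<phi> has_vector_derivative g x) (at x within Rplus)"
    using smooth_on_derivE[OF assms] by blast
  then have *: "(\<phi> has_vector_derivative g x) (at x)" if "0 < x" for x
    using that by (simp add: has_vector_derivative_at_Rplus)
  then show "(\<phi> has_vector_derivative vderiv \<phi> x) (at x)" if "0 < x" for x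
    using that by (metis vector_derivative_at)
  show "smooth_on Rplus (vderiv \<phi>)"
    using g(1) * by (auto intro!: smooth_on_cong[of _ g] vector_derivative_at)
qed

lemma has_vector_derivative_locally_const:
  fixes f :: "real \<Rightarrow> complex"
  assumes "(f has_vector_derivative d) (at x)" "open T" "x \<in> T" "\<And>y. y \<in> T \<Longrightarrow> f y = c"
  shows "d = 0"
proof -
  have "(f has_vector_derivative 0) (at x)"
    by (rule has_vector_derivative_transform_within_open[of "\<lambda>_. c" 0 x T f]) (use assms(2-4) in auto)
  then show ?thesis
    using vector_derivative_unique_at[OF assms(1)] by simp
qed

lemma Cc_smooth_vderiv:
  assumes "\<phi> \<in> Cc_smooth Rplus"
  shows "vderiv \<phi> \<in> Cc_smooth Rplus"
    and "\<And>x. 0 < x \<Longrightarrow> (\<phi> has_vector_derivative vderiv \<phi> x) (at x)"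
proof -
  note sm = smooth_on_vderiv[OF Cc_smooth_smooth[OF assms]]
  show "\<And>x. 0 < x \<Longrightarrow> (\<phi> has_vector_derivative vderiv \<phi> x) (at x)"
    by (rule sm(2))
  obtain a b where ab: "0 < a" "a < b" "\<And>x. 0 < x \<Longrightarrow> x < a \<or> b < x \<Longrightarrow> \<phi> x = 0"
    using Cc_smooth_supportE[OF assms] by blast
  have "vderiv \<phi> x = 0" if "0 < x" "x < a \<or> b < x" for x
    using that(2)
  proof
    assume "x < a"
    then show ?thesis
      using has_vector_derivative_locally_const[OF sm(2)[OF that(1)], of "{0<..<a}" 0] ab that by auto
  next
    assume "b < x"
    then show ?thesis
      using has_vector_derivative_locally_const[OF sm(2)[OF that(1)], of "{b<..}" 0] ab that by auto
  qed
  then show "vderiv \<phi> \<in> Cc_smooth Rplus"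
    by (intro Cc_smoothI[OF sm(1) ab(1,2)])
qed

lemma Cc_smooth_bounded:
  assumes "\<phi> \<in> Cc_smooth Rplus"
  obtains B where "0 \<le> B" "\<And>x. 0 < x \<Longrightarrow> cmod (\<phi> x) \<le> B"
proof -
  obtain a b where ab: "0 < a" "a < b" "\<And>x. 0 < x \<Longrightarrow> x < a \<or> b < x \<Longrightarrow> \<phi> x = 0"
    using Cc_smooth_supportE[OF assms] by blast
  have "continuous_on {a..b} \<phi>"
    by (rule continuous_on_subset[OF smooth_on_continuous_on[OF Cc_smooth_smooth[OF assms]]]) (use ab in auto)
  then have "bounded (\<phi> ` {a..b})"
    by (intro compact_imp_bounded compact_continuous_image) auto
  then obtain B where "\<forall>y\<in>\<phi> ` {a..b}. cmod y \<le> B"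
    unfolding bounded_iff by blast
  then have B: "\<And>x. x \<in> {a..b} \<Longrightarrow> cmod (\<phi> x) \<le> B"
    by blast
  have "cmod (\<phi> x) \<le> \<bar>B\<bar>" if "0 < x" for x
    using B[of x] ab(3)[OF that] by (cases "x \<in> {a..b}") auto
  then show thesis
    by (intro that[of "\<bar>B\<bar>"]) auto
qed

lemma indicator_L2: "(\<lambda>x. complex_of_real (indicator {a..b} x)) \<in> L2"
proof -
  have "integrable lebesgue (indicator {a..b} :: real \<Rightarrow> real)"
    by (intro integrable_real_indicator) (auto simp: emeasure_lborel_Icc_eq)
  then have "integrable lebesgue (\<lambda>x. indicator Rplus x *\<^sub>R (indicator {a..b} x :: real))"
    by (intro integrable_mult_indicator) auto
  then have "integrable LR (indicator {a..b} :: real \<Rightarrow> real)"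
    by (simp add: integrable_restrict_space)
  moreover have "(\<lambda>x. (cmod (complex_of_real (indicator {a..b} x)))\<^sup>2) = indicator {a..b}"
    by (auto simp: fun_eq_iff split: split_indicator)
  moreover have "(\<lambda>x. complex_of_real (indicator {a..b} x)) \<in> borel_measurable LR"
    by (intro borel_measurable_LR_I) measurable
  ultimately show ?thesis
    unfolding L2_def by simp
qed

lemma L2_of_bounded_support:
  assumes "f \<in> borel_measurable LR" "AE x in LR. cmod (f x) \<le> B * indicator {a..b} x"
  shows "f \<in> L2" and "B \<ge> 0 \<Longrightarrow> L2_norm f \<le> B * L2_norm (\<lambda>x. complex_of_real (indicator {a..b} x))"
proof -
  have *: "AE x in LR. cmod (f x) \<le> B * cmod (complex_of_real (indicator {a..b} x))"
    using assms(2) by simp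
  show "f \<in> L2"
    by (rule L2_bound[OF assms(1) indicator_L2 *])
  show "L2_norm f \<le> B * L2_norm (\<lambda>x. complex_of_real (indicator {a..b} x))" if "B \<ge> 0"
    by (rule L2_norm_mono[OF assms(1) indicator_L2 that *])
qed

lemma Cc_smooth_measurable: "\<phi> \<in> Cc_smooth Rplus \<Longrightarrow> \<phi> \<in> borel_measurable LR"
  by (intro continuous_measurable_LR smooth_on_continuous_on Cc_smooth_smooth)

lemma Cc_smooth_L2:
  assumes "\<phi> \<in> Cc_smooth Rplus"
  shows "\<phi> \<in> L2"
proof -
  obtain a b where ab: "0 < a" "a < b" "\<And>x. 0 < x \<Longrightarrow> x < a \<or> b < x \<Longrightarrow> \<phi> x = 0"
    using Cc_smooth_supportE[OF assms] by blast
  obtain B where B: "0 \<le> B" "\<And>x. 0 < x \<Longrightarrow> cmod (\<phi> x) \<le> B"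
    using Cc_smooth_bounded[OF assms] by blast
  show ?thesis
  proof (rule L2_of_bounded_support(1))
    show "AE x in LR. cmod (\<phi> x) \<le> B * indicator {a..b} x"
      using ab B by (intro AE_LR_everywhere) (auto split: split_indicator)
  qed (rule Cc_smooth_measurable[OF assms])
qed


lemma Cc_smooth_continuous: "\<phi> \<in> Cc_smooth Rplus \<Longrightarrow> continuous_on Rplus \<phi>"
  by (intro smooth_on_continuous_on Cc_smooth_smooth)

lemma cont_mult_Cc_L2:
  assumes "continuous_on Rplus u" "\<phi> \<in> Cc_smooth Rplus"
  shows "(\<lambda>x. u x * \<phi> x) \<in> L2" and "integrable LR (\<lambda>x. u x * \<phi> x)"
proof -
  have cont: "continuous_on Rplus (\<lambda>x. u x * \<phi> x)"
    by (intro continuous_on_mult assms smooth_on_continuous_on Cc_smooth_smooth)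
  obtain a b where ab: "0 < a" "a < b" "\<And>x. 0 < x \<Longrightarrow> x < a \<or> b < x \<Longrightarrow> \<phi> x = 0"
    using Cc_smooth_supportE[OF assms(2)] by blast
  have "bounded ((\<lambda>x. u x * \<phi> x) ` {a..b})"
    by (intro compact_imp_bounded compact_continuous_image continuous_on_subset[OF cont]) (use ab in auto)
  then obtain B where B: "\<forall>y\<in>(\<lambda>x. u x * \<phi> x) ` {a..b}. cmod y \<le> B"
    unfolding bounded_iff by blast
  show L2: "(\<lambda>x. u x * \<phi> x) \<in> L2"
  proof (rule L2_of_bounded_support(1)[OF continuous_measurable_LR[OF cont]])
    show "AE x in LR. cmod (u x * \<phi> x) \<le> B * indicator {a..b} x"
      using B ab by (intro AE_LR_everywhere) (auto split: split_indicator)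
  qed
  \<comment> \<open>The product lives on [a, b], so the indicator changes nothing, and a product of
    two \<open>L2\<close> functions is integrable.\<close>
  have "integrable LR (\<lambda>x. complex_of_real (indicator {a..b} x) * (u x * \<phi> x))"
    by (rule L2_mult_integrable[OF indicator_L2 L2])
  then show "integrable LR (\<lambda>x. u x * \<phi> x)"
    by (rule Bochner_Integration.integrable_cong[THEN iffD1, rotated 2])
      (use ab in \<open>auto split: split_indicator\<close>)
qed

section \<open>The fundamental theorem of calculus on compact intervals of the half-line\<close>

lemma FTC_LR:
  fixes F f :: "real \<Rightarrow> complex"
  assumes "0 < a" "a \<le> b" "\<And>x. a \<le> x \<Longrightarrow> x \<le> b \<Longrightarrow> (F has_vector_derivative f x) (at x)"
    "continuous_on {a..b} f"
  shows "integrable LR (\<lambda>x. indicator {a..b} x *\<^sub>R f x)"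
    and "(LINT x|LR. indicator {a..b} x *\<^sub>R f x) = F b - F a"
proof -
  let ?g = "\<lambda>x. indicator {a..b} x *\<^sub>R f x"
  have "has_bochner_integral lborel ?g (F b - F a)"
    using assms by (intro has_bochner_integral_FTC_Icc) (auto intro: has_vector_derivative_at_within)
  then have "integrable lborel ?g" "integral\<^sup>L lborel ?g = F b - F a"
    by (simp_all only: has_bochner_integral_iff)
  then have "integrable lebesgue ?g" "integral\<^sup>L lebesgue ?g = F b - F a"
    using integrable_completion[of ?g lborel] integral_completion[of ?g lborel]
    by (metis borel_measurable_integrable)+
  moreover have eq: "(\<lambda>x. indicator Rplus x *\<^sub>R ?g x) = ?g"
    using assms(1) by (auto simp: fun_eq_iff split: split_indicator)
  ultimately show "integrable LR ?g" "(LINT x|LR. ?g x) = F b - F a"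
    by (simp_all add: integrable_restrict_space integral_restrict_space eq del: indicator_simps)
qed


lemma integral_deriv_Cc:
  fixes F f :: "real \<Rightarrow> complex"
  assumes "0 < a" "a < b" "\<And>x. 0 < x \<Longrightarrow> x < a \<or> b < x \<Longrightarrow> F x = 0"
    "\<And>x. 0 < x \<Longrightarrow> (F has_vector_derivative f x) (at x)" "continuous_on Rplus f"
  shows "(LINT x|LR. f x) = 0"
proof -
  have f0: "f x = 0" if "0 < x" "x < a \<or> b < x" for x
    using that(2)
  proof
    assume "x < a"
    then show ?thesis
      using has_vector_derivative_locally_const[OF assms(4)[OF that(1)], of "{0<..<a}" 0] assms that by auto
  next
    assume "b < x"
    then show ?thesis
      using has_vector_derivative_locally_const[OF assms(4)[OF that(1)], of "{b<..}" 0] assms that by auto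
  qed
  \<comment> \<open>F is known to vanish only strictly outside [a, b], so the endpoints are moved
    outwards.\<close>
  have "(LINT x|LR. f x) = (LINT x|LR. indicator {a/2..b+1} x *\<^sub>R f x)"
    using f0 assms(1,2) by (intro Bochner_Integration.integral_cong) (auto split: split_indicator)
  also have "\<dots> = F (b + 1) - F (a / 2)"
    using assms by (intro FTC_LR(2)) (auto intro: continuous_on_subset[OF assms(5)])
  also have "\<dots> = 0"
    using assms by simp
  finally show ?thesis .
qed

section \<open>Primitives and Hardy's inequality\<close>

definition prim :: "(real \<Rightarrow> complex) \<Rightarrow> real \<Rightarrow> complex" where
  "prim u x = (LINT t|LR. indicator {..x} t *\<^sub>R u t)"

text \<open>The integral in \<open>prim\<close> takes the default value 0 on a non-integrable
  function, so additivity of \<open>prim\<close> has to be guarded by this predicate.\<close>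

definition loc_integrable :: "(real \<Rightarrow> complex) \<Rightarrow> bool" where
  "loc_integrable u \<longleftrightarrow> (\<forall>x. integrable LR (\<lambda>t. indicator {..x} t *\<^sub>R u t))"

lemma prim_cong: "(\<And>t. 0 < t \<Longrightarrow> u t = v t) \<Longrightarrow> prim u x = prim v x"
  unfolding prim_def by (rule Bochner_Integration.integral_cong) auto

lemma prim_nonpos: "x \<le> 0 \<Longrightarrow> prim u x = 0"
  unfolding prim_def
  by (subst Bochner_Integration.integral_cong[where g = "\<lambda>_. 0"]) (auto split: split_indicator)

lemma prim_add:
  "loc_integrable u \<Longrightarrow> loc_integrable v \<Longrightarrow> prim (\<lambda>t. u t + v t) x = prim u x + prim v x"
  unfolding prim_def loc_integrable_def by (simp add: scaleR_add_right)

lemma prim_diff: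
  "loc_integrable u \<Longrightarrow> loc_integrable v \<Longrightarrow> prim (\<lambda>t. u t - v t) x = prim u x - prim v x"
  unfolding prim_def loc_integrable_def by (simp add: scaleR_diff_right)

lemma id_measurable_LR [measurable]: "(\<lambda>x. x) \<in> borel_measurable LR"
  by (rule borel_measurable_LR_I) simp

lemma prim_measurable:
  assumes [measurable]: "u \<in> borel_measurable LR"
  shows "prim u \<in> borel_measurable LR"
proof -
  interpret sigma_finite_measure LR
    by (rule sigma_finite_LR)
  have "(\<lambda>(x, t). indicator {..x} t *\<^sub>R u t) = (\<lambda>p. (if snd p \<le> fst p then 1 else 0) *\<^sub>R u (snd p))"
    by (auto simp: fun_eq_iff split: split_indicator)
  moreover have "(\<lambda>p. (if snd p \<le> fst p then 1 else 0) *\<^sub>R u (snd p)) \<in> borel_measurable (LR \<Otimes>\<^sub>M LR)"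
    by measurable
  ultimately have "(\<lambda>x. LINT t|LR. indicator {..x} t *\<^sub>R u t) \<in> borel_measurable LR"
    by (intro borel_measurable_lebesgue_integral) simp
  then show ?thesis
    by (simp add: prim_def[abs_def])
qed

lemma prim_of_deriv:
  fixes F f :: "real \<Rightarrow> complex"
  assumes "0 < a" "\<And>x. 0 < x \<Longrightarrow> x < a \<Longrightarrow> F x = 0"
    "\<And>x. 0 < x \<Longrightarrow> (F has_vector_derivative f x) (at x)" "continuous_on Rplus f" "0 < x"
  shows "prim f x = F x"
proof -
  have f0: "f t = 0" if "0 < t" "t < a" for t
    using has_vector_derivative_locally_const[OF assms(3)[OF that(1)], of "{0<..<a}" 0] assms that by auto
  \<comment> \<open>A positive starting point at which F still vanishes: the integral from 0 becomes
    one over [c, x].\<close>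
  define c where "c = min (a / 2) (x / 2)"
  have c: "0 < c" "c < a" "c < x"
    using assms by (auto simp: c_def)
  have "prim f x = (LINT t|LR. indicator {c..x} t *\<^sub>R f t)"
    unfolding prim_def using f0 c by (intro Bochner_Integration.integral_cong) (auto split: split_indicator)
  also have "\<dots> = F x - F c"
    using assms(3) c by (intro FTC_LR(2) continuous_on_subset[OF assms(4)]) auto
  also have "\<dots> = F x"
    using assms(2) c by simp
  finally show ?thesis .
qed

lemma prim_has_vector_derivative:
  assumes "loc_integrable u" "continuous_on Rplus u" "0 < x"
  shows "(prim u has_vector_derivative u x) (at x)"
proof -
  \<comment> \<open>u may be singular at 0, so the part of the integral below a is kept as a
    constant. The Henstock primitive starts at a / 2 so that it has a two-sided derivative at a as
    well.\<close>
  define a b where "a = x / 2" and "b = x + 1"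
  have ab: "0 < a" "a < x" "x < b"
    using assms(3) by (auto simp: a_def b_def)
  have cont: "continuous_on {a / 2..b} u"
    by (rule continuous_on_subset[OF assms(2)]) (use ab in auto)
  define H where "H = (\<lambda>y. integral {a / 2..y} u)"
  have H: "(H has_vector_derivative u y) (at y)" if "a / 2 < y" "y < b" for y
  proof -
    have "(H has_vector_derivative u y) (at y within {a / 2..b})"
      unfolding H_def using that by (intro integral_has_vector_derivative[OF cont]) auto
    then show ?thesis
      using that by (simp add: at_within_Icc_at)
  qed
  have eq: "prim u y = (LINT t|LR. indicator {..<a} t *\<^sub>R u t) + (H y - H a)" if "a < y" "y < b" for y
  proof -
    have "continuous_on {a..y} u"
      by (rule continuous_on_subset[OF assms(2)]) (use ab in auto)
    then have "integrable LR (\<lambda>t. indicator {a..y} t *\<^sub>R u t)" "(LINT t|LR. indicator {a..y} t *\<^sub>R u t) = H y - H a"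
      using FTC_LR[of a y H u] H that ab by auto
    moreover have "integrable LR (\<lambda>t. indicator {..<a} t *\<^sub>R u t)"
    proof (rule Bochner_Integration.integrable_bound)
      show "integrable LR (\<lambda>t. indicator {..a} t *\<^sub>R u t)"
        using assms(1) unfolding loc_integrable_def by blast
      have [measurable]: "u \<in> borel_measurable LR"
        by (rule continuous_measurable_LR[OF assms(2)])
      show "(\<lambda>t. indicator {..<a} t *\<^sub>R u t) \<in> borel_measurable LR"
        by measurable
    qed (auto split: split_indicator)
    moreover have "(\<lambda>t. indicator {..y} t *\<^sub>R u t) = (\<lambda>t. indicator {..<a} t *\<^sub>R u t + indicator {a..y} t *\<^sub>R u t)"
      using that by (auto simp: fun_eq_iff split: split_indicator)
    ultimately show ?thesis
      by (simp add: prim_def)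
  qed
  have "((\<lambda>y. (LINT t|LR. indicator {..<a} t *\<^sub>R u t) + (H y - H a)) has_vector_derivative u x) (at x)"
    using H[of x] ab by (auto intro!: derivative_eq_intros)
  then show ?thesis
    by (rule has_vector_derivative_transform_within_open[of _ _ _ "{a<..<b}"]) (use eq ab in auto)
qed

section \<open>Power weights and the weighted Hardy operators\<close>

lemma integral_powr_0:
  assumes "a > -1" "0 \<le> x"
  shows "integrable LR (\<lambda>t. indicator {..x} t * t powr a)"
    and "(LINT t|LR. indicator {..x} t * t powr a) = x powr (a + 1) / (a + 1)"
proof -
  have hi: "((\<lambda>t. t powr a) has_integral (x powr (a + 1) / (a + 1))) {0..x}"
    using has_integral_powr_from_0[OF assms] .
  then have "(\<lambda>t. t powr a) absolutely_integrable_on {0..x}"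
    by (intro nonnegative_absolutely_integrable_1) (auto simp: integrable_on_def)
  then have si: "set_integrable lebesgue {0..x} (\<lambda>t. t powr a)" .
  have eq: "(\<lambda>t. indicator Rplus t *\<^sub>R (indicator {..x} t * t powr a)) = (\<lambda>t. indicator {0..x} t *\<^sub>R t powr a)"
    by (auto simp: fun_eq_iff split: split_indicator)
  show "integrable LR (\<lambda>t. indicator {..x} t * t powr a)"
    using si by (simp add: integrable_restrict_space eq set_integrable_def del: real_scaleR_def)
  have "(LINT t|LR. indicator {..x} t * t powr a) = (LINT t:{0..x}|lebesgue. t powr a)"
    by (simp add: integral_restrict_space eq set_lebesgue_integral_def del: real_scaleR_def)
  also have "\<dots> = x powr (a + 1) / (a + 1)"
    using set_lebesgue_integral_eq_integral(2)[OF si] integral_unique[OF hi] by simp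
  finally show "(LINT t|LR. indicator {..x} t * t powr a) = x powr (a + 1) / (a + 1)" .
qed

lemma nn_integral_powr_inf:
  assumes "e < -1" "0 < t"
  shows "(\<integral>\<^sup>+x. ennreal (x powr e) * indicator {t..} x \<partial>LR) = ennreal (t powr (e + 1) / - (e + 1))"
proof -
  have "(\<integral>\<^sup>+x. ennreal (x powr e) * indicator {t..} x \<partial>LR) =
      (\<integral>\<^sup>+x. (ennreal (x powr e) * indicator {t..} x) * indicator Rplus x \<partial>lebesgue)"
    by (rule nn_integral_restrict_space) auto
  also have "(\<lambda>x. (ennreal (x powr e) * indicator {t..} x) * indicator Rplus x) =
      (\<lambda>x. ennreal (x powr e) * indicator {t..} x)"
    using assms(2) by (auto simp: fun_eq_iff split: split_indicator)
  also have "(\<integral>\<^sup>+x. ennreal (x powr e) * indicator {t..} x \<partial>lebesgue) =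
      (\<integral>\<^sup>+x. ennreal (x powr e) * indicator {t..} x \<partial>lborel)"
    by (rule nn_integral_completion)
  also have "\<dots> = ennreal (- (t powr (e + 1)) / (e + 1))"
    using has_integral_powr_to_inf[OF assms] by (intro nn_integral_has_integral_lebesgue') auto
  also have "- (t powr (e + 1)) / (e + 1) = t powr (e + 1) / - (e + 1)"
    by (simp only: minus_divide_left[symmetric] minus_divide_right[symmetric])
  finally show ?thesis .
qed

lemma powr_indicator_L2:
  assumes "b > -1/2" "0 \<le> x"
  shows "(\<lambda>t. complex_of_real (indicator {..x} t * t powr b)) \<in> L2"
    and "L2_norm (\<lambda>t. complex_of_real (indicator {..x} t * t powr b)) = sqrt (x powr (2 * b + 1) / (2 * b + 1))"
proof -
  have eq: "(cmod (complex_of_real (indicator {..x} t * t powr b)))\<^sup>2 = indicator {..x} t * t powr (2 * b)" for t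
    by (auto simp: power2_eq_square powr_add[symmetric] split: split_indicator)
  have "(\<lambda>t. complex_of_real (indicator {..x} t * t powr b)) \<in> borel_measurable LR"
    by (intro borel_measurable_LR_I) measurable
  then show "(\<lambda>t. complex_of_real (indicator {..x} t * t powr b)) \<in> L2"
    unfolding L2_def mem_Collect_eq eq using assms by (auto intro!: integral_powr_0)
  show "L2_norm (\<lambda>t. complex_of_real (indicator {..x} t * t powr b)) = sqrt (x powr (2 * b + 1) / (2 * b + 1))"
    unfolding L2_norm_def eq using assms by (subst integral_powr_0(2)) auto
qed

lemma cmod_powr_Rplus: "0 < t \<Longrightarrow> cmod (complex_of_real t powr \<beta>) = t powr Re \<beta>"
  by (simp add: norm_powr_real_powr)

lemma powr_measurable_LR [measurable]: "(\<lambda>t. complex_of_real t powr \<beta>) \<in> borel_measurable LR"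
  by (intro continuous_measurable_LR smooth_on_continuous_on smooth_on_powr)

lemma powr_indicator_L2':
  assumes "Re \<beta> > -1/2" "0 \<le> x"
  shows "(\<lambda>t. indicator {..x} t *\<^sub>R complex_of_real t powr \<beta>) \<in> L2"
    and "L2_norm (\<lambda>t. indicator {..x} t *\<^sub>R complex_of_real t powr \<beta>) \<le> sqrt (x powr (2 * Re \<beta> + 1) / (2 * Re \<beta> + 1))"
proof -
  have m: "(\<lambda>t. indicator {..x} t *\<^sub>R complex_of_real t powr \<beta>) \<in> borel_measurable LR"
    by measurable
  have AE: "AE t in LR. cmod (indicator {..x} t *\<^sub>R complex_of_real t powr \<beta>) \<le>
      1 * cmod (complex_of_real (indicator {..x} t * t powr Re \<beta>))"
    by (rule AE_LR_everywhere) (auto simp: cmod_powr_Rplus split: split_indicator)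
  show "(\<lambda>t. indicator {..x} t *\<^sub>R complex_of_real t powr \<beta>) \<in> L2"
    by (rule L2_bound[OF m powr_indicator_L2(1)[OF assms] AE])
  show "L2_norm (\<lambda>t. indicator {..x} t *\<^sub>R complex_of_real t powr \<beta>) \<le> sqrt (x powr (2 * Re \<beta> + 1) / (2 * Re \<beta> + 1))"
    using L2_norm_mono[OF m powr_indicator_L2(1)[OF assms] _ AE] powr_indicator_L2(2)[OF assms] by simp
qed

lemma weighted_loc_integrable:
  assumes "Re \<beta> > -1/2" "g \<in> L2"
  shows "loc_integrable (\<lambda>t. complex_of_real t powr \<beta> * g t)"
  unfolding loc_integrable_def
proof
  fix x
  \<comment> \<open>The bound on powers is stated for nonnegative endpoints; below 0 both indicators
    vanish on the half-line.\<close>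
  have "integrable LR (\<lambda>t. (indicator {..max 0 x} t *\<^sub>R complex_of_real t powr \<beta>) * g t)"
    by (rule L2_mult_integrable[OF powr_indicator_L2'(1)[OF assms(1)] assms(2)]) simp
  then show "integrable LR (\<lambda>t. indicator {..x} t *\<^sub>R (complex_of_real t powr \<beta> * g t))"
    by (rule Bochner_Integration.integrable_cong[THEN iffD1, rotated 2]) (auto split: split_indicator)
qed

lemma weighted_prim_bound:
  assumes "Re \<beta> > -1/2" "g \<in> L2" "0 \<le> x"
  shows "cmod (prim (\<lambda>t. complex_of_real t powr \<beta> * g t) x) \<le>
    sqrt (x powr (2 * Re \<beta> + 1) / (2 * Re \<beta> + 1)) * L2_norm g"
proof -
  have "prim (\<lambda>t. complex_of_real t powr \<beta> * g t) x =
      (LINT t|LR. (indicator {..x} t *\<^sub>R complex_of_real t powr \<beta>) * g t)"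
    unfolding prim_def by simp
  also have "cmod \<dots> \<le> L2_norm (\<lambda>t. indicator {..x} t *\<^sub>R complex_of_real t powr \<beta>) * L2_norm g"
    by (rule L2_Cauchy_Schwarz[OF powr_indicator_L2'(1)[OF assms(1,3)] assms(2)])
  also have "\<dots> \<le> sqrt (x powr (2 * Re \<beta> + 1) / (2 * Re \<beta> + 1)) * L2_norm g"
    by (intro mult_right_mono powr_indicator_L2'(2)[OF assms(1,3)]) simp
  finally show ?thesis .
qed

text \<open>The outer exponent makes the operator commute with dilations; for \<beta> = 0 it is the
  mean of g over [0, x].\<close>

definition hardy :: "complex \<Rightarrow> (real \<Rightarrow> complex) \<Rightarrow> real \<Rightarrow> complex" where
  "hardy \<beta> g x = complex_of_real x powr (-1 - \<beta>) * prim (\<lambda>t. complex_of_real t powr \<beta> * g t) x"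

text \<open>Schur's test: the weight \<open>t\<close> to the power \<open>k - 1\<close> is split off by Cauchy--Schwarz, where
  \<open>k = Re \<beta> + 1/2\<close>, and the remaining double integral is evaluated by Tonelli.\<close>

lemma hardy_pointwise:
  assumes "Re \<beta> > -1/2" "g \<in> L2" "0 < x"
  defines "k \<equiv> Re \<beta> + 1/2"
  shows "(cmod (hardy \<beta> g x))\<^sup>2 \<le> x powr (- k - 1) / k * (LINT t|LR. indicator {..x} t * t powr k * (cmod (g t))\<^sup>2)"
    and "integrable LR (\<lambda>t. indicator {..x} t * t powr k * (cmod (g t))\<^sup>2)"
proof -
  have k: "k > 0"
    using assms by simp
  note [measurable] = L2_measurable[OF assms(2)]
  \<comment> \<open>The exponents add up to k - 1/2 = Re \<beta>. The square of the first factor is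
    t^(k-1), integrable at 0 as k > 0; the second factor keeps g with the weight t^k.\<close>
  let ?f1 = "\<lambda>t. complex_of_real (indicator {..x} t * t powr ((k - 1) / 2))"
  let ?f2 = "\<lambda>t. complex_of_real (indicator {..x} t * t powr (k / 2)) * g t"
  have f1: "?f1 \<in> L2" "L2_norm ?f1 = sqrt (x powr k / k)"
  proof -
    have "2 * ((k - 1) / 2) + 1 = k" "(k - 1) / 2 > -1/2"
      using k by (auto simp: field_simps)
    then show "?f1 \<in> L2" "L2_norm ?f1 = sqrt (x powr k / k)"
      using powr_indicator_L2[of "(k - 1) / 2" x] assms(3) by (auto simp del: of_real_mult)
  qed
  have "(\<lambda>t. complex_of_real (indicator {..x} t * t powr (k / 2))) \<in> borel_measurable LR"
    by (intro borel_measurable_LR_I) measurable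
  then have "?f2 \<in> borel_measurable LR"
    by measurable
  then have f2: "?f2 \<in> L2"
  proof (rule L2_bound[OF _ assms(2)])
    show "AE t in LR. cmod (?f2 t) \<le> x powr (k / 2) * cmod (g t)"
      using k by (intro AE_LR_everywhere) (auto simp: norm_mult split: split_indicator intro!: mult_right_mono powr_mono2)
  qed
  have sq: "(cmod (?f2 t))\<^sup>2 = indicator {..x} t * t powr k * (cmod (g t))\<^sup>2" for t
    by (auto simp: norm_mult power_mult_distrib power2_eq_square[of "t powr _"] powr_add[symmetric] split: split_indicator)
  show "integrable LR (\<lambda>t. indicator {..x} t * t powr k * (cmod (g t))\<^sup>2)"
    using L2_integrable_sq[OF f2] by (simp only: sq)
  have "cmod (prim (\<lambda>t. complex_of_real t powr \<beta> * g t) x) \<le>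
      (LINT t|LR. cmod (indicator {..x} t *\<^sub>R (complex_of_real t powr \<beta> * g t)))"
    unfolding prim_def by (rule integral_norm_bound)
  also have "\<dots> = (LINT t|LR. cmod (?f1 t) * cmod (?f2 t))"
  proof (rule Bochner_Integration.integral_cong)
    fix t assume "t \<in> space LR"
    then have t: "0 < t" by simp
    have "t powr Re \<beta> = t powr ((k - 1) / 2) * t powr (k / 2)"
      by (simp add: powr_add[symmetric] k_def field_simps)
    then show "cmod (indicator {..x} t *\<^sub>R (complex_of_real t powr \<beta> * g t)) = cmod (?f1 t) * cmod (?f2 t)"
      using t by (auto simp: norm_mult cmod_powr_Rplus split: split_indicator)
  qed simp
  also have "\<dots> \<le> L2_norm ?f1 * L2_norm ?f2"
    by (rule L2_Cauchy_Schwarz_abs[OF f1(1) f2])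
  finally have "(cmod (prim (\<lambda>t. complex_of_real t powr \<beta> * g t) x))\<^sup>2 \<le> (L2_norm ?f1 * L2_norm ?f2)\<^sup>2"
    by (intro power_mono) auto
  also have "\<dots> = x powr k / k * (LINT t|LR. indicator {..x} t * t powr k * (cmod (g t))\<^sup>2)"
    using k assms(3) unfolding power_mult_distrib f1(2) L2_norm_sq sq by simp
  finally have "(cmod (hardy \<beta> g x))\<^sup>2 \<le> (x powr (-1 - Re \<beta>))\<^sup>2 *
      (x powr k / k * (LINT t|LR. indicator {..x} t * t powr k * (cmod (g t))\<^sup>2))"
    using assms(3) unfolding hardy_def norm_mult power_mult_distrib
    by (simp only: cmod_powr_Rplus minus_complex.sel uminus_complex.sel one_complex.sel) (intro mult_left_mono, auto)
  also have "\<dots> = ((x powr (-1 - Re \<beta>))\<^sup>2 * x powr k) / k * (LINT t|LR. indicator {..x} t * t powr k * (cmod (g t))\<^sup>2)"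
    by simp
  \<comment> \<open>With Re \<beta> = k - 1/2 the exponent is -2 - 2 (k - 1/2) + k = -k - 1, which
    is integrable at infinity.\<close>
  also have "(x powr (-1 - Re \<beta>))\<^sup>2 * x powr k = x powr (- k - 1)"
    by (simp add: power2_eq_square powr_add[symmetric] k_def field_simps)
  finally show "(cmod (hardy \<beta> g x))\<^sup>2 \<le> x powr (- k - 1) / k * (LINT t|LR. indicator {..x} t * t powr k * (cmod (g t))\<^sup>2)" .
qed

lemma hardy_measurable:
  assumes "g \<in> borel_measurable LR"
  shows "hardy \<beta> g \<in> borel_measurable LR"
proof -
  note [measurable] = assms prim_measurable
  show ?thesis
    unfolding hardy_def[abs_def] by measurable
qed

text \<open>The square of the norm collects two factors 1 / k, one from the integral of s^(k-1) over
  [0, x] and one from that of x^(-k-1) over [t, infinity[. For \<beta> = 0 this is the classical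
  constant 2.\<close>

lemma hardy_inequality:
  assumes "Re \<beta> > -1/2" "g \<in> L2"
  shows "hardy \<beta> g \<in> L2" and "L2_norm (hardy \<beta> g) \<le> L2_norm g / (Re \<beta> + 1/2)"
proof -
  define k where "k = Re \<beta> + 1/2"
  have k: "k > 0"
    using assms by (simp add: k_def)
  note [measurable] = L2_measurable[OF assms(2)] hardy_measurable[OF L2_measurable[OF assms(2)]]
  have [measurable]: "(\<lambda>t. t powr e) \<in> borel_measurable LR" for e :: real
    by measurable
  interpret LR: sigma_finite_measure LR
    by (rule sigma_finite_LR)
  interpret LR2: pair_sigma_finite LR LR ..
  let ?K = "\<lambda>x t. ennreal (x powr (- k - 1)) * indicator {t..} x * ennreal (t powr k * (cmod (g t))\<^sup>2)"
  \<comment> \<open>Nonnegative integrals throughout, since the integrability of the left-hand side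
    is part of the claim.\<close>
  have "(\<integral>\<^sup>+x. ennreal ((cmod (hardy \<beta> g x))\<^sup>2) \<partial>LR) \<le> (\<integral>\<^sup>+x. ennreal (1 / k) * (\<integral>\<^sup>+t. ?K x t \<partial>LR) \<partial>LR)"
  proof (rule nn_integral_mono)
    fix x assume "x \<in> space LR"
    then have x: "0 < x" by simp
    let ?I = "LINT t|LR. indicator {..x} t * t powr k * (cmod (g t))\<^sup>2"
    have "ennreal ((cmod (hardy \<beta> g x))\<^sup>2) \<le> ennreal (1 / k * (x powr (- k - 1) * ?I))"
      using hardy_pointwise(1)[OF assms x] by (intro ennreal_leI) (simp add: k_def)
    also have "\<dots> = ennreal (1 / k) * (ennreal (x powr (- k - 1)) * ennreal ?I)"
      using k by (subst ennreal_mult', simp, subst ennreal_mult', simp_all)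
    also have "ennreal ?I = (\<integral>\<^sup>+t. ennreal (indicator {..x} t * t powr k * (cmod (g t))\<^sup>2) \<partial>LR)"
      using hardy_pointwise(2)[OF assms x] by (intro nn_integral_eq_integral[symmetric]) (auto simp: k_def)
    also have "ennreal (x powr (- k - 1)) * \<dots> = (\<integral>\<^sup>+t. ?K x t \<partial>LR)"
      by (subst nn_integral_cmult[symmetric])
        (auto intro!: nn_integral_cong split: split_indicator simp: ennreal_mult')
    finally show "ennreal ((cmod (hardy \<beta> g x))\<^sup>2) \<le> ennreal (1 / k) * (\<integral>\<^sup>+t. ?K x t \<partial>LR)" .
  qed
  also have "\<dots> = ennreal (1 / k) * (\<integral>\<^sup>+x. \<integral>\<^sup>+t. ?K x t \<partial>LR \<partial>LR)"
  proof (rule nn_integral_cmult)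
    have "(\<lambda>(x, t). ?K x t) = (\<lambda>p. ennreal (fst p powr (- k - 1)) * (if snd p \<le> fst p then 1 else 0) *
        ennreal (snd p powr k * (cmod (g (snd p)))\<^sup>2))"
      by (auto simp: fun_eq_iff split: split_indicator)
    moreover have "\<dots> \<in> borel_measurable (LR \<Otimes>\<^sub>M LR)"
      by measurable
    ultimately show "(\<lambda>x. \<integral>\<^sup>+t. ?K x t \<partial>LR) \<in> borel_measurable LR"
      by (intro LR.borel_measurable_nn_integral) simp
  qed
  also have "(\<integral>\<^sup>+x. \<integral>\<^sup>+t. ?K x t \<partial>LR \<partial>LR) = (\<integral>\<^sup>+t. \<integral>\<^sup>+x. ?K x t \<partial>LR \<partial>LR)"
  proof (rule LR2.Fubini')
    have "(\<lambda>(t, x). ?K x t) = (\<lambda>p. ennreal (snd p powr (- k - 1)) * (if fst p \<le> snd p then 1 else 0) *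
        ennreal (fst p powr k * (cmod (g (fst p)))\<^sup>2))"
      by (auto simp: fun_eq_iff split: split_indicator)
    moreover have "\<dots> \<in> borel_measurable (LR \<Otimes>\<^sub>M LR)"
      by measurable
    ultimately show "(\<lambda>(t, x). ?K x t) \<in> borel_measurable (LR \<Otimes>\<^sub>M LR)"
      by simp
  qed
  also have "\<dots> = (\<integral>\<^sup>+t. ennreal (1 / k) * ennreal ((cmod (g t))\<^sup>2) \<partial>LR)"
  proof (rule nn_integral_cong)
    fix t assume "t \<in> space LR"
    then have t: "0 < t" by simp
    have "(\<integral>\<^sup>+x. ?K x t \<partial>LR) =
        (\<integral>\<^sup>+x. ennreal (x powr (- k - 1)) * indicator {t..} x \<partial>LR) * ennreal (t powr k * (cmod (g t))\<^sup>2)"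
      by (rule nn_integral_multc) measurable
    also have "\<dots> = ennreal (t powr (- k - 1 + 1) / - (- k - 1 + 1)) * ennreal (t powr k * (cmod (g t))\<^sup>2)"
      using k t by (subst nn_integral_powr_inf) auto
    also have "\<dots> = ennreal ((t powr (- k) * t powr k) * (1 / k) * (cmod (g t))\<^sup>2)"
      using k by (simp add: ennreal_mult''[symmetric] mult_ac)
    also have "t powr (- k) * t powr k = 1"
      using t by (simp add: powr_add[symmetric])
    finally show "(\<integral>\<^sup>+x. ?K x t \<partial>LR) = ennreal (1 / k) * ennreal ((cmod (g t))\<^sup>2)"
      using k by (simp add: ennreal_mult''[symmetric])
  qed
  also have "\<dots> = ennreal (1 / k) * ennreal ((L2_norm g)\<^sup>2)"
    using L2_integrable_sq[OF assms(2)]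
    by (simp add: nn_integral_cmult nn_integral_eq_integral L2_norm_sq)
  also have "ennreal (1 / k) * (ennreal (1 / k) * ennreal ((L2_norm g)\<^sup>2)) = ennreal ((L2_norm g / k)\<^sup>2)"
    using k by (simp add: ennreal_mult''[symmetric] power2_eq_square)
  finally have le: "(\<integral>\<^sup>+x. ennreal ((cmod (hardy \<beta> g x))\<^sup>2) \<partial>LR) \<le> ennreal ((L2_norm g / k)\<^sup>2)" .
  then have int: "integrable LR (\<lambda>x. (cmod (hardy \<beta> g x))\<^sup>2)"
    by (intro integrableI_bounded) (auto intro: le_less_trans simp: ennreal_less_top)
  then show "hardy \<beta> g \<in> L2"
    unfolding L2_def by simp
  have "(L2_norm (hardy \<beta> g))\<^sup>2 \<le> (L2_norm g / k)\<^sup>2"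
    using le int k by (simp add: nn_integral_eq_integral L2_norm_sq[symmetric])
  then show "L2_norm (hardy \<beta> g) \<le> L2_norm g / (Re \<beta> + 1/2)"
    unfolding k_def[symmetric] using k by (intro power2_le_imp_le[of "L2_norm (hardy \<beta> g)"]) auto
qed

lemma hardy_diff:
  assumes "Re \<beta> > -1/2" "g \<in> L2" "h \<in> L2"
  shows "hardy \<beta> (\<lambda>x. g x - h x) x = hardy \<beta> g x - hardy \<beta> h x"
  unfolding hardy_def right_diff_distrib
  by (subst prim_diff) (auto intro!: weighted_loc_integrable assms simp: right_diff_distrib)

lemma hardy_cong: "(\<And>t. 0 < t \<Longrightarrow> g t = h t) \<Longrightarrow> hardy \<beta> g x = hardy \<beta> h x"
  unfolding hardy_def using prim_cong[of "\<lambda>t. complex_of_real t powr \<beta> * g t"] by simp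

lemma hardy_eq:
  assumes "prim (\<lambda>t. complex_of_real t powr \<beta> * g t) x = complex_of_real x powr (1 + \<beta>) * c" "0 < x"
  shows "hardy \<beta> g x = c"
  unfolding hardy_def assms(1) using assms(2)
  by (simp add: powr_add[symmetric] mult.assoc[symmetric])

section \<open>Density of test functions\<close>

lemma L2_norm_tendsto_0:
  assumes "\<And>n. f n \<in> borel_measurable LR" "w \<in> L2"
    "AE x in LR. (\<lambda>n. f n x) \<longlonglongrightarrow> 0" "\<And>n. AE x in LR. cmod (f n x) \<le> cmod (w x)"
  shows "(\<lambda>n. L2_norm (f n)) \<longlonglongrightarrow> 0"
proof -
  have "(\<lambda>n. LINT x|LR. (cmod (f n x))\<^sup>2) \<longlonglongrightarrow> (LINT x|LR. (0::real))"
  proof (rule integral_dominated_convergence[where w = "\<lambda>x. (cmod (w x))\<^sup>2"])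
    show "integrable LR (\<lambda>x. (cmod (w x))\<^sup>2)"
      by (rule L2_integrable_sq[OF assms(2)])
    show "AE x in LR. (\<lambda>n. (cmod (f n x))\<^sup>2) \<longlonglongrightarrow> 0"
      using assms(3)
    proof eventually_elim
      case (elim x)
      then show ?case
        using tendsto_power[OF tendsto_norm[OF elim], of 2] by simp
    qed
    show "AE x in LR. norm ((cmod (f n x))\<^sup>2) \<le> (cmod (w x))\<^sup>2" for n
      using assms(4)[of n] by eventually_elim (auto intro: power_mono)
  qed (use assms(1) in measurable)
  from tendsto_real_sqrt[OF this] show ?thesis
    by (simp add: L2_norm_def)
qed

text \<open>The three bounds concern \<xi>, x \<xi>' and x^2 \<xi>'', which are invariant under
  dilation of the argument: the same K serves every \<xi>(c x), in particular uniformly along a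
  sequence of cutoffs moving to infinity.\<close>

locale cutoff_function =
  fixes \<xi> \<xi>1 \<xi>2 :: "real \<Rightarrow> complex" and \<epsilon> R K :: real
  assumes eps_R: "0 < \<epsilon>" "\<epsilon> < R"
    and xi_one: "\<And>x. 0 < x \<Longrightarrow> x < \<epsilon> \<Longrightarrow> \<xi> x = 1"
    and xi_zero: "\<And>x. R < x \<Longrightarrow> \<xi> x = 0"
    and xi_smooth: "smooth_on Rplus \<xi>" "smooth_on Rplus \<xi>1" "smooth_on Rplus \<xi>2"
    and xi_deriv: "\<And>x. 0 < x \<Longrightarrow> (\<xi> has_vector_derivative \<xi>1 x) (at x)"
      "\<And>x. 0 < x \<Longrightarrow> (\<xi>1 has_vector_derivative \<xi>2 x) (at x)"
    and xi_deriv_zero: "\<And>x. 0 < x \<Longrightarrow> x < \<epsilon> \<or> R < x \<Longrightarrow> \<xi>1 x = 0 \<and> \<xi>2 x = 0"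
    and K_nonneg: "0 \<le> K"
    and xi_bound: "\<And>x. 0 < x \<Longrightarrow> cmod (\<xi> x) \<le> K"
      "\<And>x. 0 < x \<Longrightarrow> x * cmod (\<xi>1 x) \<le> K" "\<And>x. 0 < x \<Longrightarrow> x\<^sup>2 * cmod (\<xi>2 x) \<le> K"

lemma cutoffs_cutoff_function:
  assumes "\<xi> \<in> cutoffs"
  obtains \<xi>1 \<xi>2 \<epsilon> R K where "cutoff_function \<xi> \<xi>1 \<xi>2 \<epsilon> R K"
proof -
  let ?S = "{x \<in> {0..}. \<xi> x \<noteq> 0}"
  obtain \<epsilon> where xi: "smooth_on {0..} \<xi>" "compact (closure ?S)" "\<epsilon> > 0" "\<And>x. 0 \<le> x \<Longrightarrow> x < \<epsilon> \<Longrightarrow> \<xi> x = 1"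
    using assms unfolding cutoffs_def Cc_smooth_def by auto
  obtain B where B: "\<And>x. x \<in> closure ?S \<Longrightarrow> norm x \<le> B"
    using compact_imp_bounded[OF xi(2)] unfolding bounded_iff by auto
  have B': "x \<le> B" if "0 \<le> x" "\<xi> x \<noteq> 0" for x
    using B[of x] closure_subset[of ?S] that by auto
  \<comment> \<open>The summand 1 gives the strict inequality between \<epsilon> and R and puts R
    beyond the support.\<close>
  define R where "R = max \<epsilon> B + 1"
  have R: "\<epsilon> < R"
    by (simp add: R_def)
  have R0: "\<xi> x = 0" if "R < x" for x
  proof -
    have "0 < x" "B < x"
      using xi(3) that by (auto simp: R_def)
    then show ?thesis
      using B'[of x] by force
  qed
  have sm: "smooth_on Rplus \<xi>"
    by (rule smooth_on_subset[OF xi(1)]) auto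
  define \<xi>1 where "\<xi>1 = vderiv \<xi>"
  define \<xi>2 where "\<xi>2 = vderiv \<xi>1"
  have d1: "(\<xi> has_vector_derivative \<xi>1 x) (at x)" if "0 < x" for x
    unfolding \<xi>1_def by (rule smooth_on_vderiv(2)[OF sm that])
  have z1: "\<xi>1 x = 0" if "0 < x" "x < \<epsilon> \<or> R < x" for x
    using that(2)
  proof
    assume "x < \<epsilon>"
    then show ?thesis
      using has_vector_derivative_locally_const[OF d1[OF that(1)], of "{0<..<\<epsilon>}" 1] xi that by auto
  next
    assume "R < x"
    then show ?thesis
      using has_vector_derivative_locally_const[OF d1[OF that(1)], of "{R<..}" 0] R R0 xi(3) that by auto
  qed
  \<comment> \<open>\<xi> does not vanish near 0, but it is constant there, so its derivatives are
    test functions on the open half-line and are bounded even after multiplication by powers of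
    x.\<close>
  have c1: "\<xi>1 \<in> Cc_smooth Rplus"
    by (rule Cc_smoothI[of _ \<epsilon> R]) (use smooth_on_vderiv(1)[OF sm] xi R z1 in \<open>auto simp: \<xi>1_def\<close>)
  have c2: "\<xi>2 \<in> Cc_smooth Rplus" and d2: "\<And>x. 0 < x \<Longrightarrow> (\<xi>1 has_vector_derivative \<xi>2 x) (at x)"
    unfolding \<xi>2_def using Cc_smooth_vderiv[OF c1] by auto
  have z2: "\<xi>2 x = 0" if "0 < x" "x < \<epsilon> \<or> R < x" for x
    using that(2)
  proof
    assume "x < \<epsilon>"
    then show ?thesis
      using has_vector_derivative_locally_const[OF d2[OF that(1)], of "{0<..<\<epsilon>}" 0] z1 that by auto
  next
    assume "R < x"
    then show ?thesis
      using has_vector_derivative_locally_const[OF d2[OF that(1)], of "{R<..}" 0] z1 xi(3) R that by auto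
  qed
  have idsm: "smooth_on Rplus complex_of_real"
    by (rule smooth_on_cong[OF smooth_on_powr[of 1]]) auto
  have "bounded (\<xi> ` {0..R})"
    by (intro compact_imp_bounded compact_continuous_image
        continuous_on_subset[OF smooth_on_continuous_on[OF xi(1)]]) auto
  then obtain K0 where K0: "\<forall>y\<in>\<xi> ` {0..R}. cmod y \<le> K0"
    unfolding bounded_iff by blast
  obtain K1 where K1: "\<And>x. 0 < x \<Longrightarrow> cmod (complex_of_real x * \<xi>1 x) \<le> K1"
    using Cc_smooth_bounded[OF Cc_smooth_mult[OF c1 idsm]] by blast
  obtain K2 where K2: "\<And>x. 0 < x \<Longrightarrow> cmod ((complex_of_real x * complex_of_real x) * \<xi>2 x) \<le> K2"
    using Cc_smooth_bounded[OF Cc_smooth_mult[OF c2 smooth_on_mult[OF idsm idsm]]] by blast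
  define K where "K = \<bar>K0\<bar> + \<bar>K1\<bar> + \<bar>K2\<bar>"
  have "cutoff_function \<xi> \<xi>1 \<xi>2 \<epsilon> R K"
  proof
    show "cmod (\<xi> x) \<le> K" if "0 < x" for x
    proof (cases "x \<le> R")
      case True
      then have "cmod (\<xi> x) \<le> K0"
        using K0 that by auto
      then show ?thesis
        by (simp add: K_def)
    qed (use R0 in \<open>auto simp: K_def\<close>)
    show "x * cmod (\<xi>1 x) \<le> K" if "0 < x" for x
      using K1[OF that] that by (simp add: norm_mult K_def)
    show "x\<^sup>2 * cmod (\<xi>2 x) \<le> K" if "0 < x" for x
      using K2[OF that] that by (simp add: norm_mult K_def power2_eq_square)
  qed (use xi R R0 sm d1 d2 z1 z2 c1 c2 Cc_smooth_smooth in \<open>auto simp: K_def\<close>)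
  then show thesis
    by (rule that)
qed

context cutoff_function
begin

lemma xi_scaled_smooth: "0 < c \<Longrightarrow> smooth_on Rplus (\<lambda>x. \<xi> (c * x))"
  "0 < c \<Longrightarrow> smooth_on Rplus (\<lambda>x. \<xi>1 (c * x))" "0 < c \<Longrightarrow> smooth_on Rplus (\<lambda>x. \<xi>2 (c * x))"
  by (auto intro: smooth_on_rescale xi_smooth)

lemma xi_scaled_deriv:
  assumes "0 < c" "0 < x"
  shows "((\<lambda>x. \<xi> (c * x)) has_vector_derivative complex_of_real c * \<xi>1 (c * x)) (at x)"
    and "((\<lambda>x. \<xi>1 (c * x)) has_vector_derivative complex_of_real c * \<xi>2 (c * x)) (at x)"
proof -
  have c: "((\<lambda>x. c * x) has_vector_derivative c) (at x)"
    by (auto intro!: derivative_eq_intros)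
  show "((\<lambda>x. \<xi> (c * x)) has_vector_derivative complex_of_real c * \<xi>1 (c * x)) (at x)"
    using vector_diff_chain_at[OF c, of \<xi> "\<xi>1 (c * x)"] xi_deriv(1)[of "c * x"] assms
    by (simp add: o_def scaleR_conv_of_real)
  show "((\<lambda>x. \<xi>1 (c * x)) has_vector_derivative complex_of_real c * \<xi>2 (c * x)) (at x)"
    using vector_diff_chain_at[OF c, of \<xi>1 "\<xi>2 (c * x)"] xi_deriv(2)[of "c * x"] assms
    by (simp add: o_def scaleR_conv_of_real)
qed

text \<open>Near 0 both dilates of \<xi> equal 1 and cancel; on [a, b] the slow one is still 1 while
  the fast one has already vanished; far out both vanish.\<close>

lemma plateauE:
  assumes "0 < a" "a \<le> b"
  obtains \<theta> B C where "\<theta> \<in> Cc_smooth Rplus" "\<And>x. a \<le> x \<Longrightarrow> x \<le> b \<Longrightarrow> \<theta> x = 1"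
    "0 < B" "\<And>x. B < x \<Longrightarrow> \<theta> x = 0" "0 < C" "\<And>x. 0 < x \<Longrightarrow> cmod (\<theta> x) \<le> C"
proof -
  \<comment> \<open>Chosen so that c b = \<epsilon> / 2 lies where \<xi> is 1, and below d a = 2 R
    where \<xi> is 0.\<close>
  define c where "c = \<epsilon> / (2 * b)"
  define d where "d = 2 * R / a"
  define \<theta> where "\<theta> = (\<lambda>x. \<xi> (c * x) - \<xi> (d * x))"
  have pos: "0 < c" "0 < d" "0 < b" "0 < R"
    using assms eps_R by (auto simp: c_def d_def)
  have "c \<le> \<epsilon> / (2 * a)"
    using assms eps_R by (auto simp: c_def intro!: divide_left_mono)
  also have "\<dots> \<le> d"
    using assms eps_R unfolding d_def by (simp add: divide_simps)
  finally have cd: "c \<le> d" .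
  have zero: "\<theta> x = 0" if "0 < x" "x < \<epsilon> / d \<or> R / c < x" for x
    using that(2)
  proof
    assume "x < \<epsilon> / d"
    then have "d * x < \<epsilon>"
      using pos by (simp add: field_simps)
    moreover have "c * x \<le> d * x"
      using cd that by (intro mult_right_mono) auto
    ultimately have "c * x < \<epsilon>" "d * x < \<epsilon>"
      by linarith+
    then show ?thesis
      using that pos by (simp add: \<theta>_def xi_one)
  next
    assume "R / c < x"
    then have "R < c * x"
      using pos by (simp add: field_simps)
    moreover have "c * x \<le> d * x"
      using cd that by (intro mult_right_mono) auto
    ultimately show ?thesis
      by (simp add: \<theta>_def xi_zero)
  qed
  show thesis
  \<comment> \<open>The extra 1 makes the bound positive even if K = 0; it is divided by
    later.\<close>
  proof (rule that[of \<theta> "R / c" "2 * K + 1"])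
    have "\<epsilon> / d < R / c"
      using cd pos eps_R by (intro frac_less) auto
    then show "\<theta> \<in> Cc_smooth Rplus"
      using zero pos eps_R unfolding \<theta>_def
      by (intro Cc_smoothI[of _ "\<epsilon> / d" "R / c"] smooth_on_diff xi_scaled_smooth) auto
    show "\<theta> x = 1" if "a \<le> x" "x \<le> b" for x
    proof -
      have "c * x \<le> c * b"
        using that pos by (intro mult_left_mono) auto
      also have "c * b < \<epsilon>"
        using pos eps_R by (simp add: c_def)
      finally have "\<xi> (c * x) = 1"
        using pos that assms by (intro xi_one) auto
      moreover have "R < d * a"
        using assms pos by (simp add: d_def)
      moreover have "d * a \<le> d * x"
        using that pos by (intro mult_left_mono) auto
      ultimately show ?thesis
        by (simp add: \<theta>_def xi_zero)
    qed
    show "cmod (\<theta> x) \<le> 2 * K + 1" if "0 < x" for x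
      using norm_triangle_ineq4[of "\<xi> (c * x)" "\<xi> (d * x)"] xi_bound(1)[of "c * x"] xi_bound(1)[of "d * x"] pos that
      by (simp add: \<theta>_def)
    show "0 < R / c"
      using pos by simp
    then show "\<theta> x = 0" if "R / c < x" for x
      using zero[of x] that by linarith
  qed (use K_nonneg in auto)
qed

text \<open>A single parameter bounds the values and keeps the support away from both 0 and
  infinity; convergence is dominated by G itself.\<close>

lemma L2_truncate:
  assumes "G \<in> L2" "e > 0"
  obtains H and k :: real where "H \<in> borel_measurable LR" "1 \<le> k" "\<And>x. cmod (H x) \<le> k"
    "\<And>x. H x \<noteq> 0 \<Longrightarrow> 1 / k \<le> x \<and> x \<le> k" "L2_norm (\<lambda>x. G x - H x) < e"
proof -
  note [measurable] = L2_measurable[OF assms(1)]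
  define H where "H n x = (if 1 / real (Suc n) \<le> x \<and> x \<le> real (Suc n) \<and> cmod (G x) \<le> real (Suc n) then G x else 0)"
    for n x
  have H [measurable]: "H n \<in> borel_measurable LR" for n
    unfolding H_def[abs_def] by measurable
  have "(\<lambda>n. L2_norm (\<lambda>x. G x - H n x)) \<longlonglongrightarrow> 0"
  proof (rule L2_norm_tendsto_0[OF _ assms(1)])
    show "(\<lambda>x. G x - H n x) \<in> borel_measurable LR" for n
      by measurable
    show "AE x in LR. cmod (G x - H n x) \<le> cmod (G x)" for n
      by (intro AE_I2) (auto simp: H_def)
    show "AE x in LR. (\<lambda>n. G x - H n x) \<longlonglongrightarrow> 0"
    proof (rule AE_LR_everywhere)
      fix x :: real assume x: "0 < x"
      obtain N where N: "max (max (1 / x) x) (cmod (G x)) \<le> real N"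
        using real_arch_simple by blast
      have "G x - H n x = 0" if "n \<ge> N" for n
      proof -
        have "real N \<le> real (Suc n)"
          using that by simp
        then have "1 / x \<le> real (Suc n)" "x \<le> real (Suc n)" "cmod (G x) \<le> real (Suc n)"
          using N by auto
        moreover from this(1) have "1 / real (Suc n) \<le> x"
          using x by (simp add: divide_simps mult.commute)
        ultimately show ?thesis
          by (simp add: H_def)
      qed
      then have "\<forall>\<^sub>F n in sequentially. G x - H n x = 0"
        unfolding eventually_sequentially by blast
      then show "(\<lambda>n. G x - H n x) \<longlonglongrightarrow> 0"
        by (rule tendsto_eventually)
    qed
  qed
  then have "\<forall>\<^sub>F n in sequentially. L2_norm (\<lambda>x. G x - H n x) < e"
    using assms(2) order_tendstoD(2) by blast
  then obtain n where n: "L2_norm (\<lambda>x. G x - H n x) < e"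
    by (auto simp: eventually_sequentially)
  show thesis
    by (rule that[OF H _ _ _ n, of "real (Suc n)"]) (auto simp: H_def split: if_splits)
qed

text \<open>Measurable functions are almost everywhere limits of continuous ones. Composing with
  \<open>cl\<close>, the radial retraction onto the disc of radius k, restores the uniform bound
  without moving the limit H, and dominated convergence on [0, B] applies.\<close>

lemma bounded_measurable_approx_continuous:
  assumes "H \<in> borel_measurable LR" "0 < k" "\<And>x. cmod (H x) \<le> k" "e > 0"
  obtains q where "continuous_on UNIV q" "\<And>x. cmod (q x) \<le> k"
    "L2_norm (\<lambda>x. indicator {0..B} x *\<^sub>R (H x - q x)) < e"
proof -
  note [measurable] = assms(1)
  have "H measurable_on Rplus"
    using assms(1) by (simp add: measurable_on_iff_borel_measurable)
  then obtain N g where N: "negligible N" and g: "\<And>n. continuous_on UNIV (g n)"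
    and lim: "\<And>x. x \<notin> N \<Longrightarrow> (\<lambda>n. g n x) \<longlonglongrightarrow> (if x \<in> Rplus then H x else 0)"
    unfolding measurable_on_def by blast
  define cl where "cl z = complex_of_real (k / max k (cmod z)) * z" for z
  have cl_cont: "continuous_on UNIV cl"
    unfolding cl_def using assms(2) by (intro continuous_intros) auto
  have cl_bound: "cmod (cl z) \<le> k" for z
    using assms(2) by (cases "z = 0") (auto simp: cl_def norm_mult norm_divide max_def)
  have cl_id: "cl z = z" if "cmod z \<le> k" for z
    using that assms(2) by (simp add: cl_def max_def)
  define q where "q n x = cl (g n x)" for n x
  have q: "continuous_on UNIV (q n)" for n
    unfolding q_def[abs_def] by (intro continuous_on_compose2[OF cl_cont g]) auto
  then have [measurable]: "q n \<in> borel_measurable LR" for n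
    by (intro borel_measurable_LR_I borel_measurable_continuous_onI)
  have "(\<lambda>n. L2_norm (\<lambda>x. indicator {0..B} x *\<^sub>R (H x - q n x))) \<longlonglongrightarrow> 0"
  proof (rule L2_norm_tendsto_0)
    show "(\<lambda>x. indicator {0..B} x *\<^sub>R (H x - q n x)) \<in> borel_measurable LR" for n
      by measurable
    show "(\<lambda>x. complex_of_real (2 * k) * complex_of_real (indicator {0..B} x)) \<in> L2"
      by (intro L2_scale indicator_L2)
    show "AE x in LR. cmod (indicator {0..B} x *\<^sub>R (H x - q n x)) \<le> cmod (complex_of_real (2 * k) * complex_of_real (indicator {0..B} x))" for n
    proof (rule AE_I2)
      fix x
      have "cmod (H x - q n x) \<le> 2 * k"
        using norm_triangle_ineq4[of "H x" "q n x"] assms(3)[of x] cl_bound[of "g n x"] by (simp add: q_def)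
      then show "cmod (indicator {0..B} x *\<^sub>R (H x - q n x)) \<le> cmod (complex_of_real (2 * k) * complex_of_real (indicator {0..B} x))"
        using assms(2) by (auto simp: norm_mult split: split_indicator)
    qed
    have "AE x in lebesgue. x \<notin> N"
      using N by (intro AE_not_in) (simp add: negligible_iff_null_sets)
    then have "AE x in LR. x \<notin> N"
      by (intro AE_restrict_space_iff[THEN iffD2]) (auto elim: eventually_mono)
    then show "AE x in LR. (\<lambda>n. indicator {0..B} x *\<^sub>R (H x - q n x)) \<longlonglongrightarrow> 0"
      using AE_space
    proof eventually_elim
      case (elim x)
      then have "(\<lambda>n. g n x) \<longlonglongrightarrow> H x"
        using lim[of x] by simp
      then have "(\<lambda>n. q n x) \<longlonglongrightarrow> cl (H x)"
        unfolding q_def by (rule isCont_tendsto_compose[rotated]) (use cl_cont in \<open>simp add: continuous_on_eq_continuous_at\<close>)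
      then have "(\<lambda>n. q n x) \<longlonglongrightarrow> H x"
        by (simp add: cl_id assms(3))
      then have "(\<lambda>n. indicator {0..B} x *\<^sub>R (H x - q n x)) \<longlonglongrightarrow> indicator {0..B} x *\<^sub>R (H x - H x)"
        by (intro tendsto_intros)
      then show ?case by simp
    qed
  qed
  then have "\<forall>\<^sub>F n in sequentially. L2_norm (\<lambda>x. indicator {0..B} x *\<^sub>R (H x - q n x)) < e"
    using assms(4) order_tendstoD(2) by blast
  then obtain n where "L2_norm (\<lambda>x. indicator {0..B} x *\<^sub>R (H x - q n x)) < e"
    by (auto simp: eventually_sequentially)
  then show thesis
    using that[OF q] cl_bound by (simp add: q_def)
qed

text \<open>Smoothness comes from polynomials and compact support from a plateau function. The error
  is below e/2 from truncation plus at most e/8 from each of the continuous and polynomial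
  approximations, the bound C of the plateau being divided out in advance.\<close>

lemma Cc_smooth_dense:
  assumes "G \<in> L2" "e > 0"
  obtains \<psi> where "\<psi> \<in> Cc_smooth Rplus" "L2_norm (\<lambda>x. G x - \<psi> x) < e"
proof -
  obtain H k where H: "H \<in> borel_measurable LR" "1 \<le> k" "\<And>x. cmod (H x) \<le> k"
    "\<And>x. H x \<noteq> 0 \<Longrightarrow> 1 / k \<le> x \<and> x \<le> k" "L2_norm (\<lambda>x. G x - H x) < e / 2"
    using L2_truncate[OF assms(1), of "e / 2"] assms(2) by auto
  obtain \<theta> B C where \<theta>: "\<theta> \<in> Cc_smooth Rplus" "\<And>x. 1 / k \<le> x \<Longrightarrow> x \<le> k \<Longrightarrow> \<theta> x = 1"
    "0 < B" "\<And>x. B < x \<Longrightarrow> \<theta> x = 0" "0 < C" "\<And>x. 0 < x \<Longrightarrow> cmod (\<theta> x) \<le> C"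
  proof -
    have "1 / k \<le> 1"
      using H(2) by simp
    then have "1 / k \<le> k"
      using H(2) by (rule order_trans)
    moreover have "0 < 1 / k"
      using H(2) by simp
    ultimately show ?thesis
      using plateauE that by blast
  qed
  note [measurable] = H(1) Cc_smooth_measurable[OF \<theta>(1)]
  let ?N = "L2_norm (\<lambda>x. complex_of_real (indicator {0..B} x))"
  obtain q where q: "continuous_on UNIV q" "\<And>x. cmod (q x) \<le> k"
    "L2_norm (\<lambda>x. indicator {0..B} x *\<^sub>R (H x - q x)) < e / (8 * C)"
    using bounded_measurable_approx_continuous[OF H(1) _ H(3), of "e / (8 * C)" B] H(2) assms(2) \<theta>(5) by auto
  \<comment> \<open>Turns a uniform error on [0, B] into an \<open>L2\<close> error of at most e /
    (8 C); \<open>?N + 1\<close> is positive whatever \<open>?N\<close> is.\<close>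
  define \<delta> where "\<delta> = e / (8 * C * (?N + 1))"
  have N1: "?N + 1 > 0"
    using L2_norm_nonneg[of "\<lambda>x. complex_of_real (indicator {0..B} x)"] by linarith
  have \<delta>: "\<delta> > 0"
    unfolding \<delta>_def using assms(2) \<theta>(5) N1 by simp
  obtain p where p: "polynomial_function p" "\<And>x. x \<in> {0..B} \<Longrightarrow> cmod (q x - p x) < \<delta>"
    using Stone_Weierstrass_polynomial_function[of "{0..B}" q \<delta>] \<delta> continuous_on_subset[OF q(1)] by auto
  have [measurable]: "p \<in> borel_measurable LR" "q \<in> borel_measurable LR"
    using q(1) smooth_on_continuous_on[OF smooth_on_polynomial_function[OF p(1), of Rplus]]
    by (auto intro: continuous_measurable_LR continuous_on_subset)
  let ?D = "\<lambda>x. indicator {0..B} x *\<^sub>R (H x - q x)" and ?E = "\<lambda>x. indicator {0..B} x *\<^sub>R (q x - p x)"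
  have D: "?D \<in> L2"
  proof (rule L2_of_bounded_support(1))
    have "cmod (H x - q x) \<le> 2 * k" for x
      using norm_triangle_ineq4[of "H x" "q x"] H(3)[of x] q(2)[of x] by simp
    then show "AE x in LR. cmod (?D x) \<le> (2 * k) * indicator {0..B} x"
      by (intro AE_I2) (auto split: split_indicator)
  qed measurable
  have E_le: "AE x in LR. cmod (?E x) \<le> \<delta> * indicator {0..B} x"
    using p(2) by (intro AE_I2) (auto split: split_indicator intro: less_imp_le)
  have E: "?E \<in> L2" "L2_norm ?E \<le> \<delta> * ?N"
    using L2_of_bounded_support[OF _ E_le] \<delta> by auto
  define \<psi> where "\<psi> = (\<lambda>x. p x * \<theta> x)"
  have \<psi>: "\<psi> \<in> Cc_smooth Rplus"
    unfolding \<psi>_def by (intro Cc_smooth_mult \<theta> smooth_on_polynomial_function p)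
  note [measurable] = Cc_smooth_measurable[OF \<psi>]
  have "cmod (H x - \<psi> x) \<le> C * cmod (?D x + ?E x)" if "0 < x" for x
  proof -
    \<comment> \<open>The plateau is 1 wherever H is nonzero, so the whole error carries the factor
      \<open>\<theta>\<close> and only [0, B] matters.\<close>
    have "H x = H x * \<theta> x"
      using \<theta>(2)[of x] H(4)[of x] by (cases "H x = 0") auto
    then have "H x - \<psi> x = \<theta> x * (H x - p x)"
      by (simp add: \<psi>_def algebra_simps)
    also have "cmod \<dots> \<le> C * cmod (?D x + ?E x)"
      using \<theta>(4)[of x] \<theta>(6)[OF that] that
      by (cases "x \<le> B") (auto simp: norm_mult intro: mult_right_mono)
    finally show ?thesis .
  qed
  then have *: "AE x in LR. cmod (H x - \<psi> x) \<le> C * cmod (?D x + ?E x)"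
    by (rule AE_LR_everywhere)
  have "L2_norm (\<lambda>x. H x - \<psi> x) \<le> C * L2_norm (\<lambda>x. ?D x + ?E x)"
    using \<theta>(5) by (intro L2_norm_mono[OF _ L2_add[OF D E(1)] _ *]) auto
  also have "\<dots> \<le> C * (e / (8 * C) + \<delta> * ?N)"
    using L2_norm_triangle[OF D E(1)] q(3) E(2) \<theta>(5) by (intro mult_left_mono) auto
  also have "\<delta> * ?N \<le> e / (8 * C)"
  proof -
    have "\<delta> * ?N \<le> \<delta> * (?N + 1)"
      using \<delta> by (intro mult_left_mono) auto
    also have "\<dots> = e / (8 * C)"
      using N1 by (simp add: \<delta>_def)
    finally show ?thesis .
  qed
  also have "C * (e / (8 * C) + e / (8 * C)) = e / 4"
    using \<theta>(5) by simp
  finally have HP: "L2_norm (\<lambda>x. H x - \<psi> x) \<le> e / 4"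
    using \<theta>(5) by simp
  have "H \<in> L2"
  proof (rule L2_of_bounded_support(1)[OF H(1)])
    have "cmod (H x) \<le> k * indicator {1 / k..k} x" for x
      using H(3)[of x] H(4)[of x] H(2) by (cases "H x = 0") auto
    then show "AE x in LR. cmod (H x) \<le> k * indicator {1 / k..k} x"
      by (intro AE_I2)
  qed
  then have "L2_norm (\<lambda>x. (G x - H x) + (H x - \<psi> x)) \<le> L2_norm (\<lambda>x. G x - H x) + L2_norm (\<lambda>x. H x - \<psi> x)"
    by (intro L2_norm_triangle L2_diff assms Cc_smooth_L2[OF \<psi>])
  also have "\<dots> < e"
    using HP H(5) assms(2) by linarith
  finally show thesis
    by (intro that[OF \<psi>]) simp
qed

text \<open>The pairing is bilinear, so it is the conjugate of u that is approximated: the squared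
  norm of u is the integral of u against (cnj u - psi), at most the norm of u times e.\<close>

lemma L2_fundamental_lemma:
  assumes "u \<in> L2" "\<And>\<psi>. \<psi> \<in> Cc_smooth Rplus \<Longrightarrow> (LINT x|LR. u x * \<psi> x) = 0"
  shows "ae_eq u (\<lambda>x. 0)"
proof -
  have "(L2_norm u)\<^sup>2 \<le> L2_norm u * e" if "e > 0" for e
  proof -
    obtain \<psi> where \<psi>: "\<psi> \<in> Cc_smooth Rplus" "L2_norm (\<lambda>x. cnj (u x) - \<psi> x) < e"
      using Cc_smooth_dense[OF L2_cnj[OF assms(1)] \<open>e > 0\<close>] by blast
    have "complex_of_real ((L2_norm u)\<^sup>2) = (LINT x|LR. u x * cnj (u x))"
      unfolding L2_norm_sq integral_complex_of_real[symmetric] complex_norm_square ..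
    also have "\<dots> = (LINT x|LR. u x * (cnj (u x) - \<psi> x))"
      using L2_mult_integrable[OF assms(1) L2_cnj[OF assms(1)]]
        L2_mult_integrable[OF assms(1) Cc_smooth_L2[OF \<psi>(1)]] assms(2)[OF \<psi>(1)]
      by (simp add: right_diff_distrib)
    finally have eq: "complex_of_real ((L2_norm u)\<^sup>2) = (LINT x|LR. u x * (cnj (u x) - \<psi> x))" .
    have "(L2_norm u)\<^sup>2 = cmod (LINT x|LR. u x * (cnj (u x) - \<psi> x))"
      unfolding eq[symmetric] by (simp del: of_real_power)
    also have "\<dots> \<le> L2_norm u * L2_norm (\<lambda>x. cnj (u x) - \<psi> x)"
      by (intro L2_Cauchy_Schwarz assms L2_diff L2_cnj Cc_smooth_L2 \<psi>)
    also have "\<dots> \<le> L2_norm u * e"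
      using \<psi>(2) by (intro mult_left_mono) auto
    finally show ?thesis .
  qed
  \<comment> \<open>For a positive norm this choice of e would give that its square is at most half
    of itself.\<close>
  from this[of "L2_norm u / 2"] have "L2_norm u = 0"
    by (cases "L2_norm u = 0") (auto simp: power2_eq_square less_le)
  then show ?thesis
    by (rule L2_norm_eq_0[OF assms(1)])
qed

lemma continuous_ae_zero:
  fixes u :: "real \<Rightarrow> complex"
  assumes "continuous_on Rplus u" "ae_eq u (\<lambda>x. 0)" "0 < x"
  shows "u x = 0"
proof (rule ccontr)
  assume "u x \<noteq> 0"
  define S where "S = {y \<in> Rplus. u y \<noteq> 0}"
  have "open S"
  proof -
    have "S = Rplus \<inter> u -` (- {0})"
      by (auto simp: S_def)
    then show ?thesis
      using continuous_open_preimage[OF assms(1), of "- {0}"] by auto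
  qed
  moreover have "x \<in> S"
    using assms \<open>u x \<noteq> 0\<close> by (simp add: S_def)
  ultimately have "\<not> negligible S"
    using open_not_negligible by blast
  have "AE x in lebesgue. x \<in> Rplus \<longrightarrow> u x = 0"
    using assms(2) unfolding ae_eq_def by (subst (asm) AE_restrict_space_iff) auto
  then obtain N where N: "N \<in> null_sets lebesgue" "{x \<in> space lebesgue. \<not> (x \<in> Rplus \<longrightarrow> u x = 0)} \<subseteq> N"
    by (auto simp: eventually_ae_filter)
  then have "S \<subseteq> N"
    by (auto simp: S_def)
  then have "negligible S"
    using N(1) negligible_subset by (auto simp: negligible_iff_null_sets)
  with \<open>\<not> negligible S\<close> show False ..
qed

text \<open>u need not be square-integrable at 0 or at infinity, so it is first localised by a
  plateau function equal to 1 at the point x.\<close>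

lemma continuous_fundamental_lemma:
  assumes "continuous_on Rplus u" "\<And>\<psi>. \<psi> \<in> Cc_smooth Rplus \<Longrightarrow> (LINT x|LR. u x * \<psi> x) = 0" "0 < x"
  shows "u x = 0"
proof -
  obtain \<theta> where \<theta>: "\<theta> \<in> Cc_smooth Rplus" "\<theta> x = 1"
    by (rule plateauE[of x x]) (use assms(3) in auto)
  have cont: "continuous_on Rplus (\<lambda>x. u x * \<theta> x)"
    by (intro continuous_on_mult assms smooth_on_continuous_on Cc_smooth_smooth \<theta>)
  have "(\<lambda>x. u x * \<theta> x) \<in> L2"
    by (rule cont_mult_Cc_L2(1)[OF assms(1) \<theta>(1)])
  moreover have "(LINT x|LR. (u x * \<theta> x) * \<psi> x) = 0" if "\<psi> \<in> Cc_smooth Rplus" for \<psi>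
    using assms(2)[OF Cc_smooth_mult[OF that Cc_smooth_smooth[OF \<theta>(1)]]] by (simp add: mult.assoc)
  ultimately have "ae_eq (\<lambda>x. u x * \<theta> x) (\<lambda>x. 0)"
    by (rule L2_fundamental_lemma)
  then have "u x * \<theta> x = 0"
    by (rule continuous_ae_zero[OF cont _ assms(3)])
  then show ?thesis
    by (simp add: \<theta>)
qed

end

section \<open>Functions vanishing to second order at the origin\<close>

definition prim2 :: "(real \<Rightarrow> complex) \<Rightarrow> real \<Rightarrow> complex" where
  "prim2 G = prim (prim G)"

lemma loc_integrable_cong:
  assumes "loc_integrable u" "\<And>t. 0 < t \<Longrightarrow> v t = u t"
  shows "loc_integrable v"
  unfolding loc_integrable_def
proof
  fix x
  have "integrable LR (\<lambda>t. indicator {..x} t *\<^sub>R u t)"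
    using assms(1) by (simp add: loc_integrable_def)
  then show "integrable LR (\<lambda>t. indicator {..x} t *\<^sub>R v t)"
    by (rule Bochner_Integration.integrable_cong[THEN iffD1, rotated 2]) (use assms(2) in auto)
qed

lemma L2_loc_integrable:
  assumes "G \<in> L2"
  shows "loc_integrable G"
  by (rule loc_integrable_cong[OF weighted_loc_integrable[of 0, OF _ assms]]) auto

text \<open>Written with \<open>powr 1\<close> so that the right-hand side has the form of the
  integrand in the weighted lemmas for \<beta> = 1.\<close>

lemma prim_eq_hardy:
  assumes "0 < x"
  shows "prim G x = complex_of_real x powr 1 * hardy 0 G x"
proof -
  have "prim (\<lambda>t. complex_of_real t powr 0 * G t) x = prim G x"
    by (rule prim_cong) auto
  then show ?thesis
    using assms by (simp add: hardy_def powr_minus field_simps)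
qed

lemma prim_bound:
  assumes "G \<in> L2" "0 \<le> x"
  shows "cmod (prim G x) \<le> sqrt x * L2_norm G"
proof -
  have "prim (\<lambda>t. complex_of_real t powr 0 * G t) x = prim G x"
    by (rule prim_cong) auto
  then show ?thesis
    using weighted_prim_bound[of 0 G x] assms by (cases "x = 0") auto
qed

text \<open>Cauchy--Schwarz against the indicator of [x, y]: the primitive of an \<open>L2\<close>
  function is Hoelder continuous of exponent 1/2, so \<open>prim G\<close> is continuous although G
  has no regularity.\<close>

lemma prim_holder:
  assumes "G \<in> L2" "0 < x" "x \<le> y"
  shows "cmod (prim G y - prim G x) \<le> sqrt (y - x) * L2_norm G"
proof -
  let ?i = "\<lambda>t. complex_of_real (indicator {x..y} t)"
  have loc: "integrable LR (\<lambda>t. indicator {..z} t *\<^sub>R G t)" for z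
    using L2_loc_integrable[OF assms(1)] by (simp add: loc_integrable_def)
  have "prim G y - prim G x = (LINT t|LR. indicator {..y} t *\<^sub>R G t - indicator {..x} t *\<^sub>R G t)"
    unfolding prim_def by (rule Bochner_Integration.integral_diff[symmetric]) (rule loc)+
  also have "cmod \<dots> \<le> (LINT t|LR. cmod (?i t) * cmod (G t))"
  proof (rule Bochner_Integration.integral_norm_bound_integral)
    show "integrable LR (\<lambda>t. indicator {..y} t *\<^sub>R G t - indicator {..x} t *\<^sub>R G t)"
      by (intro Bochner_Integration.integrable_diff loc)
    show "integrable LR (\<lambda>t. cmod (?i t) * cmod (G t))"
      using integrable_norm[OF L2_mult_integrable[OF indicator_L2 assms(1)]] by (simp add: norm_mult)
    show "cmod (indicator {..y} t *\<^sub>R G t - indicator {..x} t *\<^sub>R G t) \<le> cmod (?i t) * cmod (G t)" for t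
      using assms(3) by (auto split: split_indicator)
  qed
  also have "\<dots> \<le> L2_norm ?i * L2_norm G"
    by (rule L2_Cauchy_Schwarz_abs[OF indicator_L2 assms(1)])
  also have "L2_norm ?i = sqrt (y - x)"
  proof -
    \<comment> \<open>The length of the interval, obtained from the fundamental theorem for the
      identity function.\<close>
    have "(LINT t|LR. indicator {x..y} t *\<^sub>R (1 :: complex)) = complex_of_real y - complex_of_real x"
      by (rule FTC_LR(2)) (use assms in \<open>auto intro!: has_vector_derivative_real_field derivative_eq_intros\<close>)
    moreover have "(LINT t|LR. indicator {x..y} t *\<^sub>R (1 :: complex)) = complex_of_real (LINT t|LR. indicator {x..y} t)"
      by (subst integral_complex_of_real[symmetric]) (simp add: scaleR_conv_of_real)
    ultimately have "(LINT t|LR. (indicator {x..y} t :: real)) = y - x"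
      by (metis of_real_diff of_real_eq_iff)
    moreover have "(\<lambda>t. (cmod (?i t))\<^sup>2) = indicator {x..y}"
      by (auto simp: fun_eq_iff split: split_indicator)
    ultimately show ?thesis
      by (simp add: L2_norm_def)
  qed
  finally show ?thesis .
qed

lemma prim_continuous:
  assumes "G \<in> L2"
  shows "continuous_on {0..} (prim G)"
  unfolding continuous_on_def
proof
  fix x :: real assume x: "x \<in> {0..}"
  have "cmod (prim G y - prim G x) \<le> sqrt \<bar>y - x\<bar> * L2_norm G" if "y \<in> {0..}" for y
  \<comment> \<open>The Hoelder estimate assumes a positive left endpoint; at 0 the growth bound for
    \<open>prim\<close> replaces it.\<close>
  proof (cases "x = 0 \<or> y = 0")
    case True
    then show ?thesis
      using prim_bound[OF assms, of x] prim_bound[OF assms, of y] x that prim_nonpos[of 0 G] by auto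
  next
    case False
    then show ?thesis
      using prim_holder[OF assms, of x y] prim_holder[OF assms, of y x] x that
      by (cases "x \<le> y") (auto simp: norm_minus_commute)
  qed
  then have "\<forall>\<^sub>F y in at x within {0..}. norm (prim G y - prim G x) \<le> sqrt \<bar>y - x\<bar> * L2_norm G"
    by (auto simp: eventually_at_filter)
  moreover have "((\<lambda>y. sqrt \<bar>y - x\<bar> * L2_norm G) \<longlongrightarrow> sqrt \<bar>x - x\<bar> * L2_norm G) (at x within {0..})"
    by (intro tendsto_intros)
  ultimately have "((\<lambda>y. prim G y - prim G x) \<longlongrightarrow> 0) (at x within {0..})"
    by (elim Lim_null_comparison) simp
  then show "(prim G \<longlongrightarrow> prim G x) (at x within {0..})"
    by (rule LIM_zero_cancel)
qed

lemma prim_loc_integrable: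
  assumes "G \<in> L2"
  shows "loc_integrable (prim G)"
proof (rule loc_integrable_cong)
  show "loc_integrable (\<lambda>t. complex_of_real t powr 1 * hardy 0 G t)"
    by (rule weighted_loc_integrable) (use hardy_inequality(1)[OF _ assms, of 0] in auto)
qed (rule prim_eq_hardy)

text \<open>The inner primitive is x times a mean, and this x becomes the weight \<beta> = 1 of the
  outer operator.\<close>

lemma prim2_eq_hardy:
  assumes "0 < x"
  shows "prim2 G x = (complex_of_real x)\<^sup>2 * hardy 1 (hardy 0 G) x"
proof -
  have "prim (\<lambda>t. complex_of_real t powr 1 * hardy 0 G t) x = prim2 G x"
    unfolding prim2_def by (rule prim_cong) (simp add: prim_eq_hardy)
  moreover have "complex_of_real x powr (-2) = 1 / (complex_of_real x)\<^sup>2"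
    using powr_minus[of "complex_of_real x" 2] by (simp add: powr_numeral inverse_eq_divide)
  ultimately show ?thesis
    using assms by (simp add: hardy_def field_simps)
qed

text \<open>4/3 is 2 times 2/3, the Hardy constants for \<beta> = 0 and \<beta> = 1.\<close>

lemma hardy2:
  assumes "G \<in> L2"
  shows "hardy 1 (hardy 0 G) \<in> L2" "L2_norm (hardy 1 (hardy 0 G)) \<le> 4/3 * L2_norm G"
proof -
  note h0 = hardy_inequality[of 0 G]
  note h1 = hardy_inequality[of 1 "hardy 0 G"]
  show "hardy 1 (hardy 0 G) \<in> L2"
    using h0 h1 assms by auto
  have "L2_norm (hardy 0 G) \<le> 2 * L2_norm G" "L2_norm (hardy 1 (hardy 0 G)) \<le> 2/3 * L2_norm (hardy 0 G)"
    using h0 h1 assms by auto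
  then show "L2_norm (hardy 1 (hardy 0 G)) \<le> 4/3 * L2_norm G"
    by linarith
qed

lemma hardy2_diff:
  assumes "G \<in> L2" "H \<in> L2"
  shows "hardy 1 (hardy 0 (\<lambda>x. G x - H x)) x = hardy 1 (hardy 0 G) x - hardy 1 (hardy 0 H) x"
proof -
  have "hardy 1 (hardy 0 (\<lambda>x. G x - H x)) x = hardy 1 (\<lambda>x. hardy 0 G x - hardy 0 H x) x"
    by (rule hardy_cong) (simp add: hardy_diff assms)
  also have "\<dots> = hardy 1 (hardy 0 G) x - hardy 1 (hardy 0 H) x"
    by (rule hardy_diff) (use hardy_inequality[of 0] assms in auto)
  finally show ?thesis .
qed

lemma prim2_diff:
  assumes "G \<in> L2" "H \<in> L2"
  shows "prim2 (\<lambda>x. G x - H x) x = prim2 G x - prim2 H x"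
proof -
  have "prim (\<lambda>x. G x - H x) = (\<lambda>x. prim G x - prim H x)"
    using prim_diff[OF L2_loc_integrable L2_loc_integrable] assms by blast
  then show ?thesis
    unfolding prim2_def using prim_diff[OF prim_loc_integrable prim_loc_integrable] assms by simp
qed

lemma prim2_add:
  assumes "G \<in> L2" "H \<in> L2"
  shows "prim2 (\<lambda>x. G x + H x) x = prim2 G x + prim2 H x"
proof -
  have "prim (\<lambda>x. G x + H x) = (\<lambda>x. prim G x + prim H x)"
    using prim_add[OF L2_loc_integrable L2_loc_integrable] assms by blast
  then show ?thesis
    unfolding prim2_def using prim_add[OF prim_loc_integrable prim_loc_integrable] assms by simp
qed

text \<open>The growth x^(3/2) serves twice: it gives the vanishing derivative at 0, and it is what
  separates \<open>H2_0\<close> from the powers x^(1/2+m) with Re m < 1.\<close>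

lemma prim2_bound:
  assumes "G \<in> L2" "0 \<le> x"
  shows "cmod (prim2 G x) \<le> 2 * x * sqrt x * L2_norm G"
proof (cases "x = 0")
  case True
  then show ?thesis
    by (simp add: prim2_def prim_nonpos)
next
  case False
  then have x: "0 < x"
    using assms by simp
  have "prim2 G x = prim (\<lambda>t. complex_of_real t powr 1 * hardy 0 G t) x"
    unfolding prim2_def by (rule prim_cong) (simp add: prim_eq_hardy)
  also have "cmod \<dots> \<le> sqrt (x powr 3 / 3) * L2_norm (hardy 0 G)"
    using weighted_prim_bound[of 1 "hardy 0 G" x] hardy_inequality(1)[of 0 G] assms by simp
  also have "\<dots> \<le> (x * sqrt x) * (2 * L2_norm G)"
  proof (intro mult_mono)
    have "(x * sqrt x)\<^sup>2 = x ^ 3"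
      using x by (simp add: power_mult_distrib power3_eq_cube power2_eq_square)
    then have "x powr 3 / 3 \<le> (x * sqrt x)\<^sup>2"
      using x by (simp add: powr_numeral)
    then show "sqrt (x powr 3 / 3) \<le> x * sqrt x"
      using x by (intro real_le_lsqrt) auto
    show "L2_norm (hardy 0 G) \<le> 2 * L2_norm G"
      using hardy_inequality(2)[of 0 G] assms by simp
  qed (use x in auto)
  finally show ?thesis
    by (simp add: mult_ac)
qed

lemma prim_continuous_Rplus: "G \<in> L2 \<Longrightarrow> continuous_on Rplus (prim G)"
  by (rule continuous_on_subset[OF prim_continuous]) auto

lemma prim2_has_vector_derivative:
  assumes "G \<in> L2" "0 < x"
  shows "(prim2 G has_vector_derivative prim G x) (at x)"
  unfolding prim2_def
  by (rule prim_has_vector_derivative[OF prim_loc_integrable prim_continuous_Rplus]) (use assms in auto)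

lemma prim2_continuous_Rplus: "G \<in> L2 \<Longrightarrow> continuous_on Rplus (prim2 G)"
  using prim2_has_vector_derivative
  by (intro continuous_at_imp_continuous_on) (auto intro: has_vector_derivative_continuous)

text \<open>Only the one-sided derivative at 0 is new; there the difference quotient is of order
  sqrt y.\<close>

lemma prim2_has_vector_derivative_0:
  assumes "G \<in> L2" "x \<in> {0..}"
  shows "(prim2 G has_vector_derivative prim G x) (at x within {0..})"
proof (cases "x = 0")
  case False
  then show ?thesis
    using prim2_has_vector_derivative[OF assms(1), of x] assms(2) by (auto intro: has_vector_derivative_at_within)
next
  case True
  have "((\<lambda>y. prim2 G y /\<^sub>R y) \<longlongrightarrow> 0) (at 0 within {0..})"
  proof (rule Lim_null_comparison)
    show "\<forall>\<^sub>F y in at 0 within {0..}. norm (prim2 G y /\<^sub>R y) \<le> 2 * sqrt y * L2_norm G"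
      unfolding eventually_at_filter
    proof (intro always_eventually allI impI)
      fix y :: real assume "y \<noteq> 0" "y \<in> {0..}"
      then show "norm (prim2 G y /\<^sub>R y) \<le> 2 * sqrt y * L2_norm G"
        using prim2_bound[OF assms(1), of y] by (simp add: field_simps)
    qed
    have "((\<lambda>y. 2 * sqrt y * L2_norm G) \<longlongrightarrow> 2 * sqrt 0 * L2_norm G) (at 0 within {0..})"
      by (intro tendsto_intros)
    then show "((\<lambda>y. 2 * sqrt y * L2_norm G) \<longlongrightarrow> 0) (at 0 within {0..})"
      by simp
  qed
  moreover have "prim G 0 = 0" "prim2 G 0 = 0"
    by (simp_all add: prim2_def prim_nonpos)
  moreover have "norm (prim2 G y - prim2 G 0 - (y - 0) *\<^sub>R 0) / norm (y - 0) = norm (prim2 G y /\<^sub>R y)" for y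
    using calculation(3) by (simp add: divide_inverse mult.commute)
  ultimately show ?thesis
    unfolding True has_vector_derivative_def has_derivative_iff_norm
    by (auto simp: bounded_linear_zero divide_inverse mult.commute dest: tendsto_norm_zero)
qed

section \<open>Weak derivatives and the characterisation of the space by double primitives\<close>

lemma integration_by_parts_Cc:
  assumes "\<And>x. 0 < x \<Longrightarrow> (u has_vector_derivative u' x) (at x)" "continuous_on Rplus u'" "\<phi> \<in> Cc_smooth Rplus"
  shows "(LINT x|LR. u x * vderiv \<phi> x) = - (LINT x|LR. u' x * \<phi> x)"
proof -
  note d = Cc_smooth_vderiv[OF assms(3)]
  have cu: "continuous_on Rplus u"
    using assms(1) by (intro continuous_at_imp_continuous_on) (auto intro: has_vector_derivative_continuous)
  obtain a b where ab: "0 < a" "a < b" "\<And>x. 0 < x \<Longrightarrow> x < a \<or> b < x \<Longrightarrow> \<phi> x = 0"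
    using Cc_smooth_supportE[OF assms(3)] by blast
  have "(LINT x|LR. u x * vderiv \<phi> x + u' x * \<phi> x) = 0"
  proof (rule integral_deriv_Cc[where F = "\<lambda>x. u x * \<phi> x", OF ab(1,2)])
    show "((\<lambda>x. u x * \<phi> x) has_vector_derivative u x * vderiv \<phi> x + u' x * \<phi> x) (at x)" if "0 < x" for x
      using has_vector_derivative_mult[OF assms(1)[OF that] d(2)[OF that]] .
    show "continuous_on Rplus (\<lambda>x. u x * vderiv \<phi> x + u' x * \<phi> x)"
      by (intro continuous_intros cu assms Cc_smooth_continuous d(1))
  qed (use ab in auto)
  then show ?thesis
    using cont_mult_Cc_L2(2)[OF cu d(1)] cont_mult_Cc_L2(2)[OF assms(2,3)]
    by (simp add: eq_neg_iff_add_eq_0)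
qed

lemma prim2_mult_integrable:
  assumes "G \<in> L2" "\<phi> \<in> Cc_smooth Rplus"
  shows "integrable LR (\<lambda>x. prim2 G x * \<phi> x)"
  by (rule cont_mult_Cc_L2(2)[OF prim2_continuous_Rplus[OF assms(1)] assms(2)])

lemma Cc_prim_has_vector_derivative:
  assumes "\<psi> \<in> Cc_smooth Rplus" "0 < x"
  shows "(prim \<psi> has_vector_derivative \<psi> x) (at x)"
  by (rule prim_has_vector_derivative[OF L2_loc_integrable[OF Cc_smooth_L2] Cc_smooth_continuous]) (use assms in auto)

lemma smooth_square: "smooth_on Rplus (\<lambda>x. (complex_of_real x)\<^sup>2)"
  by (rule smooth_on_cong[OF smooth_on_powr[of 2]]) (auto simp: powr_numeral)

lemma distr_deriv2_distr_of:
  "distr_deriv (distr_deriv (distr_of f)) \<phi> = (LINT x|LR. f x * vderiv (vderiv \<phi>) x)"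
  by (simp add: distr_deriv_def distr_of_def)

lemma integral_ae_eq_cong:
  assumes "ae_eq f g" "f \<in> borel_measurable LR" "g \<in> borel_measurable LR" "\<phi> \<in> borel_measurable LR"
  shows "(LINT x|LR. f x * \<phi> x) = (LINT x|LR. g x * \<phi> x)"
  using assms unfolding ae_eq_def
  by (intro integral_cong_AE borel_measurable_times) (auto elim: eventually_mono)

lemma prim2_measurable: "G \<in> L2 \<Longrightarrow> prim2 G \<in> borel_measurable LR"
  unfolding prim2_def by (intro prim_measurable L2_measurable)

context cutoff_function
begin

text \<open>For a test function in place of G this is two integrations by parts. Both sides are
  continuous in G for the \<open>L2\<close> norm, so density extends the identity; G itself has too
  little regularity for a direct computation.\<close>

lemma prim2_weak:
  assumes "G \<in> L2" "\<phi> \<in> Cc_smooth Rplus"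
  shows "(LINT x|LR. prim2 G x * vderiv (vderiv \<phi>) x) = (LINT x|LR. G x * \<phi> x)"
proof -
  note d1 = Cc_smooth_vderiv(1)[OF assms(2)]
  note d2 = Cc_smooth_vderiv(1)[OF d1]
  \<comment> \<open>Moving the factor x^2 onto the test function leaves prim2 / x^2, to which the
    Hardy bound applies.\<close>
  let ?\<theta> = "\<lambda>x. (complex_of_real x)\<^sup>2 * vderiv (vderiv \<phi>) x"
  have \<theta>: "?\<theta> \<in> Cc_smooth Rplus"
    by (intro Cc_smooth_mult d2 smooth_square)
  define C where "C = 4/3 * L2_norm ?\<theta> + L2_norm \<phi>"
  have C: "C \<ge> 0"
    by (simp add: C_def)
  have eq: "(LINT x|LR. prim2 \<psi> x * vderiv (vderiv \<phi>) x) = (LINT x|LR. \<psi> x * \<phi> x)" if \<psi>: "\<psi> \<in> Cc_smooth Rplus" for \<psi>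
  proof -
    have "(LINT x|LR. prim2 \<psi> x * vderiv (vderiv \<phi>) x) = - (LINT x|LR. prim \<psi> x * vderiv \<phi> x)"
      by (rule integration_by_parts_Cc[OF prim2_has_vector_derivative[OF Cc_smooth_L2] prim_continuous_Rplus[OF Cc_smooth_L2] d1])
        (use \<psi> in auto)
    also have "(LINT x|LR. prim \<psi> x * vderiv \<phi> x) = - (LINT x|LR. \<psi> x * \<phi> x)"
      by (rule integration_by_parts_Cc[OF Cc_prim_has_vector_derivative Cc_smooth_continuous assms(2)]) (use \<psi> in auto)
    finally show ?thesis by simp
  qed
  have le: "cmod ((LINT x|LR. prim2 G x * vderiv (vderiv \<phi>) x) - (LINT x|LR. G x * \<phi> x)) \<le> C * e" if e: "e > 0" for e
  proof -
    obtain \<psi> where \<psi>: "\<psi> \<in> Cc_smooth Rplus" "L2_norm (\<lambda>x. G x - \<psi> x) < e"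
      using Cc_smooth_dense[OF assms(1) e] by blast
    note \<psi>2 = Cc_smooth_L2[OF \<psi>(1)]
    note D = L2_diff[OF assms(1) \<psi>2]
    let ?W = "hardy 1 (hardy 0 (\<lambda>x. G x - \<psi> x))"
    let ?P = "\<lambda>u. LINT x|LR. prim2 u x * vderiv (vderiv \<phi>) x" and ?Q = "\<lambda>u. LINT x|LR. u x * \<phi> x"
    have "?P G - ?P \<psi> = (LINT x|LR. prim2 G x * vderiv (vderiv \<phi>) x - prim2 \<psi> x * vderiv (vderiv \<phi>) x)"
      by (intro Bochner_Integration.integral_diff[symmetric] prim2_mult_integrable assms \<psi>2 d2)
    also have "\<dots> = (LINT x|LR. ?W x * ?\<theta> x)"
    proof (rule Bochner_Integration.integral_cong)
      fix x assume "x \<in> space LR"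
      then have "prim2 G x - prim2 \<psi> x = (complex_of_real x)\<^sup>2 * ?W x"
        using prim2_diff[OF assms(1) \<psi>2, of x] prim2_eq_hardy[of x "\<lambda>x. G x - \<psi> x"] by simp
      then have "(prim2 G x - prim2 \<psi> x) * vderiv (vderiv \<phi>) x = ?W x * ?\<theta> x"
        by simp
      then show "prim2 G x * vderiv (vderiv \<phi>) x - prim2 \<psi> x * vderiv (vderiv \<phi>) x = ?W x * ?\<theta> x"
        by (simp add: algebra_simps)
    qed simp
    finally have P: "cmod (?P G - ?P \<psi>) \<le> L2_norm ?W * L2_norm ?\<theta>"
      using L2_Cauchy_Schwarz[OF hardy2(1)[OF D] Cc_smooth_L2[OF \<theta>]] by simp
    have "?Q G - ?Q \<psi> = (LINT x|LR. (G x - \<psi> x) * \<phi> x)"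
      using L2_mult_integrable[OF assms(1) Cc_smooth_L2[OF assms(2)]] L2_mult_integrable[OF \<psi>2 Cc_smooth_L2[OF assms(2)]]
      by (simp add: left_diff_distrib)
    then have Q: "cmod (?Q G - ?Q \<psi>) \<le> L2_norm (\<lambda>x. G x - \<psi> x) * L2_norm \<phi>"
      using L2_Cauchy_Schwarz[OF D Cc_smooth_L2[OF assms(2)]] by simp
    have PQ: "?P G - ?Q G = (?P G - ?P \<psi>) - (?Q G - ?Q \<psi>)"
      using eq[OF \<psi>(1)] by simp
    have "cmod (?P G - ?Q G) \<le> cmod (?P G - ?P \<psi>) + cmod (?Q G - ?Q \<psi>)"
      unfolding PQ by (rule norm_triangle_ineq4)
    also have "\<dots> \<le> L2_norm ?W * L2_norm ?\<theta> + L2_norm (\<lambda>x. G x - \<psi> x) * L2_norm \<phi>"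
      by (rule add_mono[OF P Q])
    also have "\<dots> \<le> (4/3 * e) * L2_norm ?\<theta> + e * L2_norm \<phi>"
      using hardy2(2)[OF D] \<psi>(2) by (intro add_mono mult_right_mono) auto
    also have "\<dots> = C * e"
      by (simp add: C_def algebra_simps)
    finally show ?thesis .
  qed
  have "cmod ((LINT x|LR. prim2 G x * vderiv (vderiv \<phi>) x) - (LINT x|LR. G x * \<phi> x)) \<le> 0 + e" if "e > 0" for e
  proof -
    \<comment> \<open>C may be 0, hence the division by C + 1.\<close>
    have "C * (e / (C + 1)) \<le> e"
      using C that by (simp add: divide_simps)
    then show ?thesis
      using order_trans[OF le[of "e / (C + 1)"]] that C by simp
  qed
  then have "cmod ((LINT x|LR. prim2 G x * vderiv (vderiv \<phi>) x) - (LINT x|LR. G x * \<phi> x)) \<le> 0"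
    by (rule field_le_epsilon)
  then show ?thesis
    by simp
qed

lemma H2_0_I:
  assumes "f \<in> L2" "G \<in> L2" "ae_eq f (prim2 G)"
  shows "f \<in> H2_0"
proof -
  have "distr_eq (distr_deriv (distr_deriv (distr_of f))) (distr_of G)"
    unfolding distr_eq_def distr_deriv2_distr_of
  proof
    fix \<phi> assume \<phi>: "\<phi> \<in> Cc_smooth Rplus"
    have "(LINT x|LR. f x * vderiv (vderiv \<phi>) x) = (LINT x|LR. prim2 G x * vderiv (vderiv \<phi>) x)"
      by (intro integral_ae_eq_cong assms L2_measurable prim2_measurable Cc_smooth_measurable Cc_smooth_vderiv \<phi>)
    then show "(LINT x|LR. f x * vderiv (vderiv \<phi>) x) = distr_of G \<phi>"
      using prim2_weak[OF assms(2) \<phi>] by (simp add: distr_of_def)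
  qed
  then have "f \<in> H2"
    using assms unfolding H2_def by auto
  moreover have "prim2 G 0 = 0" "prim G 0 = 0"
    by (simp_all add: prim2_def prim_nonpos)
  ultimately show ?thesis
    unfolding H2_0_def using assms(3) prim2_has_vector_derivative_0[OF assms(2)] prim_continuous[OF assms(2)]
    by (intro CollectI conjI exI[of _ "prim2 G"] exI[of _ "prim G"]) auto
qed

text \<open>A zero-mean test function is a derivative of a test function; a nonzero mean is absorbed
  by the cutoff concentrated near \<open>0\<close>, where \<open>v\<close> is small.\<close>

lemma continuous_zero_of_weak_deriv_zero:
  assumes "continuous_on {0..} v" "v 0 = 0"
    "\<And>\<phi>. \<phi> \<in> Cc_smooth Rplus \<Longrightarrow> (LINT x|LR. v x * vderiv \<phi> x) = 0" "0 < y"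
  shows "v y = 0"
proof (rule continuous_fundamental_lemma[OF _ _ assms(4)])
  show cont: "continuous_on Rplus v"
    by (rule continuous_on_subset[OF assms(1)]) auto
  fix \<psi> assume \<psi>: "\<psi> \<in> Cc_smooth Rplus"
  obtain a b where ab: "0 < a" "a < b" "\<And>x. 0 < x \<Longrightarrow> x < a \<or> b < x \<Longrightarrow> \<psi> x = 0"
    using Cc_smooth_supportE[OF \<psi>] by blast
  define A where "A = prim \<psi> b"
  have p0: "prim \<psi> x = 0" if "x < a" for x
  proof -
    have "prim \<psi> x = prim (\<lambda>_. 0) x"
      unfolding prim_def using ab that by (intro Bochner_Integration.integral_cong) (auto split: split_indicator)
    then show ?thesis
      by (simp add: prim_def)
  qed
  have pA: "prim \<psi> x = A" if "b < x" for x
    unfolding prim_def A_def using ab that by (intro Bochner_Integration.integral_cong) (auto split: split_indicator)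
  define M where "M = cmod A * (K * R / \<epsilon>)"
  have M: "0 \<le> M"
    using K_nonneg eps_R by (simp add: M_def)
  have le: "cmod (LINT x|LR. v x * \<psi> x) \<le> M * \<delta>" if "\<delta> > 0" for \<delta>
  proof -
    have "(v \<longlongrightarrow> v 0) (at 0 within {0..})"
      using assms(1) by (simp add: continuous_on_def)
    then have "\<forall>\<^sub>F x in at 0 within {0..}. dist (v x) 0 < \<delta>"
      using assms(2) tendstoD[OF _ that] by fastforce
    then obtain d where d: "d > 0" "\<And>x. 0 < x \<Longrightarrow> x < d \<Longrightarrow> cmod (v x) < \<delta>"
      unfolding eventually_at by (auto simp: dist_norm)
    \<comment> \<open>Places the support of the derivative of \<xi>(c x), contained in
      [\<epsilon> / c, R / c], below d, where v is smaller than \<open>\<delta>\<close>.\<close>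
    define c where "c = 2 * R / d"
    have c: "0 < c" "R / c < d"
      using d eps_R by (auto simp: c_def field_simps)
    \<comment> \<open>Near 0 both summands vanish; far out the second one is -A and cancels the
      constant value A of \<open>prim \<psi>\<close>.\<close>
    define \<phi> where "\<phi> x = prim \<psi> x + A * (\<xi> (c * x) - 1)" for x
    have \<phi>': "(\<phi> has_vector_derivative \<psi> x + A * (complex_of_real c * \<xi>1 (c * x))) (at x)" if "0 < x" for x
      unfolding \<phi>_def using xi_scaled_deriv(1)[OF c(1) that] Cc_prim_has_vector_derivative[OF \<psi> that]
      by (auto intro!: derivative_eq_intros)
    have "\<phi> \<in> Cc_smooth Rplus"
    proof (rule Cc_smoothI)
      have "smooth_on Rplus (prim \<psi>)"
        by (rule smooth_on_antideriv[OF Cc_smooth_smooth[OF \<psi>]])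
          (use Cc_prim_has_vector_derivative[OF \<psi>] in \<open>auto intro: has_vector_derivative_at_within\<close>)
      then show "smooth_on Rplus \<phi>"
        unfolding \<phi>_def by (intro smooth_on_add smooth_on_mult smooth_on_diff smooth_on_const xi_scaled_smooth c)
      show "0 < min a (\<epsilon> / c)"
        using ab c eps_R by simp
      show "min a (\<epsilon> / c) < max b (R / c)"
        using ab by simp
      show "\<phi> x = 0" if "0 < x" "x < min a (\<epsilon> / c) \<or> max b (R / c) < x" for x
        using that(2)
      proof
        assume "x < min a (\<epsilon> / c)"
        then have "x < a" "c * x < \<epsilon>"
          using c by (auto simp: field_simps)
        then show ?thesis
          using p0 xi_one[of "c * x"] that(1) c(1) by (simp add: \<phi>_def)
      next
        assume "max b (R / c) < x"
        then have "b < x" "R < c * x"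
          using c by (auto simp: field_simps)
        then show ?thesis
          using pA xi_zero[of "c * x"] by (simp add: \<phi>_def)
      qed
    qed
    then have "(LINT x|LR. v x * vderiv \<phi> x) = 0"
      by (rule assms(3))
    moreover have "(LINT x|LR. v x * vderiv \<phi> x) = (LINT x|LR. v x * \<psi> x + A * (v x * (complex_of_real c * \<xi>1 (c * x))))"
      using vector_derivative_at[OF \<phi>'] by (intro Bochner_Integration.integral_cong) (auto simp: algebra_simps)
    moreover have Cc1: "(\<lambda>x. complex_of_real c * \<xi>1 (c * x)) \<in> Cc_smooth Rplus"
    proof (intro Cc_smooth_scale Cc_smoothI)
      show "0 < \<epsilon> / c" "\<epsilon> / c < R / c"
        using c eps_R by (auto simp: divide_strict_right_mono)
      show "\<xi>1 (c * x) = 0" if "0 < x" "x < \<epsilon> / c \<or> R / c < x" for x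
        using xi_deriv_zero[of "c * x"] that c by (auto simp: field_simps)
    qed (rule xi_scaled_smooth(2)[OF c(1)])
    ultimately have "(LINT x|LR. v x * \<psi> x) = - (A * (LINT x|LR. v x * (complex_of_real c * \<xi>1 (c * x))))"
      using cont_mult_Cc_L2(2)[OF cont \<psi>] cont_mult_Cc_L2(2)[OF cont Cc1]
      by (simp add: eq_neg_iff_add_eq_0 del: mult.assoc)
    then have 1: "cmod (LINT x|LR. v x * \<psi> x) = cmod A * cmod (LINT x|LR. v x * (complex_of_real c * \<xi>1 (c * x)))"
      by (simp add: norm_mult)
    \<comment> \<open>The integrand is at most \<open>\<delta>\<close> K c / \<epsilon> on an
      interval of length at most R / c, so c drops out. The factor \<open>x powr 0\<close> is there
      to reuse the integral of a power.\<close>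
    have "cmod (LINT x|LR. v x * (complex_of_real c * \<xi>1 (c * x))) \<le>
        (LINT x|LR. (\<delta> * (K * c / \<epsilon>)) * (indicator {..R / c} x * x powr 0))"
    proof (rule Bochner_Integration.integral_norm_bound_integral)
      show "integrable LR (\<lambda>x. v x * (complex_of_real c * \<xi>1 (c * x)))"
        by (rule cont_mult_Cc_L2(2)[OF cont Cc1])
      show "integrable LR (\<lambda>x. (\<delta> * (K * c / \<epsilon>)) * (indicator {..R / c} x * x powr 0))"
        using c eps_R by (intro integrable_mult_right integral_powr_0) auto
      fix x assume "x \<in> space LR"
      then have x: "0 < x" by simp
      show "cmod (v x * (complex_of_real c * \<xi>1 (c * x))) \<le> (\<delta> * (K * c / \<epsilon>)) * (indicator {..R / c} x * x powr 0)"
      proof (cases "\<epsilon> / c \<le> x \<and> x \<le> R / c")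
        case True
        have "c * x * cmod (\<xi>1 (c * x)) \<le> K"
          using xi_bound(2)[of "c * x"] x c by simp
        moreover have "\<epsilon> * cmod (\<xi>1 (c * x)) \<le> c * x * cmod (\<xi>1 (c * x))"
          using True c by (intro mult_right_mono) (auto simp: field_simps)
        ultimately have "cmod (\<xi>1 (c * x)) \<le> K / \<epsilon>"
          using eps_R by (simp add: field_simps)
        then have "cmod (v x) * (c * cmod (\<xi>1 (c * x))) \<le> \<delta> * (c * (K / \<epsilon>))"
          using d(2)[of x] True c x that by (intro mult_mono) auto
        then show ?thesis
          using True x c by (simp add: norm_mult mult_ac)
      next
        case False
        then have "\<xi>1 (c * x) = 0"
          using xi_deriv_zero[of "c * x"] x c by (auto simp: field_simps)
        then show ?thesis
          using that K_nonneg c eps_R by (simp split: split_indicator)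
      qed
    qed
    also have "\<dots> = (K * R / \<epsilon>) * \<delta>"
      using c eps_R by (subst integral_mult_right_zero, subst integral_powr_0) auto
    finally have "cmod A * cmod (LINT x|LR. v x * (complex_of_real c * \<xi>1 (c * x))) \<le> cmod A * ((K * R / \<epsilon>) * \<delta>)"
      by (rule mult_left_mono) simp
    then show ?thesis
      unfolding 1 by (simp add: M_def mult.assoc)
  qed
  have "cmod (LINT x|LR. v x * \<psi> x) \<le> 0 + e" if "e > 0" for e
  proof -
    have "M * (e / (M + 1)) \<le> e"
      using M that by (simp add: divide_simps)
    then show ?thesis
      using order_trans[OF le[of "e / (M + 1)"]] that M by simp
  qed
  then have "cmod (LINT x|LR. v x * \<psi> x) \<le> 0"
    by (rule field_le_epsilon)
  then show "(LINT x|LR. v x * \<psi> x) = 0"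
    by simp
qed

text \<open>The difference w of the regular representative and \<open>prim2 G\<close> has weak
  second derivative 0. The boundary value of the derivative then gives w' = 0, and that of the
  function gives w = 0.\<close>

lemma H2_0_E:
  assumes "f \<in> H2_0"
  obtains G where "f \<in> L2" "G \<in> L2" "ae_eq f (prim2 G)"
proof -
  obtain G h h' where fG: "f \<in> L2" "G \<in> L2" "distr_eq (distr_deriv (distr_deriv (distr_of f))) (distr_of G)"
    and h: "ae_eq f h" "\<And>x. x \<in> {0..} \<Longrightarrow> (h has_vector_derivative h' x) (at x within {0..})"
      "continuous_on {0..} h'" "h 0 = 0" "h' 0 = 0"
    using assms unfolding H2_0_def H2_def by blast
  define w where "w x = h x - prim2 G x" for x
  define v where "v x = h' x - prim G x" for x
  have w': "(w has_vector_derivative v x) (at x within {0..})" if "x \<in> {0..}" for x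
    unfolding w_def v_def by (intro has_vector_derivative_diff h prim2_has_vector_derivative_0 fG that)
  have w'': "(w has_vector_derivative v x) (at x)" if "0 < x" for x
  proof -
    have "(w has_vector_derivative v x) (at x within Rplus)"
      by (rule has_vector_derivative_within_subset[OF w'[of x]]) (use that in auto)
    then show ?thesis
      using that by (simp add: has_vector_derivative_at_Rplus)
  qed
  have cv: "continuous_on {0..} v"
    unfolding v_def by (intro continuous_intros h prim_continuous fG)
  have "0 = v 0"
    by (simp add: v_def h prim_nonpos)
  have vz: "v x = 0" if "0 < x" for x
  proof (rule continuous_zero_of_weak_deriv_zero[OF cv \<open>0 = v 0\<close>[symmetric] _ that])
    fix \<phi> assume \<phi>: "\<phi> \<in> Cc_smooth Rplus"
    note d1 = Cc_smooth_vderiv(1)[OF \<phi>]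
    note d2 = Cc_smooth_vderiv(1)[OF d1]
    have "continuous_on {0..} h"
      using h(2) by (meson continuous_on_eq_continuous_within has_vector_derivative_continuous)
    then have ch: "continuous_on Rplus h"
      by (rule continuous_on_subset) auto
    have "(LINT x|LR. h x * vderiv (vderiv \<phi>) x) = (LINT x|LR. f x * vderiv (vderiv \<phi>) x)"
      by (intro integral_ae_eq_cong[symmetric] h(1) L2_measurable fG continuous_measurable_LR ch Cc_smooth_measurable d2)
    also have "\<dots> = (LINT x|LR. G x * \<phi> x)"
      using fG(3) \<phi> unfolding distr_eq_def distr_deriv2_distr_of by (simp add: distr_of_def)
    also have "\<dots> = (LINT x|LR. prim2 G x * vderiv (vderiv \<phi>) x)"
      using prim2_weak[OF fG(2) \<phi>] by simp
    finally have "(LINT x|LR. w x * vderiv (vderiv \<phi>) x) = 0"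
      using cont_mult_Cc_L2(2)[OF ch d2] prim2_mult_integrable[OF fG(2) d2] by (simp add: w_def left_diff_distrib)
    moreover have "(LINT x|LR. w x * vderiv (vderiv \<phi>) x) = - (LINT x|LR. v x * vderiv \<phi> x)"
      by (rule integration_by_parts_Cc[OF w'' _ d1]) (auto intro: continuous_on_subset[OF cv])
    ultimately show "(LINT x|LR. v x * vderiv \<phi> x) = 0"
      by simp
  qed
  have "(w has_vector_derivative 0) (at x within {0..})" if "x \<in> {0..}" for x
  proof -
    have "v x = 0"
      using vz[of x] \<open>0 = v 0\<close> that by (cases "x = 0") auto
    then show ?thesis
      using w'[OF that] by simp
  qed
  then obtain c where c: "\<And>x. x \<in> {0..} \<Longrightarrow> w x = c"
    using has_vector_derivative_zero_constant[of "{0..}" w] by auto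
  have "w 0 = 0"
    by (simp add: w_def h prim2_def prim_nonpos)
  then have "w x = 0" if "0 < x" for x
    using c[of 0] c[of x] that by auto
  then have "ae_eq h (prim2 G)"
    by (intro ae_eqI) (simp add: w_def)
  then show thesis
    using that fG h(1) ae_eq_trans by blast
qed

end

section \<open>The minimal operator\<close>

lemma L2_norm_mult_le:
  assumes "u \<in> L2" "p \<in> borel_measurable LR" "0 \<le> C" "\<And>x. 0 < x \<Longrightarrow> cmod (p x) \<le> C"
  shows "(\<lambda>x. p x * u x) \<in> L2" and "L2_norm (\<lambda>x. p x * u x) \<le> C * L2_norm u"
proof -
  have m: "(\<lambda>x. p x * u x) \<in> borel_measurable LR"
    by (rule borel_measurable_times[OF assms(2) L2_measurable[OF assms(1)]])
  have AE: "AE x in LR. cmod (p x * u x) \<le> C * cmod (u x)"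
    using assms(4) by (intro AE_LR_everywhere) (auto simp: norm_mult intro: mult_right_mono)
  show "(\<lambda>x. p x * u x) \<in> L2"
    by (rule L2_bound[OF m assms(1) AE])
  show "L2_norm (\<lambda>x. p x * u x) \<le> C * L2_norm u"
    by (rule L2_norm_mono[OF m assms(1,3) AE])
qed

lemma L2_norm_tail_tendsto_0:
  assumes "u \<in> L2" "\<And>n. p n \<in> borel_measurable LR" "0 \<le> C" "\<And>n x. 0 < x \<Longrightarrow> cmod (p n x) \<le> C"
    "\<And>x. 0 < x \<Longrightarrow> \<forall>\<^sub>F n in sequentially. p n x = 0"
  shows "(\<lambda>n. L2_norm (\<lambda>x. p n x * u x)) \<longlonglongrightarrow> 0"
proof (rule L2_norm_tendsto_0)
  show "(\<lambda>x. p n x * u x) \<in> borel_measurable LR" for n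
    by (intro borel_measurable_times assms L2_measurable)
  show "(\<lambda>x. complex_of_real C * u x) \<in> L2"
    by (intro L2_scale assms)
  show "AE x in LR. cmod (p n x * u x) \<le> cmod (complex_of_real C * u x)" for n
    using assms(3,4) by (intro AE_LR_everywhere) (auto simp: norm_mult intro: mult_right_mono)
  show "AE x in LR. (\<lambda>n. p n x * u x) \<longlonglongrightarrow> 0"
  proof (rule AE_LR_everywhere)
    fix x :: real assume "0 < x"
    from assms(5)[OF this] have "\<forall>\<^sub>F n in sequentially. p n x * u x = 0"
      by eventually_elim simp
    then show "(\<lambda>n. p n x * u x) \<longlonglongrightarrow> 0"
      by (rule tendsto_eventually)
  qed
qed

lemma Cc_prim_vderiv:
  assumes "\<phi> \<in> Cc_smooth Rplus" "0 < x"
  shows "prim (vderiv \<phi>) x = \<phi> x"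
proof -
  obtain a b where ab: "0 < a" "a < b" "\<And>x. 0 < x \<Longrightarrow> x < a \<or> b < x \<Longrightarrow> \<phi> x = 0"
    using Cc_smooth_supportE[OF assms(1)] by blast
  show ?thesis
  proof (rule prim_of_deriv[OF ab(1)])
    show "(\<phi> has_vector_derivative vderiv \<phi> x) (at x)" if "0 < x" for x
      by (rule Cc_smooth_vderiv(2)[OF assms(1) that])
    show "continuous_on Rplus (vderiv \<phi>)"
      by (intro Cc_smooth_continuous Cc_smooth_vderiv assms)
  qed (use ab assms in auto)
qed

lemma Cc_prim2_vderiv2:
  assumes "\<phi> \<in> Cc_smooth Rplus" "0 < x"
  shows "prim2 (vderiv (vderiv \<phi>)) x = \<phi> x"
proof -
  have "prim2 (vderiv (vderiv \<phi>)) x = prim (vderiv \<phi>) x"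
    unfolding prim2_def by (rule prim_cong) (rule Cc_prim_vderiv[OF Cc_smooth_vderiv(1)[OF assms(1)]])
  then show ?thesis
    using Cc_prim_vderiv[OF assms] by simp
qed

lemma Cc_div_square_eq_hardy2:
  assumes "\<phi> \<in> Cc_smooth Rplus" "0 < x"
  shows "\<phi> x / (complex_of_real x)\<^sup>2 = hardy 1 (hardy 0 (vderiv (vderiv \<phi>))) x"
  using Cc_prim2_vderiv2[OF assms] prim2_eq_hardy[OF assms(2), of "vderiv (vderiv \<phi>)"] assms(2)
  by (simp add: field_simps)

section \<open>The differential expression on smooth functions and its inversion\<close>

definition potential :: "complex \<Rightarrow> real \<Rightarrow> complex" where
  "potential \<alpha> x = (\<alpha> - 1/4) * (1 / (complex_of_real x)\<^sup>2)"

text \<open>The classical action on smooth functions, as opposed to \<open>L_expr\<close>, which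
  acts on functionals.\<close>

definition L_class :: "complex \<Rightarrow> (real \<Rightarrow> complex) \<Rightarrow> real \<Rightarrow> complex" where
  "L_class \<alpha> \<phi> x = - vderiv (vderiv \<phi>) x + potential \<alpha> x * \<phi> x"

lemma smooth_inverse_square: "smooth_on Rplus (\<lambda>x. 1 / (complex_of_real x)\<^sup>2)"
proof (rule smooth_on_cong[OF smooth_on_powr[of "-2"]])
  show "1 / (complex_of_real x)\<^sup>2 = complex_of_real x powr (-2)" if "x \<in> Rplus" for x
    using powr_minus[of "complex_of_real x" 2] by (simp add: powr_numeral inverse_eq_divide)
qed

lemma smooth_potential: "smooth_on Rplus (potential \<alpha>)"
  unfolding potential_def[abs_def] by (intro smooth_on_mult smooth_on_const smooth_inverse_square)

lemma L_class_Cc: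
  assumes "\<phi> \<in> Cc_smooth Rplus"
  shows "L_class \<alpha> \<phi> \<in> Cc_smooth Rplus"
proof -
  have "(\<lambda>x. potential \<alpha> x * \<phi> x - vderiv (vderiv \<phi>) x) \<in> Cc_smooth Rplus"
    by (intro Cc_smooth_diff Cc_smooth_mult smooth_potential Cc_smooth_vderiv assms)
  then show ?thesis
    by (simp add: L_class_def[abs_def])
qed

lemma L_expr_distr_of:
  "L_expr \<alpha> (distr_of f) \<phi> = - (LINT x|LR. f x * vderiv (vderiv \<phi>) x) + (LINT x|LR. f x * (potential \<alpha> x * \<phi> x))"
  by (simp add: L_expr_def distr_deriv_def distr_mult_def distr_of_def potential_def)

lemma L_max_smooth:
  assumes "f \<in> L2" "\<And>x. 0 < x \<Longrightarrow> (f has_vector_derivative f1 x) (at x)"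
    "\<And>x. 0 < x \<Longrightarrow> (f1 has_vector_derivative f2 x) (at x)" "continuous_on Rplus f2"
    "(\<lambda>x. - f2 x + potential \<alpha> x * f x) \<in> L2"
  shows "(f, \<lambda>x. - f2 x + potential \<alpha> x * f x) \<in> L_max \<alpha>"
proof -
  have cont: "continuous_on Rplus f" "continuous_on Rplus f1"
    using assms(2,3) by (auto intro!: continuous_at_imp_continuous_on has_vector_derivative_continuous)
  have "L_expr \<alpha> (distr_of f) \<phi> = distr_of (\<lambda>x. - f2 x + potential \<alpha> x * f x) \<phi>" if \<phi>: "\<phi> \<in> Cc_smooth Rplus" for \<phi>
  proof -
    note d1 = Cc_smooth_vderiv(1)[OF \<phi>]
    have "(LINT x|LR. f x * vderiv (vderiv \<phi>) x) = - (LINT x|LR. f1 x * vderiv \<phi> x)"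
      by (rule integration_by_parts_Cc[OF assms(2) cont(2) d1])
    moreover have "(LINT x|LR. f1 x * vderiv \<phi> x) = - (LINT x|LR. f2 x * \<phi> x)"
      by (rule integration_by_parts_Cc[OF assms(3,4) \<phi>])
    moreover have "(LINT x|LR. (- f2 x + potential \<alpha> x * f x) * \<phi> x) =
        (LINT x|LR. f x * (potential \<alpha> x * \<phi> x) - f2 x * \<phi> x)"
      by (rule Bochner_Integration.integral_cong) (auto simp: algebra_simps)
    moreover have "\<dots> = (LINT x|LR. f x * (potential \<alpha> x * \<phi> x)) - (LINT x|LR. f2 x * \<phi> x)"
      by (rule Bochner_Integration.integral_diff[OF cont_mult_Cc_L2(2)[OF cont(1) Cc_smooth_mult[OF \<phi> smooth_potential]]
            cont_mult_Cc_L2(2)[OF assms(4) \<phi>]])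
    ultimately have "distr_of (\<lambda>x. - f2 x + potential \<alpha> x * f x) \<phi> =
        - (LINT x|LR. f x * vderiv (vderiv \<phi>) x) + (LINT x|LR. f x * (potential \<alpha> x * \<phi> x))"
      by (simp add: distr_of_def)
    then show ?thesis
      by (simp only: L_expr_distr_of)
  qed
  then show ?thesis
    using assms(1,5) unfolding L_max_def distr_eq_def by blast
qed

lemma L_max_Cc:
  assumes "\<phi> \<in> Cc_smooth Rplus"
  shows "(\<phi>, L_class \<alpha> \<phi>) \<in> L_max \<alpha>"
proof -
  note d1 = Cc_smooth_vderiv[OF assms]
  note d2 = Cc_smooth_vderiv[OF d1(1)]
  have "(\<phi>, \<lambda>x. - vderiv (vderiv \<phi>) x + potential \<alpha> x * \<phi> x) \<in> L_max \<alpha>"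
  proof (rule L_max_smooth[OF Cc_smooth_L2[OF assms] d1(2) d2(2) Cc_smooth_continuous[OF d2(1)]])
    show "(\<lambda>x. - vderiv (vderiv \<phi>) x + potential \<alpha> x * \<phi> x) \<in> L2"
      using Cc_smooth_L2[OF L_class_Cc[OF assms, of \<alpha>]] by (simp add: L_class_def[abs_def])
  qed
  then show ?thesis
    by (simp add: L_class_def[abs_def])
qed

text \<open>On images of test functions this is the inverse of L divided by - x^2, the
  dilation-invariant quantity that can be bounded on \<open>L2\<close>.\<close>

definition L_inverse :: "complex \<Rightarrow> (real \<Rightarrow> complex) \<Rightarrow> real \<Rightarrow> complex" where
  "L_inverse m g = hardy (1/2 - m) (hardy (1/2 + m) g)"

text \<open>With \<open>\<beta> = 1/2 + m\<close> one has the factorisation \<open>L = - (\<partial> + \<beta>/x) (\<partial> - \<beta>/x)\<close> for \<open>\<alpha> = m\<^sup>2\<close>,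
  whose factors are inverted on test functions by weighted primitives. This avoids a separate
  treatment of \<open>m = 0\<close>.\<close>

lemma Cc_div_square_eq_L_inverse:
  assumes "\<phi> \<in> Cc_smooth Rplus" "0 < x"
  shows "\<phi> x / (complex_of_real x)\<^sup>2 = - L_inverse m (L_class (m\<^sup>2) \<phi>) x"
proof -
  define \<beta> where "\<beta> = 1/2 + m"
  note d1 = Cc_smooth_vderiv[OF assms(1)]
  note d2 = Cc_smooth_vderiv[OF d1(1)]
  let ?g = "L_class (m\<^sup>2) \<phi>"
  obtain a b where ab: "0 < a" "a < b" "\<And>x. 0 < x \<Longrightarrow> x < a \<or> b < x \<Longrightarrow> \<phi> x = 0"
    using Cc_smooth_supportE[OF assms(1)] by blast
  have \<phi>'0: "vderiv \<phi> x = 0" if "0 < x" "x < a" for x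
    using has_vector_derivative_locally_const[OF d1(2)[OF that(1)], of "{0<..<a}" 0] ab that by auto
  have pw: "complex_of_real x powr (\<gamma> - 1) = complex_of_real x powr \<gamma> / x"
      "complex_of_real x powr (\<gamma> - 1 - 1) = complex_of_real x powr \<gamma> / (complex_of_real x)\<^sup>2" if "0 < x" for x \<gamma>
    using that by (auto simp: powr_diff power2_eq_square)
  have pot: "potential (m\<^sup>2) x = \<beta> * (\<beta> - 1) / (complex_of_real x)\<^sup>2" for x
  proof -
    have "m\<^sup>2 - 1/4 = \<beta> * (\<beta> - 1)"
      by (simp add: \<beta>_def power2_eq_square algebra_simps)
    then show ?thesis
      by (simp add: potential_def)
  qed
  have first: "hardy \<beta> ?g x = - (vderiv \<phi> x - \<beta> * \<phi> x / x) / x" if "0 < x" for x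
  proof (rule hardy_eq[OF _ that])
    \<comment> \<open>x^\<beta> is the integrating factor of \<partial> + \<beta>/x, here applied to
      the function (\<partial> - \<beta>/x) \<phi>, with the sign of L included.\<close>
    let ?F = "\<lambda>x. - (complex_of_real x powr \<beta> * vderiv \<phi> x - (\<beta> * complex_of_real x powr (\<beta> - 1)) * \<phi> x)"
    have "prim (\<lambda>t. complex_of_real t powr \<beta> * ?g t) x = ?F x"
    proof (rule prim_of_deriv[OF ab(1)])
      show "(?F has_vector_derivative complex_of_real t powr \<beta> * ?g t) (at t)" if t: "0 < t" for t
      proof -
        have "(?F has_vector_derivative - ((complex_of_real t powr \<beta> * vderiv (vderiv \<phi>) t + (\<beta> * complex_of_real t powr (\<beta> - 1)) * vderiv \<phi> t) -
           ((\<beta> * complex_of_real t powr (\<beta> - 1)) * vderiv \<phi> t + (\<beta> * ((\<beta> - 1) * complex_of_real t powr (\<beta> - 1 - 1))) * \<phi> t))) (at t)"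
          by (intro has_vector_derivative_minus has_vector_derivative_diff has_vector_derivative_mult
              has_vector_derivative_mult_right has_vector_derivative_powr_Rplus d1(2) d2(2) t)
        moreover have "- ((complex_of_real t powr \<beta> * vderiv (vderiv \<phi>) t + (\<beta> * complex_of_real t powr (\<beta> - 1)) * vderiv \<phi> t) -
           ((\<beta> * complex_of_real t powr (\<beta> - 1)) * vderiv \<phi> t + (\<beta> * ((\<beta> - 1) * complex_of_real t powr (\<beta> - 1 - 1))) * \<phi> t)) =
           complex_of_real t powr \<beta> * ?g t"
          unfolding L_class_def pot pw[OF t] by (simp add: algebra_simps power2_eq_square)
        ultimately show ?thesis by simp
      qed
      show "continuous_on Rplus (\<lambda>t. complex_of_real t powr \<beta> * ?g t)"
        by (intro continuous_on_mult smooth_on_continuous_on smooth_on_powr Cc_smooth_smooth L_class_Cc assms)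
      show "?F t = 0" if "0 < t" "t < a" for t
        using ab \<phi>'0 that by simp
    qed (fact that)
    also have "\<dots> = complex_of_real x powr (1 + \<beta>) * (- (vderiv \<phi> x - \<beta> * \<phi> x / x) / x)"
      using that unfolding pw[OF that] by (simp add: powr_add field_simps)
    finally show "prim (\<lambda>t. complex_of_real t powr \<beta> * ?g t) x =
        complex_of_real x powr (1 + \<beta>) * (- (vderiv \<phi> x - \<beta> * \<phi> x / x) / x)" .
  qed
  \<comment> \<open>The integrating factor of \<partial> - \<beta>/x is x^(-\<beta>); since
    \<open>hardy\<close> already contains a division by x, the weight of the second operator is 1 -
    \<beta>.\<close>
  define \<gamma> where "\<gamma> = 1/2 - m"
  have \<gamma>: "\<gamma> = 1 - \<beta>"
    by (simp add: \<gamma>_def \<beta>_def)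
  have "hardy \<gamma> (hardy \<beta> ?g) x = - (\<phi> x / (complex_of_real x)\<^sup>2)"
  proof (rule hardy_eq[OF _ assms(2)])
    let ?F = "\<lambda>x. - (complex_of_real x powr (- \<beta>) * \<phi> x)"
    let ?f = "\<lambda>t. - (complex_of_real t powr (- \<beta>) * vderiv \<phi> t + (- \<beta> * complex_of_real t powr (- \<beta> - 1)) * \<phi> t)"
    have "prim (\<lambda>t. complex_of_real t powr \<gamma> * hardy \<beta> ?g t) x = prim ?f x"
    proof (rule prim_cong)
      fix t :: real assume t: "0 < t"
      have "complex_of_real t powr \<gamma> = complex_of_real t powr (- \<beta>) * t"
        using t by (simp add: \<gamma> powr_diff powr_minus field_simps)
      then show "complex_of_real t powr \<gamma> * hardy \<beta> ?g t = ?f t"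
        unfolding first[OF t] pw[OF t] using t by (simp add: field_simps)
    qed
    also have "\<dots> = ?F x"
    proof (rule prim_of_deriv[OF ab(1)])
      show "(?F has_vector_derivative ?f t) (at t)" if t: "0 < t" for t
        by (intro has_vector_derivative_minus has_vector_derivative_mult has_vector_derivative_powr_Rplus d1(2) t)
      show "continuous_on Rplus ?f"
        by (intro continuous_intros smooth_on_continuous_on[OF smooth_on_powr] Cc_smooth_continuous d1(1) assms(1))
      show "?F t = 0" if "0 < t" "t < a" for t
        using ab that by simp
    qed (fact assms(2))
    also have "\<dots> = complex_of_real x powr (1 + \<gamma>) * (- (\<phi> x / (complex_of_real x)\<^sup>2))"
      using assms(2) by (simp add: \<gamma> powr_add powr_diff powr_minus power2_eq_square field_simps)
    finally show "prim (\<lambda>t. complex_of_real t powr \<gamma> * hardy \<beta> ?g t) x =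
        complex_of_real x powr (1 + \<gamma>) * (- (\<phi> x / (complex_of_real x)\<^sup>2))" .
  qed
  then show ?thesis
    by (simp add: L_inverse_def \<gamma>_def \<beta>_def)
qed

text \<open>|Re m| < 1 says exactly that both weights satisfy the Hardy condition. The constant is 1
  / (1 - (Re m)^2), which blows up at the boundary of the strip.\<close>

lemma L_inverse_bounded:
  assumes "\<bar>Re m\<bar> < 1"
  obtains C where "0 \<le> C" "\<And>g. g \<in> L2 \<Longrightarrow> L_inverse m g \<in> L2"
    "\<And>g. g \<in> L2 \<Longrightarrow> L2_norm (L_inverse m g) \<le> C * L2_norm g"
proof
  define k1 k2 where "k1 = Re (1/2 + m) + 1/2" and "k2 = Re (1/2 - m) + 1/2"
  have k: "k1 > 0" "k2 > 0" "Re (1/2 + m) > -1/2" "Re (1/2 - m) > -1/2"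
    using assms by (auto simp: k1_def k2_def)
  show "0 \<le> (1 / k1) * (1 / k2)"
    using k by simp
  fix g assume g: "g \<in> L2"
  note h1 = hardy_inequality[OF k(3) g]
  note h2 = hardy_inequality[OF k(4) h1(1)]
  show "L_inverse m g \<in> L2"
    unfolding L_inverse_def by (rule h2(1))
  have "L2_norm (L_inverse m g) \<le> L2_norm (hardy (1/2 + m) g) / k2"
    unfolding L_inverse_def k2_def by (rule h2(2))
  also have "\<dots> \<le> (L2_norm g / k1) / k2"
    using h1(2) k by (intro divide_right_mono) (auto simp: k1_def)
  finally show "L2_norm (L_inverse m g) \<le> (1 / k1) * (1 / k2) * L2_norm g"
    by simp
qed

lemma L_inverse_diff:
  assumes "\<bar>Re m\<bar> < 1" "g \<in> L2" "h \<in> L2"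
  shows "L_inverse m (\<lambda>x. g x - h x) x = L_inverse m g x - L_inverse m h x"
proof -
  have k: "Re (1/2 + m) > -1/2" "Re (1/2 - m) > -1/2"
    using assms by auto
  have "L_inverse m (\<lambda>x. g x - h x) x = hardy (1/2 - m) (\<lambda>x. hardy (1/2 + m) g x - hardy (1/2 + m) h x) x"
    unfolding L_inverse_def by (rule hardy_cong) (rule hardy_diff[OF k(1) assms(2,3)])
  then show ?thesis
    unfolding L_inverse_def using hardy_diff[OF k(2)] hardy_inequality(1)[OF k(1)] assms by simp
qed

text \<open>The weight \<open>1 / (1 + x\<^sup>2)\<close> makes the two modes of approximation comparable.\<close>

lemma ae_eq_square_mult:
  assumes "f \<in> L2" "q \<in> L2"
    "\<And>e. e > 0 \<Longrightarrow> \<exists>\<phi>\<in>Cc_smooth Rplus. L2_norm (\<lambda>x. f x - \<phi> x) \<le> e \<and>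
       L2_norm (\<lambda>x. q x - \<phi> x / (complex_of_real x)\<^sup>2) \<le> e"
  shows "ae_eq f (\<lambda>x. (complex_of_real x)\<^sup>2 * q x)"
proof -
  define w where "w x = complex_of_real (1 / (1 + x\<^sup>2))" for x :: real
  define w2 where "w2 x = complex_of_real (x\<^sup>2 / (1 + x\<^sup>2))" for x :: real
  have pos: "1 + x\<^sup>2 > 0" for x :: real
    by (intro add_pos_nonneg) auto
  have wm: "w \<in> borel_measurable LR" "w2 \<in> borel_measurable LR"
    unfolding w_def[abs_def] w2_def[abs_def] by (intro borel_measurable_LR_I, measurable)+
  have wb: "cmod (w x) \<le> 1" "cmod (w2 x) \<le> 1" for x
    using pos[of x] unfolding w_def w2_def norm_of_real by (auto simp: divide_simps)
  have "ae_eq (\<lambda>x. w x * f x) (\<lambda>x. w2 x * q x)"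
  proof (rule L2_ae_eqI)
    show D: "(\<lambda>x. w x * f x - w2 x * q x) \<in> L2"
      by (intro L2_diff L2_norm_mult_le[where C = 1] assms wm wb) auto
    fix e :: real assume "e > 0"
    then obtain \<phi> where \<phi>: "\<phi> \<in> Cc_smooth Rplus" "L2_norm (\<lambda>x. f x - \<phi> x) \<le> e / 2"
       "L2_norm (\<lambda>x. q x - \<phi> x / (complex_of_real x)\<^sup>2) \<le> e / 2"
      using assms(3)[of "e / 2"] by auto
    have "(\<lambda>x. 1 / (complex_of_real x)\<^sup>2 * \<phi> x) \<in> L2"
      by (intro Cc_smooth_L2 Cc_smooth_mult \<phi> smooth_inverse_square)
    then have L: "(\<lambda>x. f x - \<phi> x) \<in> L2" "(\<lambda>x. q x - \<phi> x / (complex_of_real x)\<^sup>2) \<in> L2"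
      using assms Cc_smooth_L2[OF \<phi>(1)] by (auto intro!: L2_diff)
    have A: "(\<lambda>x. w x * (f x - \<phi> x)) \<in> L2" "L2_norm (\<lambda>x. w x * (f x - \<phi> x)) \<le> 1 * L2_norm (\<lambda>x. f x - \<phi> x)"
      by (rule L2_norm_mult_le[OF L(1) wm(1) _ wb(1)], simp)+
    have B: "(\<lambda>x. w2 x * (q x - \<phi> x / (complex_of_real x)\<^sup>2)) \<in> L2"
      "L2_norm (\<lambda>x. w2 x * (q x - \<phi> x / (complex_of_real x)\<^sup>2)) \<le> 1 * L2_norm (\<lambda>x. q x - \<phi> x / (complex_of_real x)\<^sup>2)"
      by (rule L2_norm_mult_le[OF L(2) wm(2) _ wb(2)], simp)+
    have "L2_norm (\<lambda>x. w x * f x - w2 x * q x) =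
        L2_norm (\<lambda>x. w x * (f x - \<phi> x) - w2 x * (q x - \<phi> x / (complex_of_real x)\<^sup>2))"
    proof (rule L2_norm_cong)
      \<comment> \<open>As w2 = w x^2, the two occurrences of the test function cancel.\<close>
      have "w2 x * (\<phi> x / (complex_of_real x)\<^sup>2) = w x * \<phi> x" if "0 < x" for x
        using that by (simp add: w_def w2_def)
      then show "ae_eq (\<lambda>x. w x * f x - w2 x * q x) (\<lambda>x. w x * (f x - \<phi> x) - w2 x * (q x - \<phi> x / (complex_of_real x)\<^sup>2))"
        by (intro ae_eqI) (simp add: right_diff_distrib)
    qed (rule L2_measurable[OF D], rule L2_measurable[OF L2_diff[OF A(1) B(1)]])
    also have "\<dots> \<le> L2_norm (\<lambda>x. w x * (f x - \<phi> x)) + L2_norm (\<lambda>x. w2 x * (q x - \<phi> x / (complex_of_real x)\<^sup>2))"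
      by (rule L2_norm_triangle_diff[OF A(1) B(1)])
    also have "\<dots> \<le> e"
      using A(2) B(2) \<phi>(2,3) by linarith
    finally show "L2_norm (\<lambda>x. w x * f x - w2 x * q x) \<le> e" .
  qed
  then show ?thesis
    unfolding ae_eq_def
  proof eventually_elim
    case (elim x)
    have "w2 x = w x * (complex_of_real x)\<^sup>2" "w x \<noteq> 0"
      using pos[of x] by (auto simp: w_def w2_def simp del: of_real_add)
    then show ?case
      using elim by simp
  qed
qed

section \<open>The closure that defines the minimal operator\<close>

context cutoff_function
begin

text \<open>The graph of \<open>L_max\<close> is single-valued up to almost-everywhere equality: the
  functional fixes its \<open>L2\<close> density by the fundamental lemma.\<close>

lemma L_max_unique:
  assumes "(f, g) \<in> L_max \<alpha>" "(f', g') \<in> L_max \<alpha>" "ae_eq f f'"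
  shows "ae_eq g g'"
proof -
  have L2: "f \<in> L2" "g \<in> L2" "f' \<in> L2" "g' \<in> L2"
    using assms by (auto simp: L_max_def)
  have "ae_eq (\<lambda>x. g x - g' x) (\<lambda>x. 0)"
  proof (rule L2_fundamental_lemma)
    show "(\<lambda>x. g x - g' x) \<in> L2"
      by (intro L2_diff L2)
    fix \<psi> assume \<psi>: "\<psi> \<in> Cc_smooth Rplus"
    have "(LINT x|LR. f x * \<theta> x) = (LINT x|LR. f' x * \<theta> x)" if "\<theta> \<in> Cc_smooth Rplus" for \<theta>
      by (intro integral_ae_eq_cong assms L2_measurable L2 Cc_smooth_measurable that)
    note this[OF Cc_smooth_vderiv(1)[OF Cc_smooth_vderiv(1)[OF \<psi>]]] this[OF Cc_smooth_mult[OF \<psi> smooth_potential[of \<alpha>]]]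
    moreover have "L_expr \<alpha> (distr_of f) \<psi> = distr_of g \<psi>" "L_expr \<alpha> (distr_of f') \<psi> = distr_of g' \<psi>"
      using assms \<psi> unfolding L_max_def distr_eq_def by auto
    ultimately have "(LINT x|LR. g x * \<psi> x) = (LINT x|LR. g' x * \<psi> x)"
      unfolding L_expr_distr_of by (simp add: distr_of_def)
    then show "(LINT x|LR. (g x - g' x) * \<psi> x) = 0"
      using L2_mult_integrable[OF L2(2) Cc_smooth_L2[OF \<psi>]] L2_mult_integrable[OF L2(4) Cc_smooth_L2[OF \<psi>]]
      by (simp add: left_diff_distrib)
  qed
  then show ?thesis
    by (simp add: ae_eq_def)
qed

text \<open>The restriction being closed consists of functions only almost everywhere equal to a
  test function. Passing to that test function lets \<open>L_max_unique\<close> replace the abstract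
  image by the explicit \<open>L_class\<close>.\<close>

lemma L_min_iff:
  "(f, g) \<in> L_min \<alpha> \<longleftrightarrow> f \<in> L2 \<and> g \<in> L2 \<and>
     (\<forall>e>0. \<exists>\<phi>\<in>Cc_smooth Rplus. L2_norm (\<lambda>x. f x - \<phi> x) < e \<and> L2_norm (\<lambda>x. g x - L_class \<alpha> \<phi> x) < e)"
    (is "_ \<longleftrightarrow> ?R")
proof
  assume "(f, g) \<in> L_min \<alpha>"
  then have L2: "f \<in> L2" "g \<in> L2" and appr: "\<And>e. e > 0 \<Longrightarrow> \<exists>(f', g')\<in>op_restrict (L_max \<alpha>) {f. \<exists>\<phi>\<in>Cc_smooth Rplus. ae_eq f \<phi>}.
      L2_norm (\<lambda>x. f x - f' x) < e \<and> L2_norm (\<lambda>x. g x - g' x) < e"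
    unfolding L_min_def op_closure_def by auto
  have "\<exists>\<phi>\<in>Cc_smooth Rplus. L2_norm (\<lambda>x. f x - \<phi> x) < e \<and> L2_norm (\<lambda>x. g x - L_class \<alpha> \<phi> x) < e" if e: "e > 0" for e
  proof -
    obtain f' g' \<phi> where fg: "(f', g') \<in> L_max \<alpha>" "\<phi> \<in> Cc_smooth Rplus" "ae_eq f' \<phi>"
      "L2_norm (\<lambda>x. f x - f' x) < e" "L2_norm (\<lambda>x. g x - g' x) < e"
      using appr[OF e] unfolding op_restrict_def by auto
    have L2': "f' \<in> L2" "g' \<in> L2"
      using fg(1) by (auto simp: L_max_def)
    have ae: "ae_eq g' (L_class \<alpha> \<phi>)"
      by (rule L_max_unique[OF fg(1) L_max_Cc[OF fg(2)] fg(3)])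
    have "L2_norm (\<lambda>x. f x - f' x) = L2_norm (\<lambda>x. f x - \<phi> x)"
      using fg(3) unfolding ae_eq_def
      by (intro L2_norm_cong L2_measurable L2_diff L2 L2' Cc_smooth_L2 fg(2)) (auto simp: ae_eq_def elim: eventually_mono)
    moreover have "L2_norm (\<lambda>x. g x - g' x) = L2_norm (\<lambda>x. g x - L_class \<alpha> \<phi> x)"
      using ae unfolding ae_eq_def
      by (intro L2_norm_cong L2_measurable L2_diff L2 L2' Cc_smooth_L2 L_class_Cc fg(2)) (auto simp: ae_eq_def elim: eventually_mono)
    ultimately show ?thesis
      using fg by auto
  qed
  then show ?R
    using L2 by blast
next
  assume R: ?R
  have "\<exists>(f', g')\<in>op_restrict (L_max \<alpha>) {f. \<exists>\<phi>\<in>Cc_smooth Rplus. ae_eq f \<phi>}.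
      L2_norm (\<lambda>x. f x - f' x) < e \<and> L2_norm (\<lambda>x. g x - g' x) < e" if e: "e > 0" for e
  proof -
    obtain \<phi> where \<phi>: "\<phi> \<in> Cc_smooth Rplus" "L2_norm (\<lambda>x. f x - \<phi> x) < e" "L2_norm (\<lambda>x. g x - L_class \<alpha> \<phi> x) < e"
      using R e by blast
    have "ae_eq \<phi> \<phi>"
      by (simp add: ae_eq_def)
    then have "(\<phi>, L_class \<alpha> \<phi>) \<in> op_restrict (L_max \<alpha>) {f. \<exists>\<phi>\<in>Cc_smooth Rplus. ae_eq f \<phi>}"
      using L_max_Cc[OF \<phi>(1)] \<phi>(1) unfolding op_restrict_def by auto
    then show ?thesis
      using \<phi>(2,3) by (intro bexI[of _ "(\<phi>, L_class \<alpha> \<phi>)"]) auto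
  qed
  then show "(f, g) \<in> L_min \<alpha>"
    using R unfolding L_min_def op_closure_def by auto
qed

lemma L_min_imp_H2_0:
  assumes m: "\<bar>Re m\<bar> < 1" and "(f, g) \<in> L_min (m\<^sup>2)"
  shows "f \<in> H2_0"
proof -
  have L2: "f \<in> L2" "g \<in> L2"
    using assms(2) by (auto simp: L_min_iff)
  obtain C where C: "0 \<le> C" "\<And>g. g \<in> L2 \<Longrightarrow> L_inverse m g \<in> L2"
    "\<And>g. g \<in> L2 \<Longrightarrow> L2_norm (L_inverse m g) \<le> C * L2_norm g"
    using L_inverse_bounded[OF m] by blast
  define a where "a = m\<^sup>2 - 1/4"
  \<comment> \<open>For a test function \<phi>'' = a \<phi> / x^2 - L \<phi> with \<phi> / x^2 = -
    \<open>L_inverse\<close> (L \<phi>). This expression is continuous in L \<phi>, so G is its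
    value at the limit g.\<close>
  define G where "G x = (- a) * L_inverse m g x - g x" for x
  have G: "G \<in> L2"
    unfolding G_def[abs_def] by (intro L2_diff L2_scale C L2)
  \<comment> \<open>The second summand is the Hardy constant times the norm of the map from L \<phi>
    to \<phi>''; the first ensures d \<le> e.\<close>
  define C' where "C' = 1 + 4/3 * (cmod a * C + 1)"
  have C': "C' \<ge> 1"
    using C(1) by (simp add: C'_def)
  have "ae_eq f (\<lambda>x. (complex_of_real x)\<^sup>2 * hardy 1 (hardy 0 G) x)"
  proof (rule ae_eq_square_mult[OF L2(1) hardy2(1)[OF G]])
    fix e :: real assume "e > 0"
    define d where "d = e / C'"
    have d: "d > 0" "C' * d = e" "d \<le> e"
      using C' \<open>e > 0\<close> by (auto simp: d_def divide_simps)
    obtain \<phi> where \<phi>: "\<phi> \<in> Cc_smooth Rplus" "L2_norm (\<lambda>x. f x - \<phi> x) < d"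
        "L2_norm (\<lambda>x. g x - L_class (m\<^sup>2) \<phi> x) < d"
      using assms(2) d(1) unfolding L_min_iff by blast
    let ?\<phi>2 = "vderiv (vderiv \<phi>)" and ?h = "\<lambda>x. g x - L_class (m\<^sup>2) \<phi> x"
    have \<phi>2: "?\<phi>2 \<in> L2"
      by (intro Cc_smooth_L2 Cc_smooth_vderiv \<phi>(1))
    have Lg: "L_class (m\<^sup>2) \<phi> \<in> L2"
      by (intro Cc_smooth_L2 L_class_Cc \<phi>(1))
    have h: "?h \<in> L2"
      by (rule L2_diff[OF L2(2) Lg])
    have D: "(\<lambda>x. G x - ?\<phi>2 x) \<in> L2"
      by (rule L2_diff[OF G \<phi>2])
    have R: "(\<lambda>x. (- a) * L_inverse m ?h x) \<in> L2"
      by (intro L2_scale C(2) h)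
    have "L2_norm (\<lambda>x. G x - ?\<phi>2 x) = L2_norm (\<lambda>x. (- a) * L_inverse m ?h x - ?h x)"
    proof (rule L2_norm_cong)
      show "ae_eq (\<lambda>x. G x - ?\<phi>2 x) (\<lambda>x. (- a) * L_inverse m ?h x - ?h x)"
      proof (rule ae_eqI)
        fix x :: real assume x: "0 < x"
        have "?\<phi>2 x = a * (\<phi> x / (complex_of_real x)\<^sup>2) - L_class (m\<^sup>2) \<phi> x"
          by (simp add: L_class_def potential_def a_def)
        then have eq: "?\<phi>2 x = (- a) * L_inverse m (L_class (m\<^sup>2) \<phi>) x - L_class (m\<^sup>2) \<phi> x"
          unfolding Cc_div_square_eq_L_inverse[OF \<phi>(1) x, of m] by (simp only: mult_minus_right mult_minus_left)
        show "G x - ?\<phi>2 x = (- a) * L_inverse m ?h x - ?h x"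
          unfolding L_inverse_diff[OF m L2(2) Lg] G_def eq by (simp add: algebra_simps)
      qed
    qed (intro L2_measurable D, intro L2_measurable L2_diff R h)
    also have "\<dots> \<le> L2_norm (\<lambda>x. (- a) * L_inverse m ?h x) + L2_norm ?h"
      by (rule L2_norm_triangle_diff[OF R h])
    also have "L2_norm (\<lambda>x. (- a) * L_inverse m ?h x) = cmod a * L2_norm (L_inverse m ?h)"
      by (simp only: L2_norm_scale norm_minus_cancel)
    also have "cmod a * L2_norm (L_inverse m ?h) + L2_norm ?h \<le> cmod a * (C * d) + d"
    proof (intro add_mono mult_left_mono)
      have "L2_norm (L_inverse m ?h) \<le> C * L2_norm ?h"
        by (rule C(3)[OF h])
      also have "\<dots> \<le> C * d"
        using \<phi>(3) C(1) by (intro mult_left_mono) auto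
      finally show "L2_norm (L_inverse m ?h) \<le> C * d" .
    qed (use \<phi>(3) in auto)
    finally have Dn: "L2_norm (\<lambda>x. G x - ?\<phi>2 x) \<le> (cmod a * C + 1) * d"
      by (simp add: algebra_simps)
    have "L2_norm (\<lambda>x. hardy 1 (hardy 0 G) x - \<phi> x / (complex_of_real x)\<^sup>2) =
        L2_norm (hardy 1 (hardy 0 (\<lambda>x. G x - ?\<phi>2 x)))"
    proof (rule L2_norm_cong)
      show "ae_eq (\<lambda>x. hardy 1 (hardy 0 G) x - \<phi> x / (complex_of_real x)\<^sup>2) (hardy 1 (hardy 0 (\<lambda>x. G x - ?\<phi>2 x)))"
        by (rule ae_eqI) (simp only: hardy2_diff[OF G \<phi>2] Cc_div_square_eq_hardy2[OF \<phi>(1)])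
      have "(\<lambda>x. 1 / (complex_of_real x)\<^sup>2 * \<phi> x) \<in> L2"
        by (intro Cc_smooth_L2 Cc_smooth_mult \<phi>(1) smooth_inverse_square)
      then show "(\<lambda>x. hardy 1 (hardy 0 G) x - \<phi> x / (complex_of_real x)\<^sup>2) \<in> borel_measurable LR"
        by (intro L2_measurable L2_diff hardy2(1) G) simp
    qed (intro L2_measurable hardy2(1) D)
    also have "\<dots> \<le> 4/3 * ((cmod a * C + 1) * d)"
      using hardy2(2)[OF D] Dn by linarith
    also have "\<dots> \<le> C' * d"
      using d(1) by (simp add: C'_def algebra_simps)
    finally show "\<exists>\<phi>\<in>Cc_smooth Rplus. L2_norm (\<lambda>x. f x - \<phi> x) \<le> e \<and>
        L2_norm (\<lambda>x. hardy 1 (hardy 0 G) x - \<phi> x / (complex_of_real x)\<^sup>2) \<le> e"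
      using \<phi> d by (intro bexI[of _ \<phi>]) auto
  qed
  moreover have "ae_eq (\<lambda>x. (complex_of_real x)\<^sup>2 * hardy 1 (hardy 0 G) x) (prim2 G)"
    by (rule ae_eqI) (simp add: prim2_eq_hardy)
  ultimately show ?thesis
    using H2_0_I[OF L2(1) G] ae_eq_trans by blast
qed

end

section \<open>Approximation in the graph norm and the domains\<close>

context cutoff_function
begin

definition tail :: "nat \<Rightarrow> real \<Rightarrow> real" where
  "tail n x = x / real (Suc n)"

definition tail0 :: "nat \<Rightarrow> real \<Rightarrow> complex" where
  "tail0 n x = 1 - \<xi> (tail n x)"

text \<open>x times the derivative of x |-> \<open>\<xi> (tail n x)\<close>; likewise
  \<open>tail2\<close> is x^2 times the second derivative. In this form they are bounded uniformly
  in n, and the compensating 1/x and 1/x^2 turn \<open>prim\<close> and \<open>prim2\<close> into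
  Hardy means.\<close>

definition tail1 :: "nat \<Rightarrow> real \<Rightarrow> complex" where
  "tail1 n x = complex_of_real (tail n x) * \<xi>1 (tail n x)"

definition tail2 :: "nat \<Rightarrow> real \<Rightarrow> complex" where
  "tail2 n x = (complex_of_real (tail n x))\<^sup>2 * \<xi>2 (tail n x)"

lemma tail_eq: "tail n x = (1 / real (Suc n)) * x"
  by (simp add: tail_def)

lemma tail_pos: "0 < x \<Longrightarrow> 0 < tail n x"
  by (simp add: tail_def)

lemma tail_smooth:
  "smooth_on Rplus (\<lambda>x. \<xi> (tail n x))" "smooth_on Rplus (\<lambda>x. \<xi>1 (tail n x))" "smooth_on Rplus (\<lambda>x. \<xi>2 (tail n x))"
  unfolding tail_eq by (intro xi_scaled_smooth; simp)+

lemma tail_measurable [measurable]: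
  "(\<lambda>x. \<xi> (tail n x)) \<in> borel_measurable LR" "(\<lambda>x. \<xi>1 (tail n x)) \<in> borel_measurable LR"
  "(\<lambda>x. \<xi>2 (tail n x)) \<in> borel_measurable LR"
  by (intro continuous_measurable_LR smooth_on_continuous_on tail_smooth)+

lemma tails_measurable:
  "tail0 n \<in> borel_measurable LR" "tail1 n \<in> borel_measurable LR" "tail2 n \<in> borel_measurable LR"
proof -
  have [measurable]: "tail n \<in> borel_measurable LR"
    unfolding tail_def[abs_def] by measurable
  show "tail0 n \<in> borel_measurable LR" "tail1 n \<in> borel_measurable LR" "tail2 n \<in> borel_measurable LR"
    unfolding tail0_def[abs_def] tail1_def[abs_def] tail2_def[abs_def] by measurable
qed

lemma tails_bound:
  assumes "0 < x"
  shows "cmod (tail0 n x) \<le> 1 + K" "cmod (tail1 n x) \<le> 1 + K" "cmod (tail2 n x) \<le> 1 + K"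
proof -
  note p = tail_pos[OF assms, of n]
  show "cmod (tail0 n x) \<le> 1 + K"
    using norm_triangle_ineq4[of 1 "\<xi> (tail n x)"] xi_bound(1)[OF p] by (simp add: tail0_def)
  show "cmod (tail1 n x) \<le> 1 + K"
    using xi_bound(2)[OF p] p by (simp add: tail1_def norm_mult)
  show "cmod (tail2 n x) \<le> 1 + K"
    using xi_bound(3)[OF p] p by (simp add: tail2_def norm_mult norm_power)
qed

lemma tails_eventually_zero:
  assumes "0 < x"
  shows "\<forall>\<^sub>F n in sequentially. tail0 n x = 0" "\<forall>\<^sub>F n in sequentially. tail1 n x = 0"
    "\<forall>\<^sub>F n in sequentially. tail2 n x = 0"
proof -
  obtain N where N: "x / \<epsilon> < real N"
    using reals_Archimedean2 by blast
  have small: "tail n x < \<epsilon>" if "n \<ge> N" for n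
  proof -
    have "x < real N * \<epsilon>"
      using N eps_R(1) by (simp add: field_simps)
    also have "\<dots> \<le> real (Suc n) * \<epsilon>"
      using that eps_R(1) by (intro mult_right_mono) auto
    finally show ?thesis
      unfolding tail_def by (simp add: pos_divide_less_eq mult.commute)
  qed
  have "tail0 n x = 0 \<and> tail1 n x = 0 \<and> tail2 n x = 0" if "n \<ge> N" for n
    using small[OF that] tail_pos[OF assms, of n] xi_one xi_deriv_zero
    by (simp add: tail0_def tail1_def tail2_def)
  then show "\<forall>\<^sub>F n in sequentially. tail0 n x = 0" "\<forall>\<^sub>F n in sequentially. tail1 n x = 0"
    "\<forall>\<^sub>F n in sequentially. tail2 n x = 0"
    unfolding eventually_sequentially by blast+
qed

lemma tails_tendsto_0:
  assumes "u \<in> L2"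
  shows "(\<lambda>n. L2_norm (\<lambda>x. tail0 n x * u x)) \<longlonglongrightarrow> 0" "(\<lambda>n. L2_norm (\<lambda>x. tail1 n x * u x)) \<longlonglongrightarrow> 0"
    "(\<lambda>n. L2_norm (\<lambda>x. tail2 n x * u x)) \<longlonglongrightarrow> 0"
  by (rule L2_norm_tail_tendsto_0[OF assms tails_measurable(1) _ tails_bound(1) tails_eventually_zero(1)];
      use K_nonneg in simp)
    (rule L2_norm_tail_tendsto_0[OF assms tails_measurable(2) _ tails_bound(2) tails_eventually_zero(2)]
      L2_norm_tail_tendsto_0[OF assms tails_measurable(3) _ tails_bound(3) tails_eventually_zero(3)];
      use K_nonneg in simp)+

text \<open>The approximants \<open>\<xi>(x/n) prim2 \<psi>\<close>: their second derivative differs from \<open>G\<close> by terms which are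
  small either because \<open>\<psi>\<close> is close to \<open>G\<close> or because they live where \<open>x \<ge> \<epsilon> n\<close>; the factors of \<open>1/n\<close> produced
  by the derivatives of the cutoff are absorbed by Hardy's inequality.\<close>

definition approximant :: "nat \<Rightarrow> (real \<Rightarrow> complex) \<Rightarrow> real \<Rightarrow> complex" where
  "approximant n \<psi> x = \<xi> (tail n x) * prim2 \<psi> x"

lemma prim_zero_below:
  assumes "\<And>x. 0 < x \<Longrightarrow> x < a \<Longrightarrow> u x = 0" "x < a"
  shows "prim u x = 0"
proof -
  have "prim u x = (LINT t|LR. 0)"
    unfolding prim_def using assms by (intro Bochner_Integration.integral_cong) (auto split: split_indicator)
  then show ?thesis by simp
qed

text \<open>Near 0 the double primitive vanishes together with \<open>\<psi>\<close>; beyond the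
  support of \<open>\<psi>\<close> it is affine and in general nonzero, so compactness of the
  support comes from \<xi> alone. The formula is the Leibniz rule with the powers of x
  redistributed.\<close>

lemma approximant_Cc:
  assumes "\<psi> \<in> Cc_smooth Rplus"
  shows "approximant n \<psi> \<in> Cc_smooth Rplus"
    and "\<And>x. 0 < x \<Longrightarrow> vderiv (vderiv (approximant n \<psi>)) x =
      \<xi> (tail n x) * \<psi> x + 2 * (tail1 n x * hardy 0 \<psi> x) + tail2 n x * hardy 1 (hardy 0 \<psi>) x"
proof -
  define c where "c = 1 / real (Suc n)"
  have c: "0 < c" "tail n = (\<lambda>x. c * x)"
    by (auto simp: c_def tail_def)
  obtain a b where ab: "0 < a" "a < b" "\<And>x. 0 < x \<Longrightarrow> x < a \<or> b < x \<Longrightarrow> \<psi> x = 0"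
    using Cc_smooth_supportE[OF assms] by blast
  note \<psi> = Cc_smooth_L2[OF assms]
  have p1: "prim \<psi> x = 0" if "x < a" for x
    using prim_zero_below[of a \<psi>] ab that by auto
  have p2: "prim2 \<psi> x = 0" if "x < a" for x
    unfolding prim2_def using prim_zero_below[of a "prim \<psi>"] p1 that by auto
  have s1: "smooth_on Rplus (prim \<psi>)"
    by (rule smooth_on_antideriv[OF Cc_smooth_smooth[OF assms]])
      (auto intro!: has_vector_derivative_at_within Cc_prim_has_vector_derivative[OF assms])
  have s2: "smooth_on Rplus (prim2 \<psi>)"
    by (rule smooth_on_antideriv[OF s1])
      (auto intro!: has_vector_derivative_at_within prim2_has_vector_derivative[OF \<psi>])
  show Cc: "approximant n \<psi> \<in> Cc_smooth Rplus"
  proof (rule Cc_smoothI)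
    show "smooth_on Rplus (approximant n \<psi>)"
      unfolding approximant_def[abs_def] by (intro smooth_on_mult tail_smooth s2)
    show "0 < a" "a < max (a + 1) (R / c)"
      using ab by auto
    show "approximant n \<psi> x = 0" if "0 < x" "x < a \<or> max (a + 1) (R / c) < x" for x
      using that(2)
    proof
      assume "max (a + 1) (R / c) < x"
      then have "R < c * x"
        using c(1) by (auto simp: field_simps)
      then show ?thesis
        by (simp add: approximant_def c(2) xi_zero)
    qed (simp add: approximant_def p2)
  qed
  let ?f1 = "\<lambda>x. \<xi> (c * x) * prim \<psi> x + (complex_of_real c * \<xi>1 (c * x)) * prim2 \<psi> x"
  let ?f2 = "\<lambda>x. (\<xi> (c * x) * \<psi> x + (complex_of_real c * \<xi>1 (c * x)) * prim \<psi> x) +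
      ((complex_of_real c * \<xi>1 (c * x)) * prim \<psi> x + (complex_of_real c * (complex_of_real c * \<xi>2 (c * x))) * prim2 \<psi> x)"
  have f1: "vderiv (approximant n \<psi>) x = ?f1 x" if "0 < x" for x
    unfolding approximant_def[abs_def] c(2)
    by (intro vector_derivative_at has_vector_derivative_mult xi_scaled_deriv c(1) that prim2_has_vector_derivative \<psi>)
  show "vderiv (vderiv (approximant n \<psi>)) x =
      \<xi> (tail n x) * \<psi> x + 2 * (tail1 n x * hardy 0 \<psi> x) + tail2 n x * hardy 1 (hardy 0 \<psi>) x" if x: "0 < x" for x
  proof -
    have "(?f1 has_vector_derivative ?f2 x) (at x)"
      by (intro has_vector_derivative_add has_vector_derivative_mult has_vector_derivative_mult_right
          xi_scaled_deriv c(1) x prim2_has_vector_derivative \<psi> Cc_prim_has_vector_derivative assms)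
    then have "(vderiv (approximant n \<psi>) has_vector_derivative ?f2 x) (at x)"
      by (rule has_vector_derivative_transform_within_open[of _ _ _ Rplus]) (use x f1 in auto)
    then have "vderiv (vderiv (approximant n \<psi>)) x = ?f2 x"
      by (rule vector_derivative_at)
    then show ?thesis
      using prim_eq_hardy[OF x, of \<psi>] prim2_eq_hardy[OF x, of \<psi>]
      by (simp add: c(2) tail1_def tail2_def algebra_simps power2_eq_square)
  qed
qed

text \<open>First n is chosen from f, G and their Hardy means, making all four tail terms small.
  Only then is \<open>\<psi>\<close> chosen, with an accuracy depending on n through the radius
  T.\<close>

lemma H2_0_approximation:
  assumes "f \<in> L2" "G \<in> L2" "ae_eq f (prim2 G)" "e > 0"
  obtains \<phi> where "\<phi> \<in> Cc_smooth Rplus" "L2_norm (\<lambda>x. f x - \<phi> x) < e"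
    "L2_norm (\<lambda>x. G x - vderiv (vderiv \<phi>) x) < e"
proof -
  let ?h = "hardy 0 G" and ?W = "hardy 1 (hardy 0 G)"
  have h: "?h \<in> L2" and W: "?W \<in> L2"
    using hardy_inequality(1)[of 0 G] hardy2(1) assms by auto
  have "\<forall>\<^sub>F n in sequentially. L2_norm (\<lambda>x. tail0 n x * f x) < e / 8 \<and> L2_norm (\<lambda>x. tail0 n x * G x) < e / 8 \<and>
      L2_norm (\<lambda>x. tail1 n x * ?h x) < e / 8 \<and> L2_norm (\<lambda>x. tail2 n x * ?W x) < e / 8"
    using assms(4) by (intro eventually_conj order_tendstoD(2)[OF tails_tendsto_0(1)] order_tendstoD(2)[OF tails_tendsto_0(2)]
      order_tendstoD(2)[OF tails_tendsto_0(3)] assms h W) auto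
  then obtain n where n: "L2_norm (\<lambda>x. tail0 n x * f x) < e / 8" "L2_norm (\<lambda>x. tail0 n x * G x) < e / 8"
      "L2_norm (\<lambda>x. tail1 n x * ?h x) < e / 8" "L2_norm (\<lambda>x. tail2 n x * ?W x) < e / 8"
    by (auto simp: eventually_sequentially)
  define T where "T = R * real (Suc n)"
  have T: "T > 0"
    using eps_R by (simp add: T_def)
  \<comment> \<open>Covers both estimates: the second derivative costs 7 (1 + K) d, namely 1 + 2 * 2
    + 2 Hardy-weighted terms, and the function itself costs 2 (1 + K) T^2 d.\<close>
  define C where "C = (1 + K) * (8 + T\<^sup>2 * 2)"
  have K1: "1 + K \<ge> 1"
    using K_nonneg by simp
  have C: "C \<ge> 8 * (1 + K)" "C \<ge> (1 + K) * T\<^sup>2 * 2" "C > 0"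
    using K1 T by (auto simp: C_def algebra_simps intro: add_pos_nonneg)
  define d where "d = e / (4 * C)"
  have d: "d > 0"
    using C assms(4) by (simp add: d_def)
  obtain \<psi> where \<psi>: "\<psi> \<in> Cc_smooth Rplus" "L2_norm (\<lambda>x. G x - \<psi> x) < d"
    using Cc_smooth_dense[OF assms(2) d] by blast
  note \<psi>2 = Cc_smooth_L2[OF \<psi>(1)]
  let ?D = "\<lambda>x. G x - \<psi> x"
  have D: "?D \<in> L2"
    by (rule L2_diff[OF assms(2) \<psi>2])
  have hD: "hardy 0 ?D \<in> L2" "L2_norm (hardy 0 ?D) \<le> 2 * L2_norm ?D"
    using hardy_inequality[of 0 ?D] D by auto
  note WD = hardy2[OF D]
  let ?\<phi> = "approximant n \<psi>"
  note \<phi> = approximant_Cc[OF \<psi>(1), where n = n]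
  have xib: "cmod (\<xi> (tail n x)) \<le> 1 + K" if "0 < x" for x
    using xi_bound(1)[OF tail_pos[OF that, of n]] by simp
  note tm = tails_measurable[of n]
  have K0: "0 \<le> 1 + K"
    using K_nonneg by simp
  note A0 = L2_norm_mult_le(1)[OF assms(2) tm(1) K0 tails_bound(1)]
  note A1 = L2_norm_mult_le(1)[OF h tm(2) K0 tails_bound(2)]
  note A2 = L2_norm_mult_le(1)[OF W tm(3) K0 tails_bound(3)]
  note B0 = L2_norm_mult_le[OF D tail_measurable(1)[of n] K0 xib]
  note B1 = L2_norm_mult_le[OF hD(1) tm(2) K0 tails_bound(2)]
  note B2 = L2_norm_mult_le[OF WD(1) tm(3) K0 tails_bound(3)]
  \<comment> \<open>G - \<xi> \<open>\<psi>\<close> is (1 - \<xi>) G + \<xi> (G -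
    \<open>\<psi>\<close>); in the other two terms the Hardy mean of \<open>\<psi>\<close> is that
    of G minus that of the difference. Every piece has either a tail or a small norm.\<close>
  let ?E = "\<lambda>x. tail0 n x * G x + \<xi> (tail n x) * ?D x"
  let ?E1 = "\<lambda>x. tail1 n x * ?h x - tail1 n x * hardy 0 ?D x"
  let ?E2 = "\<lambda>x. tail2 n x * ?W x - tail2 n x * hardy 1 (hardy 0 ?D) x"
  note E = L2_add[OF A0 B0(1)]
  note E1 = L2_scale[OF L2_diff[OF A1 B1(1)], of 2]
  note E2 = L2_diff[OF A2 B2(1)]
  have "L2_norm (\<lambda>x. G x - vderiv (vderiv ?\<phi>) x) = L2_norm (\<lambda>x. ?E x - 2 * ?E1 x - ?E2 x)"
  proof (rule L2_norm_cong)
    show "ae_eq (\<lambda>x. G x - vderiv (vderiv ?\<phi>) x) (\<lambda>x. ?E x - 2 * ?E1 x - ?E2 x)"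
    proof (rule ae_eqI)
      fix x :: real assume x: "0 < x"
      have hardy_D: "hardy 0 ?D x = ?h x - hardy 0 \<psi> x"
        by (rule hardy_diff[OF _ assms(2) \<psi>2]) simp
      show "G x - vderiv (vderiv ?\<phi>) x = ?E x - 2 * ?E1 x - ?E2 x"
        unfolding \<phi>(2)[OF x] hardy_D hardy2_diff[OF assms(2) \<psi>2] by (simp add: tail0_def algebra_simps)
    qed
  qed (intro L2_measurable L2_diff assms Cc_smooth_L2 Cc_smooth_vderiv \<phi>(1), intro L2_measurable L2_diff[OF L2_diff] E E1 E2)
  also have "\<dots> \<le> L2_norm (\<lambda>x. ?E x - 2 * ?E1 x) + L2_norm ?E2"
    by (rule L2_norm_triangle_diff[OF L2_diff[OF E E1] E2])
  also have "\<dots> \<le> (L2_norm ?E + L2_norm (\<lambda>x. 2 * ?E1 x)) + L2_norm ?E2"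
    by (rule add_right_mono) (rule L2_norm_triangle_diff[OF E E1])
  also have "\<dots> = L2_norm ?E + 2 * L2_norm ?E1 + L2_norm ?E2"
    by (simp only: L2_norm_scale norm_numeral)
  also have "\<dots> \<le> (e / 8 + (1 + K) * d) + 2 * (e / 8 + (1 + K) * (2 * d)) + (e / 8 + (1 + K) * (2 * d))"
  proof (intro add_mono mult_left_mono)
    have "(1 + K) * L2_norm ?D \<le> (1 + K) * d"
      using \<psi>(2) K0 by (intro mult_left_mono) auto
    then show "L2_norm ?E \<le> e / 8 + (1 + K) * d"
      using L2_norm_triangle[OF A0 B0(1)] B0(2) n(2) by linarith
    have "(1 + K) * L2_norm (hardy 0 ?D) \<le> (1 + K) * (2 * d)"
      using hD(2) \<psi>(2) K0 by (intro mult_left_mono) auto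
    then show "L2_norm ?E1 \<le> e / 8 + (1 + K) * (2 * d)"
      using L2_norm_triangle_diff[OF A1 B1(1)] B1(2) n(3) by linarith
    have "4/3 * L2_norm ?D \<le> 2 * d"
      using \<psi>(2) L2_norm_nonneg[of ?D] by linarith
    then have "(1 + K) * L2_norm (hardy 1 (hardy 0 ?D)) \<le> (1 + K) * (2 * d)"
      using WD(2) K0 by (intro mult_left_mono) auto
    then show "L2_norm ?E2 \<le> e / 8 + (1 + K) * (2 * d)"
      using L2_norm_triangle_diff[OF A2 B2(1)] B2(2) n(4) by linarith
  qed simp
  also have "\<dots> = e / 2 + 7 * (1 + K) * d"
    by (simp add: algebra_simps)
  also have "\<dots> < e"
  proof -
    have "7 * (1 + K) * d \<le> C * d"
      using C K1 d by (intro mult_right_mono) auto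
    also have "\<dots> = e / 4"
      using C by (simp add: d_def)
    finally show ?thesis
      using assms(4) by linarith
  qed
  finally have second: "L2_norm (\<lambda>x. G x - vderiv (vderiv ?\<phi>) x) < e" .
  \<comment> \<open>The difference prim2 (G - \<open>\<psi>\<close>) is x^2 times a small
    \<open>L2\<close> function; the cutoff confines x to [0, T], so the factor x^2 is
    harmless.\<close>
  let ?p = "\<lambda>x. \<xi> (tail n x) * (complex_of_real x)\<^sup>2"
  have pm: "?p \<in> borel_measurable LR"
    by measurable
  have pb: "cmod (?p x) \<le> (1 + K) * T\<^sup>2" if "0 < x" for x
  proof (cases "x \<le> T")
    case True
    then show ?thesis
      using xib[OF that] that K0 unfolding norm_mult norm_power by (intro mult_mono power_mono) auto
  next
    case False
    then have "R < tail n x"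
      by (simp add: T_def tail_def pos_less_divide_eq)
    then show ?thesis
      using K0 by (simp add: xi_zero)
  qed
  have KT: "0 \<le> (1 + K) * T\<^sup>2"
    using K0 by simp
  note F0 = L2_norm_mult_le(1)[OF assms(1) tm(1) K0 tails_bound(1)]
  note F1 = L2_norm_mult_le[OF WD(1) pm KT pb]
  have "L2_norm (\<lambda>x. f x - ?\<phi> x) = L2_norm (\<lambda>x. tail0 n x * f x + ?p x * hardy 1 (hardy 0 ?D) x)"
  proof (rule L2_norm_cong)
    show "ae_eq (\<lambda>x. f x - ?\<phi> x) (\<lambda>x. tail0 n x * f x + ?p x * hardy 1 (hardy 0 ?D) x)"
      using assms(3) AE_space unfolding ae_eq_def
    proof eventually_elim
      case (elim x)
      then have x: "0 < x" by simp
      show ?case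
        unfolding hardy2_diff[OF assms(2) \<psi>2] elim(1) approximant_def prim2_eq_hardy[OF x]
        by (simp add: tail0_def algebra_simps)
    qed
  qed (intro L2_measurable L2_diff assms Cc_smooth_L2 \<phi>(1), intro L2_measurable L2_add F0 F1)
  also have "\<dots> \<le> e / 8 + (1 + K) * T\<^sup>2 * (2 * d)"
  proof -
    have "4/3 * L2_norm ?D \<le> 2 * d"
      using \<psi>(2) L2_norm_nonneg[of ?D] by linarith
    then have "(1 + K) * T\<^sup>2 * L2_norm (hardy 1 (hardy 0 ?D)) \<le> (1 + K) * T\<^sup>2 * (2 * d)"
      using WD(2) KT by (intro mult_left_mono) auto
    then show ?thesis
      using L2_norm_triangle[OF F0 F1(1)] F1(2) n(1) by linarith
  qed
  also have "\<dots> \<le> e / 8 + C * d"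
    using mult_right_mono[OF C(2), of d] d by (simp add: mult_ac)
  also have "\<dots> = e / 8 + e / 4"
    using C by (simp add: d_def)
  also have "\<dots> < e"
    using assms(4) by simp
  finally have "L2_norm (\<lambda>x. f x - ?\<phi> x) < e" .
  then show thesis
    by (rule that[OF \<phi>(1) _ second])
qed

text \<open>By Hardy both terms of L \<phi> are continuous in \<phi>'' alone, whatever the value of
  \<alpha>, so approximating G by \<phi>'' also approximates the image.\<close>

lemma H2_0_imp_L_min:
  assumes "f \<in> H2_0"
  obtains g where "(f, g) \<in> L_min \<alpha>"
proof -
  obtain G where G: "f \<in> L2" "G \<in> L2" "ae_eq f (prim2 G)"
    using H2_0_E[OF assms] by blast
  let ?W = "hardy 1 (hardy 0 G)"
  define g where "g x = (\<alpha> - 1/4) * ?W x - G x" for x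
  have g: "g \<in> L2"
    unfolding g_def[abs_def] by (intro L2_diff L2_scale hardy2 G)
  define C where "C = cmod (\<alpha> - 1/4) * (4/3) + 1"
  have C: "C \<ge> 1"
    by (simp add: C_def)
  have "(f, g) \<in> L_min \<alpha>"
    unfolding L_min_iff
  proof (intro conjI allI impI)
    fix e :: real assume "e > 0"
    define d where "d = e / C"
    have d: "d > 0" "C * d = e" "d \<le> e"
      using C \<open>e > 0\<close> by (auto simp: d_def divide_simps)
    obtain \<phi> where \<phi>: "\<phi> \<in> Cc_smooth Rplus" "L2_norm (\<lambda>x. f x - \<phi> x) < d"
        "L2_norm (\<lambda>x. G x - vderiv (vderiv \<phi>) x) < d"
      using H2_0_approximation[OF G d(1)] by blast
    let ?D = "\<lambda>x. G x - vderiv (vderiv \<phi>) x"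
    have \<phi>2: "vderiv (vderiv \<phi>) \<in> L2"
      by (intro Cc_smooth_L2 Cc_smooth_vderiv \<phi>(1))
    have D: "?D \<in> L2"
      by (rule L2_diff[OF G(2) \<phi>2])
    note WD = hardy2[OF D]
    have "L2_norm (\<lambda>x. g x - L_class \<alpha> \<phi> x) = L2_norm (\<lambda>x. (\<alpha> - 1/4) * hardy 1 (hardy 0 ?D) x - ?D x)"
    proof (rule L2_norm_cong)
      show "ae_eq (\<lambda>x. g x - L_class \<alpha> \<phi> x) (\<lambda>x. (\<alpha> - 1/4) * hardy 1 (hardy 0 ?D) x - ?D x)"
      proof (rule ae_eqI)
        fix x :: real assume x: "0 < x"
        have "L_class \<alpha> \<phi> x = - vderiv (vderiv \<phi>) x + (\<alpha> - 1/4) * (\<phi> x / (complex_of_real x)\<^sup>2)"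
          by (simp add: L_class_def potential_def)
        then have eq: "L_class \<alpha> \<phi> x = - vderiv (vderiv \<phi>) x + (\<alpha> - 1/4) * hardy 1 (hardy 0 (vderiv (vderiv \<phi>))) x"
          by (simp only: Cc_div_square_eq_hardy2[OF \<phi>(1) x])
        show "g x - L_class \<alpha> \<phi> x = (\<alpha> - 1/4) * hardy 1 (hardy 0 ?D) x - ?D x"
          unfolding g_def eq hardy2_diff[OF G(2) \<phi>2] by (simp add: algebra_simps)
      qed
    qed (intro L2_measurable L2_diff g Cc_smooth_L2 L_class_Cc \<phi>(1), intro L2_measurable L2_diff L2_scale WD(1) D)
    also have "\<dots> \<le> L2_norm (\<lambda>x. (\<alpha> - 1/4) * hardy 1 (hardy 0 ?D) x) + L2_norm ?D"
      by (rule L2_norm_triangle_diff[OF L2_scale[OF WD(1)] D])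
    also have "\<dots> \<le> cmod (\<alpha> - 1/4) * (4/3 * L2_norm ?D) + L2_norm ?D"
      unfolding L2_norm_scale using WD(2) by (intro add_right_mono mult_left_mono) auto
    also have "\<dots> = C * L2_norm ?D"
      by (simp add: C_def algebra_simps)
    also have "\<dots> < C * d"
      using C \<phi>(3) by (intro mult_strict_left_mono) auto
    finally show "\<exists>\<phi>\<in>Cc_smooth Rplus. L2_norm (\<lambda>x. f x - \<phi> x) < e \<and> L2_norm (\<lambda>x. g x - L_class \<alpha> \<phi> x) < e"
      using \<phi> d by (intro bexI[of _ \<phi>]) auto
  qed (rule G(1), rule g)
  then show thesis
    by (rule that)
qed

section \<open>The domains, and independence of the cutoff\<close>

lemma Domain_L_min:
  assumes "\<bar>Re m\<bar> < 1"
  shows "Domain (L_min (m\<^sup>2)) = H2_0"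
  using L_min_imp_H2_0[OF assms] H2_0_imp_L_min[of _ "m\<^sup>2"] by (auto simp: Domain_iff) blast+

text \<open>\<open>H_op\<close> restricts \<open>L_max\<close>, so membership in the domain of the
  latter has to be supplied as well; it follows directly from \<open>prim2_weak\<close>, without
  showing that \<open>L_max\<close> is closed.\<close>

lemma H2_0_imp_L_max:
  assumes "f \<in> H2_0"
  obtains g where "(f, g) \<in> L_max \<alpha>"
proof -
  obtain G where G: "f \<in> L2" "G \<in> L2" "ae_eq f (prim2 G)"
    using H2_0_E[OF assms] by blast
  let ?W = "hardy 1 (hardy 0 G)"
  define g where "g x = (\<alpha> - 1/4) * ?W x - G x" for x
  have g: "g \<in> L2"
    unfolding g_def[abs_def] by (intro L2_diff L2_scale hardy2 G)
  have "L_expr \<alpha> (distr_of f) \<phi> = distr_of g \<phi>" if \<phi>: "\<phi> \<in> Cc_smooth Rplus" for \<phi>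
  proof -
    note d2 = Cc_smooth_vderiv(1)[OF Cc_smooth_vderiv(1)[OF \<phi>]]
    note pot = Cc_smooth_mult[OF \<phi> smooth_potential[of \<alpha>]]
    have "(LINT x|LR. f x * vderiv (vderiv \<phi>) x) = (LINT x|LR. prim2 G x * vderiv (vderiv \<phi>) x)"
      by (intro integral_ae_eq_cong G L2_measurable prim2_measurable Cc_smooth_measurable d2)
    then have 1: "(LINT x|LR. f x * vderiv (vderiv \<phi>) x) = (LINT x|LR. G x * \<phi> x)"
      using prim2_weak[OF G(2) \<phi>] by simp
    have "(LINT x|LR. f x * (potential \<alpha> x * \<phi> x)) = (LINT x|LR. prim2 G x * (potential \<alpha> x * \<phi> x))"
      by (intro integral_ae_eq_cong G L2_measurable prim2_measurable Cc_smooth_measurable pot)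
    also have "\<dots> = (LINT x|LR. ((\<alpha> - 1/4) * ?W x) * \<phi> x)"
      by (rule Bochner_Integration.integral_cong) (auto simp: prim2_eq_hardy potential_def)
    finally have 2: "(LINT x|LR. f x * (potential \<alpha> x * \<phi> x)) = (LINT x|LR. ((\<alpha> - 1/4) * ?W x) * \<phi> x)" .
    have "distr_of g \<phi> = (LINT x|LR. ((\<alpha> - 1/4) * ?W x) * \<phi> x - G x * \<phi> x)"
      unfolding distr_of_def g_def by (simp add: left_diff_distrib)
    also have "\<dots> = (LINT x|LR. ((\<alpha> - 1/4) * ?W x) * \<phi> x) - (LINT x|LR. G x * \<phi> x)"
      by (intro Bochner_Integration.integral_diff L2_mult_integrable L2_scale hardy2 G Cc_smooth_L2 \<phi>)
    finally show ?thesis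
      unfolding L_expr_distr_of 1 2 by simp
  qed
  then have "(f, g) \<in> L_max \<alpha>"
    using G(1) g unfolding L_max_def distr_eq_def by blast
  then show thesis
    by (rule that)
qed

lemma cut_power_L2:
  assumes "Re m > -1"
  shows "cut_power m \<xi> \<in> L2"
proof -
  have b: "Re (1/2 + m) > -1/2"
    using assms by simp
  have "0 < R"
    using eps_R by simp
  \<comment> \<open>\<open>tail 0 x\<close> is x / 1, so this is the measurability of \<xi>
    itself.\<close>
  have "(\<lambda>x. \<xi> (tail 0 x)) \<in> borel_measurable LR"
    by (rule tail_measurable)
  then have xm: "\<xi> \<in> borel_measurable LR"
    by (simp add: tail_def)
  show ?thesis
  proof (rule L2_bound[OF _ powr_indicator_L2'(1)[OF b, of R]])
    show "cut_power m \<xi> \<in> borel_measurable LR"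
      unfolding cut_power_def by (intro borel_measurable_times powr_measurable_LR xm)
    show "AE x in LR. cmod (cut_power m \<xi> x) \<le> K * cmod (indicator {..R} x *\<^sub>R complex_of_real x powr (1/2 + m))"
    proof (rule AE_LR_everywhere)
      fix x :: real assume x: "0 < x"
      show "cmod (cut_power m \<xi> x) \<le> K * cmod (indicator {..R} x *\<^sub>R complex_of_real x powr (1/2 + m))"
        using xi_bound(1)[OF x] xi_zero[of x] unfolding cut_power_def
        by (cases "x \<le> R") (auto simp: norm_mult mult.commute intro: mult_right_mono)
    qed
  qed (use \<open>0 < R\<close> in simp)
qed

text \<open>The power x^(1/2+m) is annihilated by L, because (1/2 + m)(m - 1/2) = m^2 - 1/4. Only
  terms containing a derivative of \<xi> survive, and these are test functions.\<close>

lemma cut_power_L_max: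
  assumes "Re m > -1"
  obtains g where "(cut_power m \<xi>, g) \<in> L_max (m\<^sup>2)"
proof -
  define \<beta> where "\<beta> = 1/2 + m"
  let ?p = "\<lambda>\<beta> x. complex_of_real x powr \<beta>"
  let ?f1 = "\<lambda>x. ?p \<beta> x * \<xi>1 x + (\<beta> * ?p (\<beta> - 1) x) * \<xi> x"
  let ?f2 = "\<lambda>x. (?p \<beta> x * \<xi>2 x + (\<beta> * ?p (\<beta> - 1) x) * \<xi>1 x) +
     ((\<beta> * ?p (\<beta> - 1) x) * \<xi>1 x + (\<beta> * ((\<beta> - 1) * ?p (\<beta> - 1 - 1) x)) * \<xi> x)"
  have pot: "potential (m\<^sup>2) x * ?p \<beta> x = \<beta> * ((\<beta> - 1) * ?p (\<beta> - 1 - 1) x)" if "0 < x" for x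
  proof -
    have "m\<^sup>2 - 1/4 = \<beta> * (\<beta> - 1)"
      by (simp add: \<beta>_def power2_eq_square algebra_simps)
    moreover have "?p (\<beta> - 1 - 1) x = ?p \<beta> x / (complex_of_real x)\<^sup>2"
      using that by (simp add: powr_diff power2_eq_square)
    ultimately show ?thesis
      by (simp add: potential_def)
  qed
  have C1: "\<xi>1 \<in> Cc_smooth Rplus" and C2: "\<xi>2 \<in> Cc_smooth Rplus"
    by (rule Cc_smoothI[of _ \<epsilon> R]; use eps_R xi_smooth xi_deriv_zero in simp)+
  have "(cut_power m \<xi>, \<lambda>x. - ?f2 x + potential (m\<^sup>2) x * cut_power m \<xi> x) \<in> L_max (m\<^sup>2)"
  proof (rule L_max_smooth[OF cut_power_L2[OF assms]])
    show "(cut_power m \<xi> has_vector_derivative ?f1 x) (at x)" if "0 < x" for x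
      unfolding cut_power_def \<beta>_def[symmetric]
      by (intro has_vector_derivative_mult has_vector_derivative_powr_Rplus xi_deriv that)
    show "(?f1 has_vector_derivative ?f2 x) (at x)" if "0 < x" for x
      by (intro has_vector_derivative_add has_vector_derivative_mult has_vector_derivative_mult_right
          has_vector_derivative_powr_Rplus xi_deriv that)
    show "continuous_on Rplus ?f2"
      by (intro smooth_on_continuous_on smooth_on_add smooth_on_mult smooth_on_const smooth_on_powr xi_smooth)
    have "(\<lambda>x. (- 2 * \<beta>) * (?p (\<beta> - 1) x * \<xi>1 x) - ?p \<beta> x * \<xi>2 x) \<in> L2"
      by (intro Cc_smooth_L2 Cc_smooth_diff Cc_smooth_scale Cc_smooth_mult smooth_on_powr C1 C2)
    moreover have "ae_eq (\<lambda>x. - ?f2 x + potential (m\<^sup>2) x * cut_power m \<xi> x)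
        (\<lambda>x. (- 2 * \<beta>) * (?p (\<beta> - 1) x * \<xi>1 x) - ?p \<beta> x * \<xi>2 x)"
    proof (rule ae_eqI)
      fix x :: real assume x: "0 < x"
      have "potential (m\<^sup>2) x * cut_power m \<xi> x = (potential (m\<^sup>2) x * ?p \<beta> x) * \<xi> x"
        by (simp add: cut_power_def \<beta>_def)
      then show "- ?f2 x + potential (m\<^sup>2) x * cut_power m \<xi> x = (- 2 * \<beta>) * (?p (\<beta> - 1) x * \<xi>1 x) - ?p \<beta> x * \<xi>2 x"
        unfolding pot[OF x] by (simp add: algebra_simps)
    qed
    ultimately show "(\<lambda>x. - ?f2 x + potential (m\<^sup>2) x * cut_power m \<xi> x) \<in> L2"
      using L2_ae_cong by blast
  qed
  then show thesis
    by (rule that)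
qed

lemma Cc_H2_0:
  assumes "\<phi> \<in> Cc_smooth Rplus"
  shows "\<phi> \<in> H2_0"
proof (rule H2_0_I[OF Cc_smooth_L2[OF assms]])
  show "vderiv (vderiv \<phi>) \<in> L2"
    by (intro Cc_smooth_L2 Cc_smooth_vderiv assms)
  show "ae_eq \<phi> (prim2 (vderiv (vderiv \<phi>)))"
    by (rule ae_eqI) (simp add: Cc_prim2_vderiv2[OF assms])
qed

lemma H2_0_add:
  assumes "f \<in> H2_0" "g \<in> H2_0"
  shows "(\<lambda>x. f x + g x) \<in> H2_0"
proof -
  obtain F where F: "f \<in> L2" "F \<in> L2" "ae_eq f (prim2 F)"
    using H2_0_E[OF assms(1)] by blast
  obtain G where G: "g \<in> L2" "G \<in> L2" "ae_eq g (prim2 G)"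
    using H2_0_E[OF assms(2)] by blast
  show ?thesis
  proof (rule H2_0_I)
    show "(\<lambda>x. f x + g x) \<in> L2" "(\<lambda>x. F x + G x) \<in> L2"
      by (intro L2_add F G)+
    show "ae_eq (\<lambda>x. f x + g x) (prim2 (\<lambda>x. F x + G x))"
      using F(3) G(3) unfolding ae_eq_def prim2_add[OF F(2) G(2)] by eventually_elim simp
  qed
qed

end

text \<open>Two cutoffs agree near 0 and near infinity. As test functions lie in
  \<open>H2_0\<close>, this gives the independence of the span from the choice of cutoff.\<close>

lemma cut_power_diff_Cc:
  assumes "cutoff_function \<xi> \<xi>1 \<xi>2 \<epsilon> R K" "cutoff_function \<eta> \<eta>1 \<eta>2 \<epsilon>' R' K'"
  shows "(\<lambda>x. cut_power m \<xi> x - cut_power m \<eta> x) \<in> Cc_smooth Rplus"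
proof -
  interpret a: cutoff_function \<xi> \<xi>1 \<xi>2 \<epsilon> R K by fact
  interpret b: cutoff_function \<eta> \<eta>1 \<eta>2 \<epsilon>' R' K' by fact
  have "(\<lambda>x. \<xi> x - \<eta> x) \<in> Cc_smooth Rplus"
  proof (rule Cc_smoothI)
    show "smooth_on Rplus (\<lambda>x. \<xi> x - \<eta> x)"
      by (intro smooth_on_diff a.xi_smooth b.xi_smooth)
    show "0 < min \<epsilon> \<epsilon>'" "min \<epsilon> \<epsilon>' < max R R'"
      using a.eps_R b.eps_R by auto
    show "\<xi> x - \<eta> x = 0" if "0 < x" "x < min \<epsilon> \<epsilon>' \<or> max R R' < x" for x
      using that a.xi_one[of x] b.xi_one[of x] a.xi_zero[of x] b.xi_zero[of x] by auto
  qed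
  from Cc_smooth_mult[OF this smooth_on_powr[of "1/2 + m"]] show ?thesis
    by (simp add: cut_power_def right_diff_distrib)
qed

lemma L_max_add:
  assumes "(f, g) \<in> L_max \<alpha>" "(f', g') \<in> L_max \<alpha>" "ae_eq h (\<lambda>x. f x + c * f' x)"
  shows "(h, \<lambda>x. g x + c * g' x) \<in> L_max \<alpha>"
proof -
  have L2: "f \<in> L2" "g \<in> L2" "f' \<in> L2" "g' \<in> L2"
    and eq: "\<And>\<phi>. \<phi> \<in> Cc_smooth Rplus \<Longrightarrow> L_expr \<alpha> (distr_of f) \<phi> = distr_of g \<phi>"
      "\<And>\<phi>. \<phi> \<in> Cc_smooth Rplus \<Longrightarrow> L_expr \<alpha> (distr_of f') \<phi> = distr_of g' \<phi>"
    using assms unfolding L_max_def distr_eq_def by auto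
  have h: "(\<lambda>x. f x + c * f' x) \<in> L2" "(\<lambda>x. g x + c * g' x) \<in> L2"
    by (intro L2_add L2_scale L2)+
  then have hL: "h \<in> L2"
    using L2_ae_cong[OF assms(3)] by blast
  have lin: "(LINT x|LR. (u x + c * v x) * \<theta> x) = (LINT x|LR. u x * \<theta> x) + c * (LINT x|LR. v x * \<theta> x)"
    if "u \<in> L2" "v \<in> L2" "\<theta> \<in> Cc_smooth Rplus" for u v \<theta>
  proof -
    have "integrable LR (\<lambda>x. u x * \<theta> x)" "integrable LR (\<lambda>x. v x * \<theta> x)"
      by (intro L2_mult_integrable that Cc_smooth_L2)+
    then show ?thesis
      by (simp add: distrib_right mult.assoc)
  qed
  have "L_expr \<alpha> (distr_of h) \<phi> = distr_of (\<lambda>x. g x + c * g' x) \<phi>" if \<phi>: "\<phi> \<in> Cc_smooth Rplus" for \<phi>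
  proof -
    note d2 = Cc_smooth_vderiv(1)[OF Cc_smooth_vderiv(1)[OF \<phi>]]
    note pot = Cc_smooth_mult[OF \<phi> smooth_potential[of \<alpha>]]
    have hl: "(LINT x|LR. h x * \<theta> x) = (LINT x|LR. f x * \<theta> x) + c * (LINT x|LR. f' x * \<theta> x)"
      if "\<theta> \<in> Cc_smooth Rplus" for \<theta>
      using lin[OF L2(1,3) that] integral_ae_eq_cong[OF assms(3) L2_measurable[OF hL] L2_measurable[OF h(1)] Cc_smooth_measurable[OF that]]
      by simp
    have "distr_of (\<lambda>x. g x + c * g' x) \<phi> = L_expr \<alpha> (distr_of f) \<phi> + c * L_expr \<alpha> (distr_of f') \<phi>"
      unfolding eq[OF \<phi>] unfolding distr_of_def by (rule lin[OF L2(2,4) \<phi>])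
    then show ?thesis
      unfolding L_expr_distr_of hl[OF d2] hl[OF pot] by (simp add: algebra_simps)
  qed
  then show ?thesis
    using hL h(2) unfolding L_max_def distr_eq_def by blast
qed

text \<open>The derivative of q^d at q = 1 is d. Differentiation avoids the periods of the complex
  exponential that a single value of q would leave.\<close>

lemma powr_constant_exponent_zero:
  fixes d :: complex
  assumes "\<And>q. q > 0 \<Longrightarrow> complex_of_real q powr d = 1"
  shows "d = 0"
proof -
  have "((\<lambda>x. complex_of_real x powr d) has_vector_derivative d * complex_of_real 1 powr (d - 1)) (at 1)"
    by (rule has_vector_derivative_powr_Rplus) simp
  from has_vector_derivative_locally_const[OF this, of Rplus 1] assms show ?thesis
    by auto
qed

lemma Domain_H_op:
  assumes "\<bar>Re m\<bar> < 1" "cutoff_function \<xi> \<xi>1 \<xi>2 \<epsilon> R K" "cutoff_function \<eta> \<eta>1 \<eta>2 \<epsilon>' R' K'"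
  shows "Domain (H_op \<eta> m) = plus_span H2_0 (cut_power m \<xi>)"
proof -
  interpret a: cutoff_function \<xi> \<xi>1 \<xi>2 \<epsilon> R K by fact
  interpret b: cutoff_function \<eta> \<eta>1 \<eta>2 \<epsilon>' R' K' by fact
  have shift: "plus_span H2_0 (cut_power m \<zeta>) \<subseteq> plus_span H2_0 (cut_power m \<zeta>')"
    if "(\<lambda>x. cut_power m \<zeta> x - cut_power m \<zeta>' x) \<in> Cc_smooth Rplus" for \<zeta> \<zeta>'
  proof
    fix f assume "f \<in> plus_span H2_0 (cut_power m \<zeta>)"
    then obtain g c where g: "g \<in> H2_0" "ae_eq f (\<lambda>x. g x + c * cut_power m \<zeta> x)"
      unfolding plus_span_def by blast
    have "(\<lambda>x. g x + c * (cut_power m \<zeta> x - cut_power m \<zeta>' x)) \<in> H2_0"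
      by (intro a.H2_0_add g a.Cc_H2_0 Cc_smooth_scale that)
    moreover have "(\<lambda>x. g x + c * cut_power m \<zeta> x) = (\<lambda>x. (g x + c * (cut_power m \<zeta> x - cut_power m \<zeta>' x)) + c * cut_power m \<zeta>' x)"
      by (simp add: fun_eq_iff algebra_simps)
    ultimately show "f \<in> plus_span H2_0 (cut_power m \<zeta>')"
      using g(2) unfolding plus_span_def by auto
  qed
  have span: "plus_span H2_0 (cut_power m \<eta>) = plus_span H2_0 (cut_power m \<xi>)"
    using shift[OF cut_power_diff_Cc[OF assms(2,3)]] shift[OF cut_power_diff_Cc[OF assms(3,2)]] by blast
  \<comment> \<open>The restriction in \<open>H_op\<close> intersects the span with the domain of
    \<open>L_max\<close>; this shows that nothing is lost.\<close>
  have "\<exists>g. (f, g) \<in> L_max (m\<^sup>2)" if f: "f \<in> plus_span H2_0 (cut_power m \<eta>)" for f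
  proof -
    obtain g c where g: "g \<in> H2_0" "ae_eq f (\<lambda>x. g x + c * cut_power m \<eta> x)"
      using f unfolding plus_span_def by blast
    obtain g1 where g1: "(g, g1) \<in> L_max (m\<^sup>2)"
      using a.H2_0_imp_L_max[OF g(1)] by blast
    obtain g2 where g2: "(cut_power m \<eta>, g2) \<in> L_max (m\<^sup>2)"
      by (rule b.cut_power_L_max[of m]) (use assms(1) in auto)
    show ?thesis
      using L_max_add[OF g1 g2 g(2)] by blast
  qed
  then have "Domain (H_op \<eta> m) = plus_span H2_0 (cut_power m \<eta>)"
    unfolding H_op_def op_restrict_def a.Domain_L_min[OF assms(1)] by (auto simp: Domain_iff)
  then show ?thesis
    using span by simp
qed

lemma exponent_unique:
  assumes "\<bar>Re m1\<bar> < 1" "cutoff_function \<xi> \<xi>1 \<xi>2 \<epsilon> R K"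
    "cut_power m1 \<xi> \<in> plus_span H2_0 (cut_power m2 \<xi>)"
  shows "m1 = m2"
proof -
  interpret cutoff_function \<xi> \<xi>1 \<xi>2 \<epsilon> R K by fact
  obtain g c where g: "g \<in> H2_0" "ae_eq (cut_power m1 \<xi>) (\<lambda>x. g x + c * cut_power m2 \<xi> x)"
    using assms(3) unfolding plus_span_def by blast
  obtain G where G: "g \<in> L2" "G \<in> L2" "ae_eq g (prim2 G)"
    using H2_0_E[OF g(1)] by blast
  define u where "u x = cut_power m1 \<xi> x - c * cut_power m2 \<xi> x - prim2 G x" for x
  \<comment> \<open>By continuity the almost-everywhere identity holds at every positive x, so
    limits at 0 can be taken.\<close>
  have "continuous_on Rplus u"
    unfolding u_def cut_power_def by (intro continuous_intros prim2_continuous_Rplus G(2) smooth_on_continuous_on[OF smooth_on_powr]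
        smooth_on_continuous_on[OF xi_smooth(1)])
  moreover have "ae_eq u (\<lambda>x. 0)"
    using g(2) G(3) unfolding ae_eq_def by eventually_elim (simp add: u_def)
  ultimately have u: "u x = 0" if "0 < x" for x
    using continuous_ae_zero that by blast
  define d where "d = m2 - m1"
  define B where "B = 2 * L2_norm G"
  \<comment> \<open>The exponent is the gap between the order 3/2 of \<open>prim2 G\<close> and the
    order 1/2 + Re m1 of the power; it is positive because Re m1 < 1.\<close>
  have est: "cmod (1 - c * complex_of_real x powr d) \<le> x powr (1 - Re m1) * B" if x: "0 < x" "x < \<epsilon>" for x
  proof -
    let ?p = "\<lambda>\<beta>. complex_of_real x powr \<beta>"
    have "prim2 G x = ?p (1/2 + m1) - c * ?p (1/2 + m2)"
      using u[OF x(1)] xi_one[OF x] by (simp add: u_def cut_power_def)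
    also have "\<dots> = ?p (1/2 + m1) * (1 - c * ?p d)"
      using x by (simp add: d_def powr_add[symmetric] algebra_simps)
    finally have "x powr (1/2 + Re m1) * cmod (1 - c * ?p d) = cmod (prim2 G x)"
      using x by (simp add: norm_mult cmod_powr_Rplus)
    also have "\<dots> \<le> (x * sqrt x) * B"
      using prim2_bound[OF G(2), of x] x by (simp add: B_def mult_ac)
    also have "x * sqrt x = x powr (1/2 + Re m1) * x powr (1 - Re m1)"
    proof -
      have "x powr (1/2 + Re m1) * x powr (1 - Re m1) = x powr (1 + 1/2)"
        by (simp add: powr_add[symmetric])
      also have "\<dots> = x * sqrt x"
        using x unfolding powr_add by (simp add: powr_half_sqrt)
      finally show ?thesis ..
    qed
    finally show ?thesis
      using x by (simp add: mult.assoc)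
  qed
  have lim: "((\<lambda>x. c * complex_of_real x powr d) \<longlongrightarrow> 1) (at_right 0)"
  proof -
    have "((\<lambda>x::real. x powr (1 - Re m1) * B) \<longlongrightarrow> 0) (at_right 0)"
    proof -
      have "((\<lambda>x::real. x powr (1 - Re m1)) \<longlongrightarrow> 0 powr (1 - Re m1)) (at_right 0)"
        using assms(1) by (intro tendsto_powr') (auto intro!: eventually_at_rightI[of 0 1])
      then show ?thesis
        using tendsto_mult_left_zero by auto
    qed
    moreover have "\<forall>\<^sub>F x in at_right 0. norm (1 - c * complex_of_real x powr d) \<le> x powr (1 - Re m1) * B"
      using est eps_R by (intro eventually_at_rightI[of 0 \<epsilon>]) auto
    ultimately have "((\<lambda>x. 1 - c * complex_of_real x powr d) \<longlongrightarrow> 0) (at_right 0)"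
      by (rule Lim_null_comparison[rotated])
    from tendsto_diff[OF tendsto_const[of 1] this] show ?thesis
      by simp
  qed
  have "complex_of_real q powr d = 1" if q: "q > 0" for q
  proof -
    have "filterlim (\<lambda>x. q * x) (at_right 0) (at_right 0)"
      using q by real_asymp
    from filterlim_compose[OF lim this] have "((\<lambda>x. c * complex_of_real (q * x) powr d) \<longlongrightarrow> 1) (at_right 0)" .
    moreover have "\<forall>\<^sub>F x in at_right 0. c * complex_of_real (q * x) powr d = complex_of_real q powr d * (c * complex_of_real x powr d)"
      using q by (intro eventually_at_rightI[of 0 1]) (auto simp: powr_times_real)
    ultimately have "((\<lambda>x. complex_of_real q powr d * (c * complex_of_real x powr d)) \<longlongrightarrow> 1) (at_right 0)"
      using tendsto_cong by fast
    moreover have "((\<lambda>x. complex_of_real q powr d * (c * complex_of_real x powr d)) \<longlongrightarrow> complex_of_real q powr d * 1) (at_right 0)"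
      by (intro tendsto_mult tendsto_const lim)
    ultimately show ?thesis
      using tendsto_unique[of "at_right (0::real)"] by auto
  qed
  then have "d = 0"
    by (rule powr_constant_exponent_zero)
  then show ?thesis
    by (simp add: d_def)
qed

theorem theorem4p4:
  fixes \<xi> :: "real \<Rightarrow> complex"
  assumes "\<xi> \<in> cutoffs"
  shows "(\<forall>m. \<bar>Re m\<bar> < 1 \<longrightarrow>
            (\<forall>\<eta>\<in>cutoffs. Domain (H_op \<eta> m) = plus_span H2_0 (cut_power m \<xi>))) \<and>
         (\<forall>m\<^sub>1 m\<^sub>2. m\<^sub>1 \<noteq> m\<^sub>2 \<and> \<bar>Re m\<^sub>1\<bar> < 1 \<and> \<bar>Re m\<^sub>2\<bar> < 1 \<longrightarrow>
            (\<forall>\<eta>\<^sub>1\<in>cutoffs. \<forall>\<eta>\<^sub>2\<in>cutoffs. Domain (H_op \<eta>\<^sub>1 m\<^sub>1) \<noteq> Domain (H_op \<eta>\<^sub>2 m\<^sub>2)))"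
proof -
  obtain \<xi>1 \<xi>2 \<epsilon> R K where xi: "cutoff_function \<xi> \<xi>1 \<xi>2 \<epsilon> R K"
    using cutoffs_cutoff_function[OF assms] by blast
  have dom: "Domain (H_op \<eta> m) = plus_span H2_0 (cut_power m \<xi>)" if m: "\<bar>Re m\<bar> < 1" and eta: "\<eta> \<in> cutoffs" for m \<eta>
  proof -
    obtain \<eta>1 \<eta>2 \<epsilon>' R' K' where "cutoff_function \<eta> \<eta>1 \<eta>2 \<epsilon>' R' K'"
      using cutoffs_cutoff_function[OF eta] by blast
    then show ?thesis
      by (rule Domain_H_op[OF m xi])
  qed
  have "Domain (H_op \<eta>1 m1) \<noteq> Domain (H_op \<eta>2 m2)"
    if m: "m1 \<noteq> m2" "\<bar>Re m1\<bar> < 1" "\<bar>Re m2\<bar> < 1" and eta: "\<eta>1 \<in> cutoffs" "\<eta>2 \<in> cutoffs" for m1 m2 \<eta>1 \<eta>2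
  proof
    assume "Domain (H_op \<eta>1 m1) = Domain (H_op \<eta>2 m2)"
    \<comment> \<open>The first claim rewrites both domains with the same \<xi>, so that only the
      exponents differ.\<close>
    then have eq: "plus_span H2_0 (cut_power m1 \<xi>) = plus_span H2_0 (cut_power m2 \<xi>)"
      using dom m eta by simp
    have "(\<lambda>x. 0) \<in> Cc_smooth Rplus"
      by (rule Cc_smoothI[of _ 1 2]) (auto intro: smooth_on_const)
    then have "(\<lambda>x. 0) \<in> H2_0"
      by (rule cutoff_function.Cc_H2_0[OF xi])
    then have "cut_power m1 \<xi> \<in> plus_span H2_0 (cut_power m1 \<xi>)"
      unfolding plus_span_def ae_eq_def by (intro CollectI bexI[of _ "\<lambda>x. 0"] exI[of _ 1]) auto
    then have "m1 = m2"
      using exponent_unique[OF m(2) xi] eq by simp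
    with m(1) show False ..
  qed
  with dom show ?thesis
    by blast
qed

end
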